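(* Let $M$ be a simple connected binary matroid, and let $e$ and $f$ be distinct elements of $M$. Then every circuit of $M$ containing $\{e,f\}$ is spanning if and only if the canonical tree decomposition of $M$ is a path $\mathcal{P}$ with vertices, in order, $P_0,P_1,\dots,P_n$ (where $n\ge 0$) such that (i) each vertex is labeled by a circuit of size at least three, by $U_{1,3}$, or by a copy of $Z_r\backslash y_r$ for some $r\geq 3$; (ii) neither $P_0$ nor $P_n$ is labeled by $U_{1,3}$; (iii) if $n=0$ and $P_0$ is a binary spike with a tip and a cotip, then this pair of elements (tip and cotip) is $\{e,f\}$; (iv) if $n\geq 1$, then one of $e$ and $f$ is in $E(P_0)$ and the other is in $E(P_n)$, and, when $P_i$ is labeled by a spike with a tip and a cotip, (a) for $0<i<n$, the tip and the cotip are the two basepoints of $P_i$, and (b) for $i\in\{0,n\}$, the pair consisting of the tip and the cotip coincides with the pair consisting of the single basepoint in $P_i$ and the single member of $\{e,f\}$ in $P_i$.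
   Context: All matroids are finite. A circuit $C$ of a matroid $M$ is spanning if $r_M(C)=r(M)$. $U_{k,n}$ denotes the uniform matroid of rank $k$ on $n$ elements. A vertex of a tree decomposition is "labeled by" a matroid $N$ if its label is isomorphic to $N$; "labeled by a circuit" of size $k$ means the label is isomorphic to $U_{k-1,k}$, and "labeled by a cocircuit" means the label is isomorphic to $U_{1,k}$ for some $k$. Spikes. For $r\geq 3$, $Z_r$ is the rank-$r$ binary spike with tip $t$: the binary matroid on $\{x_1,y_1,x_2,y_2,\dots,x_r,y_r,t\}$ represented over $\mathrm{GF}(2)$ by letting $x_1,\dots,x_r$ be the standard basis vectors of $\mathrm{GF}(2)^r$, $t$ the all-ones vector, and $y_i=x_i+t$ (so each $\{x_i,y_i,t\}$ is a triangle). The matroid $Z_r\backslash y_r$ is called a rank-$r$ binary spike with tip $t$ and cotip $x_r$. If a matroid $P$ is isomorphic to $Z_r\backslash y_r$, the statement that a given pair of elements of $P$ is the pair consisting of the tip and the cotip means that there is an isomorphism from $P$ to $Z_r\backslash y_r$ mapping this pair (as an unordered pair) to $\{t,x_r\}$. (When $r=3$, $Z_3\backslash y_3\cong M(K_4)$ and there is more than one such pair.) 2-sums. If $M_1$ and $M_2$ are connected matroids, each with at least three elements and with $E(M_1)\cap E(M_2)=\{p\}$, then $M_1\oplus_2 M_2$ is the 2-sum with basepoint $p$: the matroid on $(E(M_1)\cup E(M_2))-\{p\}$ whose circuits are the circuits of $M_1$ avoiding $p$, the circuits of $M_2$ avoiding $p$, and all sets $(C_1\cup C_2)-\{p\}$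 where $C_i$ is a circuit of $M_i$ containing $p$. Tree decompositions. A tree decomposition of a connected matroid $M$ is a tree $\mathcal{T}$ with vertex set $\{M_1,\dots,M_k\}$, where each $M_i$ is a connected matroid (the label of that vertex), and edge set $\{e_1,\dots,e_{k-1}\}$, such that (i) $E(M)=(E(M_1)\cup\dots\cup E(M_k))-\{e_1,\dots,e_{k-1}\}$; (ii) if $M_{j_1}$ and $M_{j_2}$ are joined by an edge $e_i$, then $E(M_{j_1})\cap E(M_{j_2})=\{e_i\}$, and otherwise $E(M_{j_1})\cap E(M_{j_2})=\emptyset$; (iii) $|E(M_i)|\geq 3$ for all $i$ unless $|E(M)|<3$, in which case $k=1$ and $M_1=M$; and (iv) $M$ can be obtained from $\mathcal{T}$ by repeatedly taking an edge $e_i$ with ends $M_{j_1}$ and $M_{j_2}$, contracting $e_i$ from the current tree, and labeling the resulting composite vertex by $M_{j_1}\oplus_2 M_{j_2}$. The basepoints of a vertex $M_j$ are the elements of $E(M_j)$ that are edges of $\mathcal{T}$. By a theorem of Cunningham and Edmonds, every connected matroid $M$ has a tree decomposition, unique up to its edge labels, in which every vertex is labeled by a circuit, a cocircuit, or a 3-connected matroid with at least four elements, and no two adjacent vertices are both labeled by circuits or both labeled by cocircuits. This is the canonical tree decomposition of $M$. *)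

theory Defs
  imports Main "HOL-Library.Z2"
begin

section \<open>Finite matroids\<close>

record 'a matroid =
  ground :: "'a set"
  indeps :: "'a set set"

definition matroid :: "'a matroid \<Rightarrow> bool" where
  "matroid M \<longleftrightarrow>
     finite (ground M) \<and>
     indeps M \<subseteq> Pow (ground M) \<and>
     {} \<in> indeps M \<and>
     (\<forall>I \<in> indeps M. \<forall>J. J \<subseteq> I \<longrightarrow> J \<in> indeps M) \<and>
     (\<forall>I \<in> indeps M. \<forall>J \<in> indeps M. card I < card J \<longrightarrow>
        (\<exists>x \<in> J - I. insert x I \<in> indeps M))"

definition circuit :: "'a matroid \<Rightarrow> 'a set \<Rightarrow> bool" where
  "circuit M C \<longleftrightarrow> C \<subseteq> ground M \<and> C \<notin> indeps M \<and> (\<forall>D. D \<subset> C \<longrightarrow> D \<in> indeps M)"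

definition matroid_rank :: "'a matroid \<Rightarrow> 'a set \<Rightarrow> nat" where
  "matroid_rank M X = Max (card ` {I \<in> indeps M. I \<subseteq> X})"

definition spanning :: "'a matroid \<Rightarrow> 'a set \<Rightarrow> bool" where
  "spanning M X \<longleftrightarrow> matroid_rank M X = matroid_rank M (ground M)"

definition simple_matroid :: "'a matroid \<Rightarrow> bool" where
  "simple_matroid M \<longleftrightarrow> \<not> (\<exists>C. circuit M C \<and> card C \<le> 2)"

definition connected_matroid :: "'a matroid \<Rightarrow> bool" where
  "connected_matroid M \<longleftrightarrow>
     (\<forall>x \<in> ground M. \<forall>y \<in> ground M. x \<noteq> y \<longrightarrow> (\<exists>C. circuit M C \<and> x \<in> C \<and> y \<in> C))"

text \<open>Tutte connectivity. The inequality is \<open>r(X) + r(E - X) - r(M) < k\<close>.\<close>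

definition matroid_separation :: "'a matroid \<Rightarrow> nat \<Rightarrow> 'a set \<Rightarrow> bool" where
  "matroid_separation M k X \<longleftrightarrow>
     X \<subseteq> ground M \<and> k \<le> card X \<and> k \<le> card (ground M - X) \<and>
     matroid_rank M X + matroid_rank M (ground M - X) < matroid_rank M (ground M) + k"

definition n_connected_matroid :: "nat \<Rightarrow> 'a matroid \<Rightarrow> bool" where
  "n_connected_matroid n M \<longleftrightarrow> (\<forall>k. 1 \<le> k \<and> k < n \<longrightarrow> \<not> (\<exists>X. matroid_separation M k X))"

definition matroid_iso :: "('a \<Rightarrow> 'b) \<Rightarrow> 'a matroid \<Rightarrow> 'b matroid \<Rightarrow> bool" where
  "matroid_iso \<phi> M N \<longleftrightarrow>
     bij_betw \<phi> (ground M) (ground N) \<and>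
     (\<forall>X. X \<subseteq> ground M \<longrightarrow> (X \<in> indeps M \<longleftrightarrow> \<phi> ` X \<in> indeps N))"

definition isomorphic_matroid :: "'a matroid \<Rightarrow> 'b matroid \<Rightarrow> bool" where
  "isomorphic_matroid M N \<longleftrightarrow> (\<exists>\<phi>. matroid_iso \<phi> M N)"

definition relabel :: "('a \<Rightarrow> 'b) \<Rightarrow> 'a matroid \<Rightarrow> 'b matroid" where
  "relabel \<phi> M = \<lparr>ground = \<phi> ` ground M, indeps = (\<lambda>I. \<phi> ` I) ` indeps M\<rparr>"

definition delete_elements :: "'a matroid \<Rightarrow> 'a set \<Rightarrow> 'a matroid" where
  "delete_elements M D = \<lparr>ground = ground M - D, indeps = {I \<in> indeps M. I \<inter> D = {}}\<rparr>"

definition uniform_matroid :: "nat \<Rightarrow> nat \<Rightarrow> nat matroid" where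
  "uniform_matroid k n =
     \<lparr>ground = {..<n}, indeps = {I. I \<subseteq> {..<n} \<and> card I \<le> k}\<rparr>"

text \<open>
  The columns of the matrix \<open>A\<close>, with rows \<open>1, \<dots>, m\<close>, are indexed by the ground set. Independence
  is that of the family of columns, so equal columns at distinct indices are dependent.
\<close>

definition independent_columns :: "nat \<Rightarrow> (nat \<Rightarrow> 'a \<Rightarrow> 'f::field) \<Rightarrow> 'a set \<Rightarrow> bool" where
  "independent_columns m A X \<longleftrightarrow>
     (\<forall>c. (\<forall>i \<in> {1..m}. (\<Sum>x\<in>X. c x * A i x) = 0) \<longrightarrow> (\<forall>x\<in>X. c x = 0))"

definition vector_matroid :: "nat \<Rightarrow> (nat \<Rightarrow> 'a \<Rightarrow> 'f::field) \<Rightarrow> 'a set \<Rightarrow> 'a matroid" where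
  "vector_matroid m A E = \<lparr>ground = E, indeps = {X. X \<subseteq> E \<and> independent_columns m A X}\<rparr>"

text \<open>The field \<open>GF(2)\<close> is the type \<^typ>\<open>bit\<close>.\<close>

definition binary_matroid :: "'a matroid \<Rightarrow> bool" where
  "binary_matroid M \<longleftrightarrow>
     (\<exists>m (A :: nat \<Rightarrow> 'a \<Rightarrow> bit). M = vector_matroid m A (ground M))"


section \<open>Binary spikes\<close>

datatype spike_elem = SX nat | SY nat | STip

fun spike_matrix :: "nat \<Rightarrow> spike_elem \<Rightarrow> bit" where
  "spike_matrix i (SX j) = (if i = j then 1 else 0)"
| "spike_matrix i STip = 1"
| "spike_matrix i (SY j) = (if i = j then 1 else 0) + 1"

definition tipped_spike :: "nat \<Rightarrow> spike_elem matroid" where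
  "tipped_spike r = vector_matroid r spike_matrix (SX ` {1..r} \<union> SY ` {1..r} \<union> {STip})"

definition cotipped_spike :: "nat \<Rightarrow> spike_elem matroid" where
  "cotipped_spike r = delete_elements (tipped_spike r) {SY r}"

text \<open>
  \<open>S\<close> is the unordered pair consisting of the tip and the cotip of \<open>P\<close>, for some identification of
  \<open>P\<close> with the spike. The inclusion is needed because \<open>\<phi>\<close> is unconstrained off the ground set.
\<close>

definition tip_cotip_pair :: "nat \<Rightarrow> 'a matroid \<Rightarrow> 'a set \<Rightarrow> bool" where
  "tip_cotip_pair r P S \<longleftrightarrow>
     S \<subseteq> ground P \<and> (\<exists>\<phi>. matroid_iso \<phi> P (cotipped_spike r) \<and> \<phi> ` S = {STip, SX r})"

definition labeled_circuit :: "nat \<Rightarrow> 'a matroid \<Rightarrow> bool" where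
  "labeled_circuit k N \<longleftrightarrow> 1 \<le> k \<and> isomorphic_matroid N (uniform_matroid (k - 1) k)"

definition labeled_cocircuit :: "nat \<Rightarrow> 'a matroid \<Rightarrow> bool" where
  "labeled_cocircuit k N \<longleftrightarrow> 1 \<le> k \<and> isomorphic_matroid N (uniform_matroid 1 k)"


section \<open>2-sums\<close>

definition two_sum_circuits :: "'a \<Rightarrow> 'a matroid \<Rightarrow> 'a matroid \<Rightarrow> 'a set set" where
  "two_sum_circuits p M1 M2 =
     {C. circuit M1 C \<and> p \<notin> C} \<union> {C. circuit M2 C \<and> p \<notin> C} \<union>
     {(C1 \<union> C2) - {p} | C1 C2. circuit M1 C1 \<and> p \<in> C1 \<and> circuit M2 C2 \<and> p \<in> C2}"

text \<open>
  The matroid with these circuits. The definition is meant for connected \<open>M1\<close>, \<open>M2\<close> with at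
  least three elements each and \<open>p\<close> as their only common element.
\<close>

definition two_sum :: "'a \<Rightarrow> 'a matroid \<Rightarrow> 'a matroid \<Rightarrow> 'a matroid" where
  "two_sum p M1 M2 =
     \<lparr>ground = (ground M1 \<union> ground M2) - {p},
      indeps = {I. I \<subseteq> (ground M1 \<union> ground M2) - {p} \<and>
                   (\<forall>C \<in> two_sum_circuits p M1 M2. \<not> C \<subseteq> I)}\<rparr>"


section \<open>Tree decompositions\<close>

text \<open>
  The vertices are the labels themselves. This loses nothing: in a tree decomposition
  labels at distinct vertices have at least three elements and share at most one. The edges are matroid elements, and \<open>tends\<close>
  gives the set of ends of an edge; it is only relevant on \<open>tedges\<close>.
\<close>

record 'a matroid_graph =
  tverts :: "'a matroid set"
  tedges :: "'a set"
  tends :: "'a \<Rightarrow> 'a matroid set"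

definition tadjacent :: "'a matroid_graph \<Rightarrow> ('a matroid \<times> 'a matroid) set" where
  "tadjacent T = {(N1, N2). \<exists>x \<in> tedges T. tends T x = {N1, N2}}"

text \<open>A cycle has length at least two, the case of length two being a pair of parallel edges.\<close>

definition tcycle :: "'a matroid_graph \<Rightarrow> 'a matroid list \<Rightarrow> 'a list \<Rightarrow> bool" where
  "tcycle T Ns xs \<longleftrightarrow>
     length Ns = length xs \<and> 2 \<le> length xs \<and> distinct Ns \<and> distinct xs \<and> set xs \<subseteq> tedges T \<and>
     (\<forall>i < length xs. tends T (xs ! i) = {Ns ! i, Ns ! (Suc i mod length Ns)})"

definition is_tree :: "'a matroid_graph \<Rightarrow> bool" where
  "is_tree T \<longleftrightarrow>
     finite (tverts T) \<and> tverts T \<noteq> {} \<and> finite (tedges T) \<and>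
     (\<forall>x \<in> tedges T. tends T x \<subseteq> tverts T \<and> card (tends T x) = 2) \<and>
     (\<forall>N1 \<in> tverts T. \<forall>N2 \<in> tverts T. (N1, N2) \<in> (tadjacent T)\<^sup>*) \<and>
     \<not> (\<exists>Ns xs. tcycle T Ns xs)"

text \<open>Contraction of the edge \<open>x\<close>, labeling the composite vertex by the 2-sum of the ends of \<open>x\<close>.\<close>

definition contract_edge ::
    "'a matroid_graph \<Rightarrow> 'a \<Rightarrow> 'a matroid \<Rightarrow> 'a matroid \<Rightarrow> 'a matroid_graph" where
  "contract_edge T x N1 N2 =
     \<lparr>tverts = insert (two_sum x N1 N2) (tverts T - {N1, N2}),
      tedges = tedges T - {x},
      tends = (\<lambda>y. (\<lambda>N. if N \<in> {N1, N2} then two_sum x N1 N2 else N) ` tends T y)\<rparr>"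

definition contract_step :: "'a matroid_graph \<Rightarrow> 'a matroid_graph \<Rightarrow> bool" where
  "contract_step T T' \<longleftrightarrow>
     (\<exists>x \<in> tedges T. \<exists>N1 N2. tends T x = {N1, N2} \<and> T' = contract_edge T x N1 N2)"

text \<open>
  The edges are elements of the same type as those of \<open>M\<close>, but lie outside \<open>ground M\<close>. To have
  enough of them for \<open>M :: 'a matroid\<close>, decompose the copy \<open>relabel Inl M\<close> over \<open>'a + nat\<close>.
  In the contractions, the hypotheses of the 2-sum hold initially and persist, since 2-sums of
  connected matroids are connected.
\<close>

definition tree_decomposition :: "'a matroid_graph \<Rightarrow> 'a matroid \<Rightarrow> bool" where
  "tree_decomposition T M \<longleftrightarrow>
     is_tree T \<and>
     (\<forall>N \<in> tverts T. matroid N \<and> connected_matroid N) \<and>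
     ground M = (\<Union>N \<in> tverts T. ground N) - tedges T \<and>
     (\<forall>x \<in> tedges T. \<forall>N1 N2. tends T x = {N1, N2} \<longrightarrow> ground N1 \<inter> ground N2 = {x}) \<and>
     (\<forall>N1 \<in> tverts T. \<forall>N2 \<in> tverts T.
        N1 \<noteq> N2 \<and> (N1, N2) \<notin> tadjacent T \<longrightarrow> ground N1 \<inter> ground N2 = {}) \<and>
     (if card (ground M) < 3 then tverts T = {M}
      else (\<forall>N \<in> tverts T. 3 \<le> card (ground N))) \<and>
     (\<exists>T'. contract_step\<^sup>*\<^sup>* T T' \<and> tverts T' = {M} \<and> tedges T' = {})"

definition basepoints :: "'a matroid_graph \<Rightarrow> 'a matroid \<Rightarrow> 'a set" where
  "basepoints T N = ground N \<inter> tedges T"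

definition canonical_tree_decomposition :: "'a matroid_graph \<Rightarrow> 'a matroid \<Rightarrow> bool" where
  "canonical_tree_decomposition T M \<longleftrightarrow>
     tree_decomposition T M \<and>
     (\<forall>N \<in> tverts T.
        (\<exists>k. labeled_circuit k N) \<or> (\<exists>k. labeled_cocircuit k N) \<or>
        (n_connected_matroid 3 N \<and> 4 \<le> card (ground N))) \<and>
     (\<forall>(N1, N2) \<in> tadjacent T.
        \<not> ((\<exists>k. labeled_circuit k N1) \<and> (\<exists>k. labeled_circuit k N2)) \<and>
        \<not> ((\<exists>k. labeled_cocircuit k N1) \<and> (\<exists>k. labeled_cocircuit k N2)))"

definition is_path :: "'a matroid_graph \<Rightarrow> nat \<Rightarrow> (nat \<Rightarrow> 'a matroid) \<Rightarrow> bool" where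
  "is_path T n P \<longleftrightarrow>
     inj_on P {0..n} \<and> tverts T = P ` {0..n} \<and>
     (\<exists>b. tedges T = b ` {0..<n} \<and> (\<forall>i<n. tends T (b i) = {P i, P (Suc i)}))"

end

theory Submission
  imports Defs
begin

text \<open>
  Suppose that all circuits through \<open>e\<close> and \<open>f\<close> are spanning, and let \<open>{e, f} \<union> X\<close> be one of them.
  Every other element \<open>z\<close> is a chord, lying in a circuit \<open>{z, e} \<union> A z\<close> with \<open>A z \<subseteq> X\<close>, since otherwise
  there would be a shorter circuit through \<open>e\<close> and \<open>f\<close>. If \<open>A z\<close> and \<open>A w\<close> are incomparable, then
  \<open>{e, f, z, w}\<close> together with the elements of \<open>X\<close> outside the symmetric difference of \<open>A z\<close> and
  \<open>A w\<close> is a circuit, and comparing sizes shows that \<open>A z\<close> and \<open>A w\<close> differ by exchanging one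
  element. Such a family of sets is a chain whose links are single sets (copies of \<open>U\<^sub>1\<^sub>,\<^sub>3\<close>) and
  levels of equicardinal sets (spikes), separated by parts of \<open>X\<close> without chords (circuits). Cutting
  along the chain displays \<open>M\<close> as the 2-sum of a path of such matroids.

  Conversely, the property that deleting an element from a circuit through \<open>s\<close> and \<open>t\<close> always leaves
  a maximal independent set passes from \<open>(N\<^sub>1, s, p)\<close> and \<open>(N\<^sub>2, p, t)\<close> to the 2-sum of \<open>N\<^sub>1\<close> and \<open>N\<^sub>2\<close>
  with basepoint \<open>p\<close>, and it holds for each of the three kinds of labels.
\<close>

section \<open>Binary matroids as cycle spaces\<close>

text \<open>Linear algebra over GF(2) becomes set algebra: a vector is its support, addition is
  symmetric difference, orthogonality to a row is evenness of an intersection. The matroid is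
  carried by \<open>A\<close>, \<open>e\<close>, \<open>f\<close>, \<open>X\<close>,
  \<open>Z\<close>, and a cut of the chain cuts these data: chords before the cut avoid the later
  part of \<open>X\<close>, chords after it contain the earlier part, which makes the parity
  conditions split over a 2-sum. Interchanging \<open>e\<close> and \<open>f\<close> complements
  each \<open>A z\<close>, so spikes with the tip at either end are handled at once. The exchange
  condition is a count: the circuit through \<open>e\<close>, \<open>f\<close>, \<open>z\<close>,
  \<open>w\<close> has \<open>4 + |X| - d\<close> elements, \<open>d\<close> being the size of the
  symmetric difference, and it must have \<open>|X| + 2\<close>, so \<open>d = 2\<close>. Simplicity
  makes each \<open>A z \<inter> X\<close> a nonempty proper subset of \<open>X\<close>, which keeps
  \<open>U_{1,3}\<close> away from the ends of the path. In the converse the contractions come in an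
  arbitrary order, so the property followed must survive the contraction of any edge.\<close>

definition cycle_space :: "'a set \<Rightarrow> 'a set set \<Rightarrow> bool" where
  "cycle_space E Cy \<longleftrightarrow>
     finite E \<and> Cy \<subseteq> Pow E \<and> {} \<in> Cy \<and> (\<forall>S \<in> Cy. \<forall>T \<in> Cy. sym_diff S T \<in> Cy)"

text \<open>\<open>Cy\<close> is thought of as the kernel of a matrix over GF(2), each kernel vector
  being given by its support. Independence of a set of columns then means that it supports no
  nonzero kernel vector.\<close>

definition cycle_matroid :: "'a set \<Rightarrow> 'a set set \<Rightarrow> 'a matroid" where
  "cycle_matroid E Cy = \<lparr>ground = E, indeps = {I. I \<subseteq> E \<and> (\<forall>S \<in> Cy. S \<subseteq> I \<longrightarrow> S = {})}\<rparr>"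

lemma ground_cycle_matroid [simp]: "ground (cycle_matroid E Cy) = E"
  by (simp add: cycle_matroid_def)

lemma indeps_cycle_matroid:
  "I \<in> indeps (cycle_matroid E Cy) \<longleftrightarrow> I \<subseteq> E \<and> (\<forall>S \<in> Cy. S \<subseteq> I \<longrightarrow> S = {})"
  by (simp add: cycle_matroid_def)

lemma cycle_space_sym_diff:
  "cycle_space E Cy \<Longrightarrow> S \<in> Cy \<Longrightarrow> T \<in> Cy \<Longrightarrow> sym_diff S T \<in> Cy"
  by (simp add: cycle_space_def)

text \<open>The parity of the intersection with \<open>D\<close> is the inner product with
  \<open>D\<close> over GF(2); this is its linearity, which makes systems of parity conditions
  define cycle spaces.\<close>

lemma even_card_sym_diff:
  assumes "finite S" "finite T"
  shows "even (card (sym_diff S T \<inter> D)) \<longleftrightarrow> (even (card (S \<inter> D)) \<longleftrightarrow> even (card (T \<inter> D)))"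
proof -
  have 1: "sym_diff S T \<inter> D = ((S - T) \<inter> D) \<union> ((T - S) \<inter> D)" by blast
  have 2: "S \<inter> D = ((S - T) \<inter> D) \<union> (S \<inter> T \<inter> D)" by blast
  have 3: "T \<inter> D = ((T - S) \<inter> D) \<union> (S \<inter> T \<inter> D)" by blast
  have "card (sym_diff S T \<inter> D) = card ((S - T) \<inter> D) + card ((T - S) \<inter> D)"
    unfolding 1 using assms by (intro card_Un_disjoint) auto
  moreover have "card (S \<inter> D) = card ((S - T) \<inter> D) + card (S \<inter> T \<inter> D)"
    by (subst 2, intro card_Un_disjoint) (use assms in auto)
  moreover have "card (T \<inter> D) = card ((T - S) \<inter> D) + card (S \<inter> T \<inter> D)"
    by (subst 3, intro card_Un_disjoint) (use assms in auto)
  ultimately show ?thesis by auto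
qed

lemma even_card_Int_insert:
  assumes "finite D" "a \<notin> D"
  shows "even (card (S \<inter> insert a D)) \<longleftrightarrow> (even (card (S \<inter> D)) \<longleftrightarrow> a \<notin> S)"
proof (cases "a \<in> S")
  case True
  then have "S \<inter> insert a D = insert a (S \<inter> D)" by blast
  then show ?thesis using assms True by simp
qed simp

text \<open>
  If no element of \<open>J - I\<close> extends \<open>I\<close>, every subset of \<open>J\<close> is congruent to a subset of \<open>I\<close> modulo
  the cycle space, so augmentation follows by the pigeonhole principle on power sets.
\<close>

lemma matroid_cycle_matroid:
  assumes cs: "cycle_space E Cy"
  shows "matroid (cycle_matroid E Cy)"
proof -
  have fin: "finite E" and sub: "Cy \<subseteq> Pow E" and em: "{} \<in> Cy"
    using cs by (auto simp: cycle_space_def)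
  have aug: "\<exists>x \<in> J - I. insert x I \<in> indeps (cycle_matroid E Cy)"
    if I: "I \<in> indeps (cycle_matroid E Cy)" and J: "J \<in> indeps (cycle_matroid E Cy)"
      and less: "card I < card J" for I J
  proof (rule ccontr)
    assume no: "\<not> (\<exists>x \<in> J - I. insert x I \<in> indeps (cycle_matroid E Cy))"
    have IE: "I \<subseteq> E" and JE: "J \<subseteq> E" using I J by (auto simp: indeps_cycle_matroid)
    have finI: "finite I" "finite J" using IE JE fin finite_subset by auto
    have D: "\<exists>R. R \<subseteq> I \<and> insert x R \<in> Cy" if x: "x \<in> J - I" for x
    proof -
      have "insert x I \<notin> indeps (cycle_matroid E Cy)" using no x by blast
      then obtain S where S: "S \<in> Cy" "S \<subseteq> insert x I" "S \<noteq> {}"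
        using IE JE x by (auto simp: indeps_cycle_matroid)
      have "x \<in> S"
        using I S by (auto simp: indeps_cycle_matroid)
      then have "insert x (S - {x}) \<in> Cy" "S - {x} \<subseteq> I"
        using S by (auto simp: insert_absorb)
      then show ?thesis by blast
    qed
    have cong: "\<exists>R. R \<subseteq> I \<and> sym_diff S R \<in> Cy" if "finite S" "S \<subseteq> J" for S
      using that
    proof (induction S rule: finite_induct)
      case empty
      then show ?case using em by auto
    next
      case (insert x S)
      then obtain R where R: "R \<subseteq> I" "sym_diff S R \<in> Cy" by auto
      show ?case
      proof (cases "x \<in> I")
        case True
        have "sym_diff (insert x S) (sym_diff R {x}) = sym_diff S R"
          using insert.hyps by blast
        moreover have "sym_diff R {x} \<subseteq> I" using R True by blast
        ultimately show ?thesis using R by metis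
      next
        case False
        then obtain R' where R': "R' \<subseteq> I" "insert x R' \<in> Cy"
          using D insert.prems by blast
        have "sym_diff (sym_diff S R) (insert x R') \<in> Cy"
          using cycle_space_sym_diff[OF cs] R R' by blast
        moreover have "sym_diff (sym_diff S R) (insert x R') = sym_diff (insert x S) (sym_diff R R')"
          using insert.hyps False R R' by blast
        moreover have "sym_diff R R' \<subseteq> I" using R R' by blast
        ultimately show ?thesis by metis
      qed
    qed
    define g where "g S = (SOME R. R \<subseteq> I \<and> sym_diff S R \<in> Cy)" for S
    have g: "g S \<subseteq> I \<and> sym_diff S (g S) \<in> Cy" if "S \<subseteq> J" for S
      unfolding g_def by (rule someI_ex) (use cong that finI finite_subset in blast)
    \<comment> \<open>Subsets of \<open>J\<close> with the same representative differ by a cycle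
      inside \<open>J\<close>, and independence of \<open>J\<close> makes this cycle empty.\<close>
    have "inj_on g (Pow J)"
    proof (rule inj_onI)
      fix S T assume ST: "S \<in> Pow J" "T \<in> Pow J" "g S = g T"
      have "sym_diff (sym_diff S (g S)) (sym_diff T (g T)) \<in> Cy"
        by (rule cycle_space_sym_diff[OF cs]) (use ST g in blast)+
      moreover have "sym_diff (sym_diff S (g S)) (sym_diff T (g T)) = sym_diff S T"
        unfolding ST(3) by blast
      moreover have "sym_diff S T \<subseteq> J" using ST by blast
      ultimately have "sym_diff S T = {}"
        using J unfolding indeps_cycle_matroid by metis
      then show "S = T" by blast
    qed
    moreover have "g ` Pow J \<subseteq> Pow I" using g by blast
    ultimately have "card (Pow J) \<le> card (Pow I)"
      using finI by (intro card_inj_on_le) auto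
    then show False using less finI by (simp add: card_Pow)
  qed
  show ?thesis
    unfolding matroid_def
  proof (intro conjI ballI allI impI)
    show "finite (ground (cycle_matroid E Cy))" using fin by simp
    show "indeps (cycle_matroid E Cy) \<subseteq> Pow (ground (cycle_matroid E Cy))"
      by (auto simp: indeps_cycle_matroid)
    show "{} \<in> indeps (cycle_matroid E Cy)" by (auto simp: indeps_cycle_matroid)
    show "J \<in> indeps (cycle_matroid E Cy)"
      if "I \<in> indeps (cycle_matroid E Cy)" "J \<subseteq> I" for I J
      using that by (auto simp: indeps_cycle_matroid)
  qed (rule aug)
qed

lemma cycle_dependent:
  "S \<in> Cy \<Longrightarrow> S \<subseteq> I \<Longrightarrow> S \<noteq> {} \<Longrightarrow> I \<notin> indeps (cycle_matroid E Cy)"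
  by (auto simp: indeps_cycle_matroid)

lemma circuit_cycle_matroid:
  assumes "Cy \<subseteq> Pow E"
  shows "circuit (cycle_matroid E Cy) C \<longleftrightarrow>
    C \<in> Cy \<and> C \<noteq> {} \<and> (\<forall>S \<in> Cy. S \<subseteq> C \<longrightarrow> S = {} \<or> S = C)"
proof
  assume C: "circuit (cycle_matroid E Cy) C"
  then obtain S where S: "S \<in> Cy" "S \<subseteq> C" "S \<noteq> {}"
    by (auto simp: circuit_def indeps_cycle_matroid)
  have eq: "T = C" if "T \<in> Cy" "T \<subseteq> C" "T \<noteq> {}" for T
    using C that cycle_dependent[of T Cy T E] unfolding circuit_def by blast
  show "C \<in> Cy \<and> C \<noteq> {} \<and> (\<forall>S \<in> Cy. S \<subseteq> C \<longrightarrow> S = {} \<or> S = C)"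
    using S eq by blast
next
  assume "C \<in> Cy \<and> C \<noteq> {} \<and> (\<forall>S \<in> Cy. S \<subseteq> C \<longrightarrow> S = {} \<or> S = C)"
  then show "circuit (cycle_matroid E Cy) C"
    using assms unfolding circuit_def indeps_cycle_matroid ground_cycle_matroid by blast
qed

text \<open>A minimal cycle among those through \<open>x\<close> inside \<open>S\<close> is minimal
  among all nonempty cycles: a smaller nonempty cycle \<open>T\<close> avoiding \<open>x\<close>
  could be added, leaving the smaller cycle \<open>C - T\<close> that still contains
  \<open>x\<close>.\<close>

lemma cycle_contains_circuit_through:
  assumes cs: "cycle_space E Cy" and S: "S \<in> Cy" "x \<in> S"
  shows "\<exists>C. circuit (cycle_matroid E Cy) C \<and> x \<in> C \<and> C \<subseteq> S"
proof -
  have fin: "finite E" and sub: "Cy \<subseteq> Pow E" using cs by (auto simp: cycle_space_def)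
  define F where "F = {T \<in> Cy. x \<in> T \<and> T \<subseteq> S}"
  have "finite F" using fin sub unfolding F_def
    by (auto intro: finite_subset[of _ "Pow E"])
  moreover have "S \<in> F" using S by (simp add: F_def)
  ultimately obtain C where C: "C \<in> F" "\<forall>T \<in> F. T \<subseteq> C \<longrightarrow> C = T"
    using finite_has_minimal2[of F S] by auto
  have "T = {} \<or> T = C" if T: "T \<in> Cy" "T \<subseteq> C" for T
  proof (cases "x \<in> T")
    case True
    then show ?thesis using C T unfolding F_def by blast
  next
    case False
    have eq: "sym_diff C T = C - T" using T by blast
    have "sym_diff C T \<in> Cy"
      by (rule cycle_space_sym_diff[OF cs]) (use C T in \<open>auto simp: F_def\<close>)
    then have "C - T \<in> F" using C T False unfolding F_def eq by blast
    then have "C = C - T" using C by blast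
    then show ?thesis using T by blast
  qed
  then have "circuit (cycle_matroid E Cy) C"
    using C unfolding circuit_cycle_matroid[OF sub] F_def by auto
  then show ?thesis using C by (auto simp: F_def)
qed

text \<open>Cycles through \<open>z\<close> are covered by those avoiding it, because such a cycle
  \<open>S\<close> inside \<open>C\<close> leaves the cycle \<open>C - S\<close>, which avoids
  \<open>z\<close>.\<close>

lemma cycle_circuitI:
  assumes cs: "cycle_space E Cy" and C: "C \<in> Cy" "C \<noteq> {}"
    and sub: "\<And>S. S \<in> Cy \<Longrightarrow> S \<subseteq> C \<Longrightarrow> z \<notin> S \<Longrightarrow> S = {}"
  shows "circuit (cycle_matroid E Cy) C"
proof -
  have "S = {} \<or> S = C" if S: "S \<in> Cy" "S \<subseteq> C" for S
  proof (cases "z \<in> S")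
    case True
    have eq: "sym_diff C S = C - S" using S by blast
    have "C - S \<in> Cy" using cycle_space_sym_diff[OF cs C(1) S(1)] unfolding eq .
    then have "C - S = {}" using sub[of "C - S"] True by blast
    then show ?thesis using S by blast
  qed (use sub S in blast)
  moreover have "Cy \<subseteq> Pow E" using cs by (simp add: cycle_space_def)
  ultimately show ?thesis using C by (subst circuit_cycle_matroid) auto
qed

section \<open>Circuits with chords\<close>

text \<open>
  The cycle space of the binary matroid in which \<open>{e, f} \<union> X\<close> is a spanning circuit and
  \<open>{z, e} \<union> A z\<close> is a circuit for each chord \<open>z \<in> Z\<close>, where only \<open>A z \<inter> X\<close> matters. The two parity
  conditions say that a cycle is orthogonal to the rows of a representation over the basis
  \<open>insert e X\<close>.
\<close>

definition chord_cycles :: "('a \<Rightarrow> 'a set) \<Rightarrow> 'a \<Rightarrow> 'a \<Rightarrow> 'a set \<Rightarrow> 'a set \<Rightarrow> 'a set set" where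
  "chord_cycles A e f X Z = {S. S \<subseteq> {e, f} \<union> X \<union> Z \<and>
     (even (card (S \<inter> Z)) \<longleftrightarrow> (e \<in> S \<longleftrightarrow> f \<in> S)) \<and>
     (\<forall>y \<in> X. even (card (S \<inter> {z \<in> Z. y \<in> A z})) \<longleftrightarrow> (y \<in> S \<longleftrightarrow> f \<in> S))}"

definition chorded :: "('a \<Rightarrow> 'a set) \<Rightarrow> 'a \<Rightarrow> 'a \<Rightarrow> 'a set \<Rightarrow> 'a set \<Rightarrow> 'a matroid" where
  "chorded A e f X Z = cycle_matroid ({e, f} \<union> X \<union> Z) (chord_cycles A e f X Z)"

definition chord_data :: "'a \<Rightarrow> 'a \<Rightarrow> 'a set \<Rightarrow> 'a set \<Rightarrow> bool" where
  "chord_data e f X Z \<longleftrightarrow>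
     finite X \<and> finite Z \<and> e \<noteq> f \<and> e \<notin> X \<union> Z \<and> f \<notin> X \<union> Z \<and> X \<inter> Z = {}"

lemma ground_chorded [simp]: "ground (chorded A e f X Z) = {e, f} \<union> X \<union> Z"
  by (simp add: chorded_def)

lemma chord_cycle_subset: "S \<in> chord_cycles A e f X Z \<Longrightarrow> S \<subseteq> {e, f} \<union> X \<union> Z"
  by (simp add: chord_cycles_def)

lemma chord_cycles_subset: "chord_cycles A e f X Z \<subseteq> Pow ({e, f} \<union> X \<union> Z)"
  by (auto simp: chord_cycles_def)

lemma cycle_space_chord_cycles:
  assumes "chord_data e f X Z"
  shows "cycle_space ({e, f} \<union> X \<union> Z) (chord_cycles A e f X Z)"
proof -
  let ?Cy = "chord_cycles A e f X Z" and ?Z = "\<lambda>y. {z \<in> Z. y \<in> A z}"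
  have fin: "finite ({e, f} \<union> X \<union> Z)" using assms by (simp add: chord_data_def)
  have "sym_diff S T \<in> ?Cy"
    if S: "S \<in> ?Cy" and T: "T \<in> ?Cy" for S T
  proof -
    have "finite S" "finite T"
      using S T chord_cycles_subset[of A e f X Z] by (auto intro: finite_subset[OF _ fin])
    note ev = even_card_sym_diff[OF this]
    show ?thesis
      unfolding chord_cycles_def mem_Collect_eq ev
    proof (intro conjI ballI)
      show "sym_diff S T \<subseteq> {e, f} \<union> X \<union> Z"
        using S T chord_cycles_subset[of A e f X Z] by blast
      have "even (card (S \<inter> Z)) \<longleftrightarrow> (e \<in> S \<longleftrightarrow> f \<in> S)"
        "even (card (T \<inter> Z)) \<longleftrightarrow> (e \<in> T \<longleftrightarrow> f \<in> T)"
        using S T by (simp_all add: chord_cycles_def)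
      then show "(even (card (S \<inter> Z)) \<longleftrightarrow> even (card (T \<inter> Z))) \<longleftrightarrow>
          (e \<in> sym_diff S T \<longleftrightarrow> f \<in> sym_diff S T)"
        by (simp only: Un_iff Diff_iff) argo
      fix y assume "y \<in> X"
      then have "even (card (S \<inter> ?Z y)) \<longleftrightarrow> (y \<in> S \<longleftrightarrow> f \<in> S)"
        "even (card (T \<inter> ?Z y)) \<longleftrightarrow> (y \<in> T \<longleftrightarrow> f \<in> T)"
        using S T by (simp_all add: chord_cycles_def)
      then show "(even (card (S \<inter> ?Z y)) \<longleftrightarrow> even (card (T \<inter> ?Z y)))
          \<longleftrightarrow> (y \<in> sym_diff S T \<longleftrightarrow> f \<in> sym_diff S T)"
        by (simp only: Un_iff Diff_iff) argo
    qed
  qed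
  moreover have "{} \<in> ?Cy" by (simp add: chord_cycles_def)
  ultimately show ?thesis
    using fin chord_cycles_subset[of A e f X Z] unfolding cycle_space_def by blast
qed

lemma matroid_chorded: "chord_data e f X Z \<Longrightarrow> matroid (chorded A e f X Z)"
  unfolding chorded_def by (intro matroid_cycle_matroid cycle_space_chord_cycles)

lemma circuit_chorded:
  "circuit (chorded A e f X Z) C \<longleftrightarrow>
    C \<in> chord_cycles A e f X Z \<and> C \<noteq> {} \<and> (\<forall>S \<in> chord_cycles A e f X Z. S \<subseteq> C \<longrightarrow> S = {} \<or> S = C)"
  unfolding chorded_def by (rule circuit_cycle_matroid[OF chord_cycles_subset])

text \<open>Adding the whole circuit to the cycle \<open>{z, e} \<union> (A z \<inter> X)\<close>
  gives \<open>{z, f} \<union> (X - A z)\<close>, so reversing the ends complements each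
  \<open>A z\<close>. On the level of parities, the row of \<open>y\<close> for the complements is
  the sum of the old row and the row counting all chords. Statements about one end transfer to the
  other through this symmetry.\<close>

lemma chord_cycles_swap:
  assumes "chord_data e f X Z"
  shows "chord_cycles (\<lambda>z. - A z) f e X Z = chord_cycles A e f X Z"
proof -
  let ?in = "\<lambda>S y. S \<inter> {z \<in> Z. y \<in> A z}" and ?out = "\<lambda>S y. S \<inter> {z \<in> Z. y \<notin> A z}"
  have fin: "finite Z" using assms by (simp add: chord_data_def)
  have split: "even (card (?out S y)) \<longleftrightarrow>
      (even (card (S \<inter> Z)) \<longleftrightarrow> even (card (?in S y)))" for S y
  proof -
    have "S \<inter> Z = (?out S y) \<union> (?in S y)" by blast
    then have "card (S \<inter> Z) = card ((?out S y) \<union> (?in S y))" by simp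
    also have "\<dots> = card (?out S y) + card (?in S y)"
      using fin by (intro card_Un_disjoint) auto
    finally have "card (S \<inter> Z) = card (?out S y) + card (?in S y)" .
    then show ?thesis by auto
  qed
  show ?thesis
  proof (rule set_eqI)
    fix S
    show "S \<in> chord_cycles (\<lambda>z. - A z) f e X Z \<longleftrightarrow> S \<in> chord_cycles A e f X Z"
      unfolding chord_cycles_def mem_Collect_eq Compl_iff split insert_commute[of f e "{}"]
      by (cases "even (card (S \<inter> Z))"; cases "e \<in> S"; cases "f \<in> S") (simp_all, metis+)
  qed
qed

lemma chorded_swap:
  "chord_data e f X Z \<Longrightarrow> chorded (\<lambda>z. - A z) f e X Z = chorded A e f X Z"
  by (simp add: chorded_def chord_cycles_swap insert_commute)

lemma chord_data_swap: "chord_data e f X Z \<Longrightarrow> chord_data f e X Z"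
  by (auto simp: chord_data_def)

text \<open>Without chords every count is zero, so all elements of \<open>{e, f} \<union> X\<close>
  belong to the cycle as soon as one of them does.\<close>

lemma chord_cycle_without_chords:
  assumes "S \<in> chord_cycles A e f X Z" "S \<inter> Z = {}"
  shows "S = {} \<or> S = {e, f} \<union> X"
proof -
  have "S \<inter> {z \<in> Z. y \<in> A z} = {}" for y using assms by blast
  then have "S \<subseteq> {e, f} \<union> X" "e \<in> S \<longleftrightarrow> f \<in> S" "\<forall>y \<in> X. y \<in> S \<longleftrightarrow> f \<in> S"
    using assms unfolding chord_cycles_def by auto
  then show ?thesis by (cases "f \<in> S") blast+
qed

lemma whole_circuit_cycle:
  assumes "chord_data e f X Z"
  shows "{e, f} \<union> X \<in> chord_cycles A e f X Z"
proof -
  have 1: "({e, f} \<union> X) \<inter> Z = {}" using assms by (auto simp: chord_data_def)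
  have 2: "({e, f} \<union> X) \<inter> {z \<in> Z. y \<in> A z} = {}" for y using 1 by blast
  show ?thesis unfolding chord_cycles_def mem_Collect_eq 1 2 by auto
qed

lemma chord_cycle_e:
  assumes cd: "chord_data e f X Z" and z: "z \<in> Z"
  shows "{z, e} \<union> (A z \<inter> X) \<in> chord_cycles A e f X Z"
proof -
  have 1: "({z, e} \<union> (A z \<inter> X)) \<inter> Z = {z}" using assms by (auto simp: chord_data_def)
  have 2: "({z, e} \<union> (A z \<inter> X)) \<inter> {u \<in> Z. y \<in> A u} = (if y \<in> A z then {z} else {})" for y
    using 1 by auto
  show ?thesis unfolding chord_cycles_def mem_Collect_eq 1 2
    using assms by (auto simp: chord_data_def)
qed

lemma chorded_circuitI:
  assumes "chord_data e f X Z" "C \<in> chord_cycles A e f X Z" "C \<noteq> {}"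
    and "\<And>S. S \<in> chord_cycles A e f X Z \<Longrightarrow> S \<subseteq> C \<Longrightarrow> z \<notin> S \<Longrightarrow> S = {}"
  shows "circuit (chorded A e f X Z) C"
  unfolding chorded_def using assms by (intro cycle_circuitI[where z = z] cycle_space_chord_cycles)

lemma circuit_whole:
  assumes cd: "chord_data e f X Z"
  shows "circuit (chorded A e f X Z) ({e, f} \<union> X)"
  unfolding circuit_chorded
proof (intro conjI ballI impI)
  show "{e, f} \<union> X \<in> chord_cycles A e f X Z" by (rule whole_circuit_cycle[OF cd])
  fix S assume "S \<in> chord_cycles A e f X Z" "S \<subseteq> {e, f} \<union> X"
  then show "S = {} \<or> S = {e, f} \<union> X"
    using cd by (intro chord_cycle_without_chords) (auto simp: chord_data_def)
qed auto

lemma circuit_chord_e: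
  assumes cd: "chord_data e f X Z" and z: "z \<in> Z"
  shows "circuit (chorded A e f X Z) ({z, e} \<union> (A z \<inter> X))"
proof (rule chorded_circuitI[OF cd chord_cycle_e[OF cd z], where z = z])
  fix S assume S: "S \<in> chord_cycles A e f X Z" "S \<subseteq> {z, e} \<union> (A z \<inter> X)" "z \<notin> S"
  then have "f \<notin> S" "S \<inter> Z = {}" using cd z by (auto simp: chord_data_def)
  then show "S = {}" using chord_cycle_without_chords[OF S(1)] by blast
qed auto

lemma circuit_chord_f:
  assumes cd: "chord_data e f X Z" and z: "z \<in> Z"
  shows "circuit (chorded A e f X Z) ({z, f} \<union> (X - A z))"
  using circuit_chord_e[OF chord_data_swap[OF cd] z, of "\<lambda>z. - A z"] chorded_swap[OF cd]
  by (simp add: Diff_eq Int_commute)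

lemma chord_cycle_two:
  assumes cd: "chord_data e f X Z" and zw: "z \<in> Z" "w \<in> Z" "z \<noteq> w"
  shows "{z, w} \<union> (sym_diff (A z) (A w) \<inter> X) \<in> chord_cycles A e f X Z"
proof -
  have "sym_diff ({z, e} \<union> (A z \<inter> X)) ({w, e} \<union> (A w \<inter> X)) \<in> chord_cycles A e f X Z"
    using cycle_space_sym_diff[OF cycle_space_chord_cycles[OF cd]] chord_cycle_e[OF cd] zw by blast
  moreover have "sym_diff ({z, e} \<union> (A z \<inter> X)) ({w, e} \<union> (A w \<inter> X))
      = {z, w} \<union> (sym_diff (A z) (A w) \<inter> X)"
    using cd zw by (auto simp: chord_data_def)
  ultimately show ?thesis by simp
qed

text \<open>Adding the cycle of the chord \<open>z\<close> through \<open>e\<close> removes the only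
  chord, so what remains is empty or the whole circuit.\<close>

lemma chord_cycle_one:
  assumes cd: "chord_data e f X Z" and S: "S \<in> chord_cycles A e f X Z" and "S \<inter> Z = {z}"
  shows "S = {z, e} \<union> (A z \<inter> X) \<or> S = {z, f} \<union> (X - A z)"
proof -
  let ?D = "{z, e} \<union> (A z \<inter> X)"
  have z: "z \<in> Z" using assms(3) by auto
  have D: "?D \<in> chord_cycles A e f X Z" by (rule chord_cycle_e[OF cd z])
  then have "sym_diff S ?D \<in> chord_cycles A e f X Z"
    using cycle_space_sym_diff[OF cycle_space_chord_cycles[OF cd]] S by blast
  moreover have "sym_diff S ?D \<inter> Z = {}" using assms(3) cd by (auto simp: chord_data_def)
  ultimately have "sym_diff S ?D = {} \<or> sym_diff S ?D = {e, f} \<union> X"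
    by (rule chord_cycle_without_chords)
  moreover have "S = sym_diff (sym_diff S ?D) ?D" by blast
  moreover have "sym_diff ({e, f} \<union> X) ?D = {z, f} \<union> (X - A z)"
    using cd z by (auto simp: chord_data_def)
  ultimately show ?thesis by (metis Diff_empty Un_empty_left empty_Diff)
qed

text \<open>A subcycle missing \<open>z\<close> contains no chord other than \<open>w\<close>; a
  nonempty cycle with at most one chord contains \<open>e\<close> or \<open>f\<close>, which are
  absent here.\<close>

lemma circuit_two_chords:
  assumes cd: "chord_data e f X Z" and zw: "z \<in> Z" "w \<in> Z" "z \<noteq> w"
  shows "circuit (chorded A e f X Z) ({z, w} \<union> (sym_diff (A z) (A w) \<inter> X))" (is "circuit _ ?C")
proof (rule chorded_circuitI[OF cd chord_cycle_two[OF cd zw], where z = z])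
  fix S assume S: "S \<in> chord_cycles A e f X Z" "S \<subseteq> ?C" "z \<notin> S"
  have no: "e \<notin> S" "f \<notin> S" using S cd zw by (auto simp: chord_data_def)
  have "S \<inter> Z \<subseteq> {w}" using S cd by (auto simp: chord_data_def)
  then have "S \<inter> Z = {} \<or> S \<inter> Z = {w}" by blast
  then show "S = {}"
    using chord_cycle_without_chords[OF S(1)] chord_cycle_one[OF cd S(1), of w] no by blast
qed auto

text \<open>Elements of the whole circuit share it, and two chords share their common circuit. A
  chord \<open>z\<close> and an element \<open>c\<close> of the whole circuit share the circuit of
  \<open>z\<close> through \<open>e\<close> if \<open>c\<close> is \<open>e\<close> or in
  \<open>A z\<close>, and the one through \<open>f\<close> otherwise.\<close>

lemma connected_chorded:
  assumes cd: "chord_data e f X Z"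
  shows "connected_matroid (chorded A e f X Z)"
  unfolding connected_matroid_def
proof (intro ballI impI)
  let ?M = "chorded A e f X Z"
  fix x y assume x: "x \<in> ground ?M" and y: "y \<in> ground ?M" and "x \<noteq> y"
  have chord: "\<exists>C. circuit ?M C \<and> z \<in> C \<and> c \<in> C" if "z \<in> Z" "c \<in> {e, f} \<union> X" for z c
  proof (cases "c = e \<or> c \<in> A z \<inter> X")
    case True
    then show ?thesis using circuit_chord_e[OF cd that(1), of A] by blast
  next
    case False
    then show ?thesis using circuit_chord_f[OF cd that(1), of A] that(2) by blast
  qed
  show "\<exists>C. circuit ?M C \<and> x \<in> C \<and> y \<in> C"
  proof (cases "x \<in> Z")
    case x: True
    show ?thesis
    proof (cases "y \<in> Z")
      case True
      then show ?thesis using circuit_two_chords[OF cd x True \<open>x \<noteq> y\<close>, of A] by blast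
    next
      case False
      then show ?thesis using chord[OF x, of y] y by auto
    qed
  next
    case xn: False
    show ?thesis
    proof (cases "y \<in> Z")
      case True
      then show ?thesis using chord[OF True, of x] x xn by auto
    next
      case False
      then show ?thesis using circuit_whole[OF cd, of A] x y xn by auto
    qed
  qed
qed

text \<open>The bound is the rank: \<open>insert e X\<close> is independent of size
  \<open>card X + 1\<close>, and it cannot be augmented, since \<open>f\<close> completes the whole
  circuit and a chord completes its circuit through \<open>e\<close>.\<close>

lemma chorded_indep_card:
  assumes cd: "chord_data e f X Z" and I: "I \<in> indeps (chorded A e f X Z)"
  shows "card I \<le> card X + 1"
proof (rule ccontr)
  let ?M = "chorded A e f X Z"
  assume "\<not> card I \<le> card X + 1"
  then have less: "card (insert e X) < card I"
    using cd by (simp add: chord_data_def)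
  have B: "insert e X \<in> indeps ?M"
  proof -
    have "insert e X \<subset> {e, f} \<union> X" using cd by (auto simp: chord_data_def)
    then show ?thesis using circuit_whole[OF cd, of A] unfolding circuit_def by blast
  qed
  then obtain x where x: "x \<in> I - insert e X" "insert x (insert e X) \<in> indeps ?M"
    using matroid_chorded[OF cd, of A] I less unfolding matroid_def by meson
  have "x \<in> {e, f} \<union> X \<union> Z" using I x by (auto simp: chorded_def indeps_cycle_matroid)
  then consider "x = f" | "x \<in> Z" using x by blast
  then show False
  proof cases
    case 1
    then show False using circuit_whole[OF cd, of A] x by (simp add: circuit_def insert_commute)
  next
    case 2
    have "{x, e} \<union> (A x \<inter> X) \<subseteq> insert x (insert e X)" by blast
    then show False
      using cycle_dependent[OF chord_cycle_e[OF cd 2, of A]] x unfolding chorded_def by blast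
  qed
qed

section \<open>Two-sums of circuits with chords\<close>

text \<open>The hypothesis \<open>pe\<close> is the chord-counting row of the first part. Modulo it,
  the chord-counting row of the whole is that of the second part. A row \<open>y\<close> in
  \<open>X1\<close> also counts every chord of \<open>Z2\<close>, as \<open>A z\<close> contains
  \<open>X1\<close> for all of these; the chord-counting row of the second part absorbs this count
  by replacing \<open>f\<close> with \<open>p\<close>. A row \<open>y\<close> in \<open>X2\<close>
  sees no chord of \<open>Z1\<close> and is a row of the second part.\<close>

lemma chord_cycles_glue:
  assumes cd: "chord_data e f (X1 \<union> X2) (Z1 \<union> Z2)" and X: "X1 \<inter> X2 = {}" and Z: "Z1 \<inter> Z2 = {}"
    and p: "p \<notin> {e, f} \<union> X1 \<union> X2 \<union> Z1 \<union> Z2"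
    and A1: "\<forall>z \<in> Z1. A z \<inter> X2 = {}" and A2: "\<forall>z \<in> Z2. X1 \<subseteq> A z"
    and S1: "S1 \<subseteq> {e, p} \<union> X1 \<union> Z1" and S2: "S2 \<subseteq> {p, f} \<union> X2 \<union> Z2"
    and pp: "p \<in> S1 \<longleftrightarrow> p \<in> S2" and pe: "p \<in> S1 \<longleftrightarrow> (even (card (S1 \<inter> Z1)) \<longleftrightarrow> e \<in> S1)"
  shows "(S1 \<union> S2) - {p} \<in> chord_cycles A e f (X1 \<union> X2) (Z1 \<union> Z2) \<longleftrightarrow>
    S1 \<in> chord_cycles A e p X1 Z1 \<and> S2 \<in> chord_cycles A p f X2 Z2"
proof -
  let ?n1 = "even (card (S1 \<inter> Z1))" and ?n2 = "even (card (S2 \<inter> Z2))"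
  let ?r1 = "\<lambda>y. even (card (S1 \<inter> {z \<in> Z1. y \<in> A z}))" and ?r2 = "\<lambda>y. even (card (S2 \<inter> {z \<in> Z2. y \<in> A z}))"
  let ?S = "(S1 \<union> S2) - {p}"
  have fin: "finite Z1" "finite Z2" using cd by (auto simp: chord_data_def)
  have un: "even (card (D1 \<union> D2)) \<longleftrightarrow> (even (card D1) \<longleftrightarrow> even (card D2))"
    if "D1 \<subseteq> Z1" "D2 \<subseteq> Z2" for D1 D2
  proof -
    have "card (D1 \<union> D2) = card D1 + card D2"
      using that fin Z by (intro card_Un_disjoint) (auto intro: finite_subset)
    then show ?thesis by simp
  qed
  have d: "f \<notin> S1" "e \<notin> S2" "\<And>y. y \<in> X1 \<Longrightarrow> y \<notin> S2" "\<And>y. y \<in> X2 \<Longrightarrow> y \<notin> S1"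
    "p \<noteq> e" "p \<noteq> f" "p \<notin> X1" "p \<notin> X2"
    using S1 S2 cd X p unfolding chord_data_def by blast+
  have "?S \<inter> (Z1 \<union> Z2) = (S1 \<inter> Z1) \<union> (S2 \<inter> Z2)"
    using S1 S2 cd Z p unfolding chord_data_def by blast
  then have c0: "even (card (?S \<inter> (Z1 \<union> Z2))) \<longleftrightarrow>
      (?n1 \<longleftrightarrow> ?n2)"
    using un[of "S1 \<inter> Z1" "S2 \<inter> Z2"] by simp
  have c1: "even (card (?S \<inter> {z \<in> Z1 \<union> Z2. y \<in> A z})) \<longleftrightarrow>
      (?r1 y \<longleftrightarrow> ?n2)" if "y \<in> X1" for y
  proof -
    have "?S \<inter> {z \<in> Z1 \<union> Z2. y \<in> A z} = (S1 \<inter> {z \<in> Z1. y \<in> A z}) \<union> (S2 \<inter> Z2)"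
      using S1 S2 cd Z p A2 that unfolding chord_data_def by blast
    then show ?thesis using un[of "S1 \<inter> {z \<in> Z1. y \<in> A z}" "S2 \<inter> Z2"] by auto
  qed
  have c2: "?S \<inter> {z \<in> Z1 \<union> Z2. y \<in> A z} = S2 \<inter> {z \<in> Z2. y \<in> A z}" if "y \<in> X2" for y
    using S1 S2 cd Z p A1 that unfolding chord_data_def by blast
  have s: "?S \<subseteq> {e, f} \<union> (X1 \<union> X2) \<union> (Z1 \<union> Z2)" using S1 S2 by blast
  have m1: "S1 \<in> chord_cycles A e p X1 Z1 \<longleftrightarrow>
      (\<forall>y \<in> X1. ?r1 y \<longleftrightarrow> (y \<in> S1 \<longleftrightarrow> p \<in> S1))"
    using S1 pe unfolding chord_cycles_def by blast
  have m2: "S2 \<in> chord_cycles A p f X2 Z2 \<longleftrightarrow>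
      (?n2 \<longleftrightarrow> (p \<in> S1 \<longleftrightarrow> f \<in> S2)) \<and>
      (\<forall>y \<in> X2. ?r2 y \<longleftrightarrow> (y \<in> S2 \<longleftrightarrow> f \<in> S2))"
    using S2 pp unfolding chord_cycles_def by simp
  have m: "?S \<in> chord_cycles A e f (X1 \<union> X2) (Z1 \<union> Z2) \<longleftrightarrow>
      ((?n1 \<longleftrightarrow> ?n2) \<longleftrightarrow> (e \<in> S1 \<longleftrightarrow> f \<in> S2)) \<and>
      (\<forall>y \<in> X1. (?r1 y \<longleftrightarrow> ?n2) \<longleftrightarrow>
        (y \<in> S1 \<longleftrightarrow> f \<in> S2)) \<and>
      (\<forall>y \<in> X2. ?r2 y \<longleftrightarrow> (y \<in> S2 \<longleftrightarrow> f \<in> S2))"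
  proof -
    have "e \<in> ?S \<longleftrightarrow> e \<in> S1" "f \<in> ?S \<longleftrightarrow> f \<in> S2" using d by auto
    moreover have "y \<in> ?S \<longleftrightarrow> y \<in> S1" if "y \<in> X1" for y using d that by auto
    moreover have "y \<in> ?S \<longleftrightarrow> y \<in> S2" if "y \<in> X2" for y using d that by auto
    ultimately show ?thesis
      unfolding chord_cycles_def mem_Collect_eq ball_Un c0 using s c1 c2 by simp
  qed
  have row: "(?n2 \<longleftrightarrow> (p \<in> S1 \<longleftrightarrow> f \<in> S2)) \<longleftrightarrow>
      ((?n1 \<longleftrightarrow> ?n2) \<longleftrightarrow> (e \<in> S1 \<longleftrightarrow> f \<in> S2))"
    using pe by argo
  \<comment> \<open>If the chord-counting row of the second part fails, both sides are false;
    otherwise it can be substituted into the rows of \<open>X1\<close>.\<close>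
  show ?thesis
  proof (cases "?n2 \<longleftrightarrow> (p \<in> S1 \<longleftrightarrow> f \<in> S2)")
    case True
    then have key: "((a \<longleftrightarrow> ?n2) \<longleftrightarrow> (b \<longleftrightarrow> f \<in> S2)) \<longleftrightarrow> (a \<longleftrightarrow> (b \<longleftrightarrow> p \<in> S1))"
      for a b by argo
    have "(\<forall>y \<in> X1. (?r1 y \<longleftrightarrow> ?n2) \<longleftrightarrow>
          (y \<in> S1 \<longleftrightarrow> f \<in> S2)) \<longleftrightarrow>
        (\<forall>y \<in> X1. ?r1 y \<longleftrightarrow> (y \<in> S1 \<longleftrightarrow> p \<in> S1))"
      by (simp only: key)
    then show ?thesis unfolding m m1 m2 row[symmetric] by (simp only: conj_left_commute)
  next
    case False
    show ?thesis unfolding m m1 m2 row[symmetric]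
      by (rule iffI; elim conjE; rule notE[OF False]; assumption)
  qed
qed

text \<open>A 2-sum is defined by circuits but compared here through cycles. It suffices that every
  2-sum circuit is a nonempty cycle of the large matroid and that every nonempty cycle of the latter
  contains a 2-sum circuit. Both follow from gluing cycles that agree on \<open>p\<close>, since a
  cycle through \<open>p\<close> contains a circuit through \<open>p\<close>.\<close>

lemma two_sum_chorded:
  assumes cd: "chord_data e f (X1 \<union> X2) (Z1 \<union> Z2)" and X: "X1 \<inter> X2 = {}" and Z: "Z1 \<inter> Z2 = {}"
    and p: "p \<notin> {e, f} \<union> X1 \<union> X2 \<union> Z1 \<union> Z2"
    and A1: "\<forall>z \<in> Z1. A z \<inter> X2 = {}" and A2: "\<forall>z \<in> Z2. X1 \<subseteq> A z"
  shows "two_sum p (chorded A e p X1 Z1) (chorded A p f X2 Z2) = chorded A e f (X1 \<union> X2) (Z1 \<union> Z2)"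
proof -
  let ?M1 = "chorded A e p X1 Z1" and ?M2 = "chorded A p f X2 Z2"
  let ?C1 = "chord_cycles A e p X1 Z1" and ?C2 = "chord_cycles A p f X2 Z2"
  let ?C = "chord_cycles A e f (X1 \<union> X2) (Z1 \<union> Z2)"
  have cd1: "chord_data e p X1 Z1" and cd2: "chord_data p f X2 Z2"
    using cd p by (auto simp: chord_data_def)
  note glue = chord_cycles_glue[OF cd X Z p A1 A2]
  have join: "(S1 \<union> S2) - {p} \<in> ?C" if S1: "S1 \<in> ?C1" and S2: "S2 \<in> ?C2" and "p \<in> S1 \<longleftrightarrow> p \<in> S2" for S1 S2
  proof -
    have s: "S1 \<subseteq> {e, p} \<union> X1 \<union> Z1" "S2 \<subseteq> {p, f} \<union> X2 \<union> Z2"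
      using chord_cycle_subset[OF S1] chord_cycle_subset[OF S2] by blast+
    have "even (card (S1 \<inter> Z1)) \<longleftrightarrow> (e \<in> S1 \<longleftrightarrow> p \<in> S1)"
      using S1 by (simp add: chord_cycles_def)
    then have pe: "p \<in> S1 \<longleftrightarrow> (even (card (S1 \<inter> Z1)) \<longleftrightarrow> e \<in> S1)" by argo
    show ?thesis by (rule iffD2[OF glue[OF s that(3) pe] conjI[OF S1 S2]])
  qed
  have split: "\<exists>S1 \<in> ?C1. \<exists>S2 \<in> ?C2. (p \<in> S1 \<longleftrightarrow> p \<in> S2) \<and> S = (S1 \<union> S2) - {p}" if S: "S \<in> ?C" for S
  proof -
    \<comment> \<open>\<open>B\<close> puts \<open>p\<close> into both halves precisely when the
      chord-counting row of the first half requires it.\<close>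
    define B where "B = (if even (card (S \<inter> Z1)) \<longleftrightarrow> e \<in> S then {p} else {})"
    define S1 where "S1 = S \<inter> ({e} \<union> X1 \<union> Z1) \<union> B"
    define S2 where "S2 = S \<inter> ({f} \<union> X2 \<union> Z2) \<union> B"
    have B: "B \<subseteq> {p}" "p \<in> B \<longleftrightarrow> (even (card (S \<inter> Z1)) \<longleftrightarrow> e \<in> S)" by (auto simp: B_def)
    have Ssub: "S \<subseteq> {e, f} \<union> (X1 \<union> X2) \<union> (Z1 \<union> Z2)" by (rule chord_cycle_subset[OF S])
    then have eq: "S = (S1 \<union> S2) - {p}" using p B by (auto simp: S1_def S2_def)
    have pS: "p \<notin> S" using Ssub p by blast
    have "S1 \<inter> Z1 = S \<inter> Z1" using B p by (auto simp: S1_def)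
    moreover have "e \<in> S1 \<longleftrightarrow> e \<in> S" using B p by (auto simp: S1_def)
    moreover have "p \<in> S1 \<longleftrightarrow> p \<in> B" "p \<in> S2 \<longleftrightarrow> p \<in> B" using pS by (auto simp: S1_def S2_def)
    ultimately have pp: "p \<in> S1 \<longleftrightarrow> p \<in> S2" "p \<in> S1 \<longleftrightarrow> (even (card (S1 \<inter> Z1)) \<longleftrightarrow> e \<in> S1)"
      using B by simp_all
    have s: "S1 \<subseteq> {e, p} \<union> X1 \<union> Z1" "S2 \<subseteq> {p, f} \<union> X2 \<union> Z2"
      using B by (auto simp: S1_def S2_def)
    have "S1 \<in> ?C1 \<and> S2 \<in> ?C2"
      by (rule iffD1[OF glue[OF s pp]]) (use S eq in simp)
    then have "S1 \<in> ?C1 \<and> S2 \<in> ?C2 \<and> (p \<in> S1 \<longleftrightarrow> p \<in> S2)" using pp by simp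
    then show ?thesis using eq by blast
  qed
  have sp: "\<exists>C. circuit ?M1 C \<and> x \<in> C \<and> C \<subseteq> S" if "S \<in> ?C1" "x \<in> S" for S x
    using cycle_contains_circuit_through[OF cycle_space_chord_cycles[OF cd1] that]
    unfolding chorded_def .
  have sp2: "\<exists>C. circuit ?M2 C \<and> x \<in> C \<and> C \<subseteq> S" if "S \<in> ?C2" "x \<in> S" for S x
    using cycle_contains_circuit_through[OF cycle_space_chord_cycles[OF cd2] that]
    unfolding chorded_def .
  have emp: "{} \<in> ?C1" "{} \<in> ?C2" by (simp_all add: chord_cycles_def)
  have lower: "\<exists>D \<in> two_sum_circuits p ?M1 ?M2. D \<subseteq> S" if S: "S \<in> ?C" "S \<noteq> {}" for S
  proof -
    obtain S1 S2 where *: "S1 \<in> ?C1" "S2 \<in> ?C2" "p \<in> S1 \<longleftrightarrow> p \<in> S2" "S = (S1 \<union> S2) - {p}"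
      using split[OF S(1)] by blast
    show ?thesis
    proof (cases "p \<in> S1")
      case True
      then obtain C1 C2 where "circuit ?M1 C1" "p \<in> C1" "C1 \<subseteq> S1" "circuit ?M2 C2" "p \<in> C2" "C2 \<subseteq> S2"
        using sp[OF *(1)] sp2[OF *(2)] *(3) by blast
      then have "(C1 \<union> C2) - {p} \<in> two_sum_circuits p ?M1 ?M2" "(C1 \<union> C2) - {p} \<subseteq> S"
        using *(4) unfolding two_sum_circuits_def by blast+
      then show ?thesis by blast
    next
      case False
      then have pS: "p \<notin> S1" "p \<notin> S2" using *(3) by auto
      obtain x where "x \<in> S1 \<or> x \<in> S2" using S(2) *(4) by blast
      then consider C where "circuit ?M1 C" "C \<subseteq> S1" | C where "circuit ?M2 C" "C \<subseteq> S2"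
        using sp[OF *(1)] sp2[OF *(2)] by blast
      then obtain C where "C \<in> two_sum_circuits p ?M1 ?M2" "C \<subseteq> S1 \<union> S2"
        unfolding two_sum_circuits_def using pS by cases blast+
      then show ?thesis using pS *(4) by blast
    qed
  qed
  have upper: "C \<in> ?C \<and> C \<noteq> {}" if C: "C \<in> two_sum_circuits p ?M1 ?M2" for C
  proof -
    consider "circuit ?M1 C" "p \<notin> C" | "circuit ?M2 C" "p \<notin> C"
      | C1 C2 where "circuit ?M1 C1" "p \<in> C1" "circuit ?M2 C2" "p \<in> C2" "C = (C1 \<union> C2) - {p}"
      using C unfolding two_sum_circuits_def by blast
    then show ?thesis
    proof cases
      case 1
      then show ?thesis using join[of C "{}"] emp by (auto simp: circuit_chorded)
    next
      case 2
      then show ?thesis using join[of "{}" C] emp by (auto simp: circuit_chorded)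
    next
      case 3
      \<comment> \<open>The singleton is not a cycle, hence \<open>C1\<close> has an element besides
        \<open>p\<close> and the glued set is nonempty.\<close>
      have "{p} \<notin> ?C1" using cd1 by (auto simp: chord_cycles_def chord_data_def)
      then have "C1 \<noteq> {p}" using 3 by (auto simp: circuit_chorded)
      then show ?thesis using 3 join[of C1 C2] by (auto simp: circuit_chorded)
    qed
  qed
  have "ground (two_sum p ?M1 ?M2) = ground (chorded A e f (X1 \<union> X2) (Z1 \<union> Z2))"
    using p by (auto simp: two_sum_def)
  moreover have "indeps (two_sum p ?M1 ?M2) = indeps (chorded A e f (X1 \<union> X2) (Z1 \<union> Z2))"
  proof (rule set_eqI)
    fix I
    have g: "(ground ?M1 \<union> ground ?M2) - {p} = {e, f} \<union> (X1 \<union> X2) \<union> (Z1 \<union> Z2)"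
      using p by auto
    have "(\<forall>C \<in> two_sum_circuits p ?M1 ?M2. \<not> C \<subseteq> I) \<longleftrightarrow> (\<forall>S \<in> ?C. S \<subseteq> I \<longrightarrow> S = {})"
      using lower upper by (meson subset_trans)
    then show "I \<in> indeps (two_sum p ?M1 ?M2) \<longleftrightarrow> I \<in> indeps (chorded A e f (X1 \<union> X2) (Z1 \<union> Z2))"
      unfolding two_sum_def chorded_def[of A e f] g[symmetric]
      by (simp add: indeps_cycle_matroid g)
  qed
  ultimately show ?thesis by simp
qed

section \<open>Isomorphisms and labels\<close>

lemma matroid_iso_cycle_matroid:
  assumes bij: "bij_betw \<phi> E E'" and Cy: "Cy \<subseteq> Pow E"
    and iff: "\<And>S. S \<subseteq> E \<Longrightarrow> S \<in> Cy \<longleftrightarrow> \<phi> ` S \<in> Cy'"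
  shows "matroid_iso \<phi> (cycle_matroid E Cy) (cycle_matroid E' Cy')"
  unfolding matroid_iso_def ground_cycle_matroid
proof (intro conjI allI impI bij)
  fix X assume X: "X \<subseteq> E"
  have "(\<forall>S \<in> Cy. S \<subseteq> X \<longrightarrow> S = {}) \<longleftrightarrow> (\<forall>S \<in> Cy'. S \<subseteq> \<phi> ` X \<longrightarrow> S = {})"
  proof
    assume L: "\<forall>S \<in> Cy. S \<subseteq> X \<longrightarrow> S = {}"
    show "\<forall>S \<in> Cy'. S \<subseteq> \<phi> ` X \<longrightarrow> S = {}"
    proof (intro ballI impI)
      fix S' assume S': "S' \<in> Cy'" "S' \<subseteq> \<phi> ` X"
      then obtain S where "S \<subseteq> X" "S' = \<phi> ` S" by (auto simp: subset_image_iff)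
      then show "S' = {}" using L S' iff[of S] X by auto
    qed
  next
    assume R: "\<forall>S \<in> Cy'. S \<subseteq> \<phi> ` X \<longrightarrow> S = {}"
    then show "\<forall>S \<in> Cy. S \<subseteq> X \<longrightarrow> S = {}" using iff X Cy by (metis image_is_empty image_mono subset_trans)
  qed
  moreover have "\<phi> ` X \<subseteq> E'" using X bij by (auto simp: bij_betw_def)
  ultimately show "X \<in> indeps (cycle_matroid E Cy) \<longleftrightarrow> \<phi> ` X \<in> indeps (cycle_matroid E' Cy')"
    using X by (simp add: indeps_cycle_matroid)
qed

lemma chord_cycles_image:
  assumes inj: "inj_on \<phi> ({e, f} \<union> X \<union> Z)" and S: "S \<subseteq> {e, f} \<union> X \<union> Z"
    and A: "\<And>y z. y \<in> X \<Longrightarrow> z \<in> Z \<Longrightarrow> y \<in> A z \<longleftrightarrow> \<phi> y \<in> A' (\<phi> z)"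
  shows "\<phi> ` S \<in> chord_cycles A' (\<phi> e) (\<phi> f) (\<phi> ` X) (\<phi> ` Z) \<longleftrightarrow> S \<in> chord_cycles A e f X Z"
proof -
  have mem: "\<phi> y \<in> \<phi> ` S \<longleftrightarrow> y \<in> S" if "y \<in> {e, f} \<union> X \<union> Z" for y
    using inj_on_image_mem_iff[OF inj that S] .
  have int: "\<phi> ` S \<inter> \<phi> ` D = \<phi> ` (S \<inter> D)" if "D \<subseteq> Z" for D
    using inj_on_image_Int[OF inj S, of D] that by blast
  have card: "card (\<phi> ` (S \<inter> D)) = card (S \<inter> D)" for D
    using inj S by (intro card_image) (blast intro: inj_on_subset)
  have set: "{z \<in> \<phi> ` Z. \<phi> y \<in> A' z} = \<phi> ` {z \<in> Z. y \<in> A z}" if "y \<in> X" for y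
    using A that by blast
  have sub: "\<phi> ` S \<subseteq> {\<phi> e, \<phi> f} \<union> \<phi> ` X \<union> \<phi> ` Z" using S by blast
  have row: "card (\<phi> ` S \<inter> {z \<in> \<phi> ` Z. \<phi> y \<in> A' z}) = card (S \<inter> {z \<in> Z. y \<in> A z})"
    if "y \<in> X" for y
    unfolding set[OF that] by (subst int) (auto simp: card)
  have top: "card (\<phi> ` S \<inter> \<phi> ` Z) = card (S \<inter> Z)" by (simp add: int card)
  show ?thesis
    unfolding chord_cycles_def mem_Collect_eq top using S sub by (simp add: row mem)
qed

lemma matroid_iso_chorded:
  assumes inj: "inj_on \<phi> ({e, f} \<union> X \<union> Z)"
    and A: "\<And>y z. y \<in> X \<Longrightarrow> z \<in> Z \<Longrightarrow> y \<in> A z \<longleftrightarrow> \<phi> y \<in> A' (\<phi> z)"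
  shows "matroid_iso \<phi> (chorded A e f X Z) (chorded A' (\<phi> e) (\<phi> f) (\<phi> ` X) (\<phi> ` Z))"
  unfolding chorded_def
proof (rule matroid_iso_cycle_matroid)
  show "bij_betw \<phi> ({e, f} \<union> X \<union> Z) ({\<phi> e, \<phi> f} \<union> \<phi> ` X \<union> \<phi> ` Z)"
    using inj by (simp add: bij_betw_def image_Un)
  show "S \<in> chord_cycles A e f X Z \<longleftrightarrow>
      \<phi> ` S \<in> chord_cycles A' (\<phi> e) (\<phi> f) (\<phi> ` X) (\<phi> ` Z)" if "S \<subseteq> {e, f} \<union> X \<union> Z" for S
    using chord_cycles_image[OF inj that, of A A'] A by blast
qed (rule chord_cycles_subset)

lemma relabel_iso:
  assumes iso: "matroid_iso \<phi> M N" and M: "indeps M \<subseteq> Pow (ground M)" and N: "indeps N \<subseteq> Pow (ground N)"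
  shows "relabel \<phi> M = N"
proof -
  have g: "\<phi> ` ground M = ground N" using iso by (auto simp: matroid_iso_def bij_betw_def)
  have "(\<lambda>I. \<phi> ` I) ` indeps M = indeps N"
  proof
    show "(\<lambda>I. \<phi> ` I) ` indeps M \<subseteq> indeps N" using iso M by (auto simp: matroid_iso_def)
    show "indeps N \<subseteq> (\<lambda>I. \<phi> ` I) ` indeps M"
    proof
      fix J assume J: "J \<in> indeps N"
      then have "J \<subseteq> \<phi> ` ground M" using N g by auto
      then obtain I where "I \<subseteq> ground M" "J = \<phi> ` I" by (auto simp: subset_image_iff)
      then show "J \<in> (\<lambda>I. \<phi> ` I) ` indeps M" using iso J by (auto simp: matroid_iso_def)
    qed
  qed
  then show ?thesis using g by (simp add: relabel_def)
qed

section \<open>Recognizing circuits and cocircuits among matroids with chords\<close>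

lemma isomorphic_uniform_iff:
  assumes "finite (ground N)"
  shows "isomorphic_matroid N (uniform_matroid k n) \<longleftrightarrow>
    card (ground N) = n \<and> (\<forall>I. I \<subseteq> ground N \<longrightarrow> (I \<in> indeps N \<longleftrightarrow> card I \<le> k))"
proof
  assume "isomorphic_matroid N (uniform_matroid k n)"
  then obtain \<phi> where \<phi>: "bij_betw \<phi> (ground N) {..<n}"
    "\<And>I. I \<subseteq> ground N \<Longrightarrow> I \<in> indeps N \<longleftrightarrow> \<phi> ` I \<subseteq> {..<n} \<and> card (\<phi> ` I) \<le> k"
    by (auto simp: isomorphic_matroid_def matroid_iso_def uniform_matroid_def)
  have "card (\<phi> ` I) = card I" "\<phi> ` I \<subseteq> {..<n}" if "I \<subseteq> ground N" for I
    using \<phi>(1) that by (auto simp: bij_betw_def intro: card_image inj_on_subset)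
  then show "card (ground N) = n \<and> (\<forall>I. I \<subseteq> ground N \<longrightarrow> (I \<in> indeps N \<longleftrightarrow> card I \<le> k))"
    using \<phi> bij_betw_same_card[OF \<phi>(1)] by simp
next
  assume *: "card (ground N) = n \<and> (\<forall>I. I \<subseteq> ground N \<longrightarrow> (I \<in> indeps N \<longleftrightarrow> card I \<le> k))"
  then obtain \<phi> where \<phi>: "bij_betw \<phi> (ground N) {..<n}"
    using assms by (metis finite_same_card_bij card_lessThan finite_lessThan)
  have "card (\<phi> ` I) = card I" "\<phi> ` I \<subseteq> {..<n}" if "I \<subseteq> ground N" for I
    using \<phi> that by (auto simp: bij_betw_def intro: card_image inj_on_subset)
  then show "isomorphic_matroid N (uniform_matroid k n)"
    using * \<phi> unfolding isomorphic_matroid_def matroid_iso_def uniform_matroid_def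
    by (intro exI[of _ \<phi>]) auto
qed

lemma circuit_proper_subset_indep: "circuit M C \<Longrightarrow> D \<subset> C \<Longrightarrow> D \<in> indeps M"
  by (simp add: circuit_def)

lemma finite_ground_chorded: "chord_data e f X Z \<Longrightarrow> finite (ground (chorded A e f X Z))"
  by (simp add: chord_data_def)

lemma card_ground_chorded:
  assumes "chord_data e f X Z"
  shows "card (ground (chorded A e f X Z)) = card X + card Z + 2"
proof -
  have "card (X \<union> Z) = card X + card Z"
    using assms by (auto simp: chord_data_def card_Un_disjoint)
  then show ?thesis using assms by (simp add: chord_data_def)
qed

lemma chorded_labeled_circuit:
  assumes cd: "chord_data e f X {}"
  shows "labeled_circuit (card X + 2) (chorded A e f X {})"
proof -
  let ?M = "chorded A e f X {}"
  have C: "circuit ?M (ground ?M)" using circuit_whole[OF cd, of A] by simp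
  have fin: "finite (ground ?M)" by (rule finite_ground_chorded[OF cd])
  have "I \<in> indeps ?M \<longleftrightarrow> card I \<le> card X + 1" if "I \<subseteq> ground ?M" for I
  proof
    assume "card I \<le> card X + 1"
    then have "I \<noteq> ground ?M" using card_ground_chorded[OF cd, of A] by auto
    then show "I \<in> indeps ?M" using C that by (auto simp: circuit_def)
  qed (rule chorded_indep_card[OF cd])
  then show ?thesis
    unfolding labeled_circuit_def isomorphic_uniform_iff[OF fin]
    using card_ground_chorded[OF cd, of A] by simp
qed

text \<open>In a matroid labeled by a circuit every proper subset of the ground set is independent,
  whereas the circuit of a chord through \<open>e\<close> misses \<open>f\<close>.\<close>

lemma chorded_labeled_circuitD:
  assumes cd: "chord_data e f X Z" and "labeled_circuit k (chorded A e f X Z)"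
  shows "Z = {}"
proof (rule ccontr)
  let ?M = "chorded A e f X Z"
  assume "Z \<noteq> {}"
  then obtain z where z: "z \<in> Z" by blast
  let ?C = "{z, e} \<union> (A z \<inter> X)"
  have k: "1 \<le> k" "card (ground ?M) = k" "\<And>I. I \<subseteq> ground ?M \<Longrightarrow> I \<in> indeps ?M \<longleftrightarrow> card I \<le> k - 1"
    using assms(2) unfolding labeled_circuit_def isomorphic_uniform_iff[OF finite_ground_chorded[OF cd]]
    by auto
  have C: "circuit ?M ?C" by (rule circuit_chord_e[OF cd z])
  have "?C \<subset> ground ?M" using cd z by (auto simp: chord_data_def)
  then have "card ?C < k" using k(2) finite_ground_chorded[OF cd] psubset_card_mono by metis
  then show False using C k(3)[of ?C] k(1) by (auto simp: circuit_def)
qed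

text \<open>With \<open>X\<close> empty, the whole circuit and the circuits of the chord are pairs,
  so the three elements are parallel.\<close>

lemma chorded_triangle_cocircuit:
  assumes cd: "chord_data e f {} {z}"
  shows "labeled_cocircuit 3 (chorded A e f {} {z})"
proof -
  let ?M = "chorded A e f {} {z}"
  have fin: "finite (ground ?M)" by (rule finite_ground_chorded[OF cd])
  have c1: "circuit ?M {e, f}" using circuit_whole[OF cd, of A] by simp
  have c2: "circuit ?M {z, e}" using circuit_chord_e[OF cd, of z A] by simp
  have d: "e \<noteq> f" "z \<noteq> e" using cd by (auto simp: chord_data_def)
  have "I \<in> indeps ?M \<longleftrightarrow> card I \<le> 1" if I: "I \<subseteq> ground ?M" for I
  proof
    assume "card I \<le> 1"
    moreover have "finite I" using I fin finite_subset by blast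
    ultimately have "I = {} \<or> (\<exists>x. I = {x})"
      by (metis One_nat_def card_0_eq card_1_singletonE le_Suc_eq le_zero_eq)
    then have "I \<subset> {e, f} \<or> I \<subset> {z, e}" using I d by auto
    then show "I \<in> indeps ?M" using c1 c2 circuit_proper_subset_indep by metis
  qed (use chorded_indep_card[OF cd] in force)
  then show ?thesis
    unfolding labeled_cocircuit_def isomorphic_uniform_iff[OF fin]
    using card_ground_chorded[OF cd, of A] by simp
qed

text \<open>An element \<open>y\<close> of \<open>X\<close> gives the independent pair
  \<open>{e, y}\<close>, too large for rank one.\<close>

lemma chorded_labeled_cocircuitD:
  assumes cd: "chord_data e f X Z" and "labeled_cocircuit k (chorded A e f X Z)"
  shows "X = {}"
proof (rule ccontr)
  let ?M = "chorded A e f X Z"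
  assume "X \<noteq> {}"
  then obtain y where y: "y \<in> X" by blast
  have "{e, y} \<subset> {e, f} \<union> X" using y cd by (auto simp: chord_data_def)
  then have "{e, y} \<in> indeps ?M"
    using circuit_whole[OF cd, of A] circuit_proper_subset_indep by metis
  moreover have "{e, y} \<subseteq> ground ?M" using y by auto
  ultimately have "card {e, y} \<le> 1"
    using assms(2) unfolding labeled_cocircuit_def isomorphic_uniform_iff[OF finite_ground_chorded[OF cd]]
    by metis
  moreover have "e \<noteq> y" using y cd by (auto simp: chord_data_def)
  ultimately show False by simp
qed

section \<open>Binary spikes\<close>

text \<open>A coefficient vector over GF(2) is the indicator of its support, which turns vanishing
  row sums into parity conditions.\<close>

lemma independent_columns_bit:
  fixes A :: "nat \<Rightarrow> 'a \<Rightarrow> bit"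
  assumes fin: "finite X"
  shows "independent_columns m A X \<longleftrightarrow>
    (\<forall>S \<subseteq> X. (\<forall>i \<in> {1..m}. even (card (S \<inter> {x. A i x = 1}))) \<longrightarrow> S = {})"
proof -
  let ?R = "\<lambda>S. \<forall>i \<in> {1..m}. even (card (S \<inter> {x. A i x = 1}))"
  have sum: "(\<Sum>x\<in>X. c x * A i x) = of_nat (card ({x \<in> X. c x = 1} \<inter> {x. A i x = 1}))" for c i
  proof -
    have "(\<Sum>x\<in>X. c x * A i x) = (\<Sum>x\<in>X. if c x = 1 \<and> A i x = 1 then 1 else 0)"
      by (intro sum.cong refl) (metis bit_not_one_iff mult_1 mult_zero_left mult_zero_right)
    also have "\<dots> = (\<Sum>x\<in>{x \<in> X. c x = 1 \<and> A i x = 1}. 1)"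
      using fin by (subst sum.inter_filter[symmetric]) auto
    also have "{x \<in> X. c x = 1 \<and> A i x = 1} = {x \<in> X. c x = 1} \<inter> {x. A i x = 1}" by blast
    finally show ?thesis by simp
  qed
  have zero: "(of_nat n :: bit) = 0 \<longleftrightarrow> even n" for n
    by (induction n) (auto simp: )
  show ?thesis
  proof
    assume L: "independent_columns m A X"
    show "\<forall>S \<subseteq> X. ?R S \<longrightarrow> S = {}"
    proof (intro allI impI)
      fix S assume S: "S \<subseteq> X" "\<forall>i \<in> {1..m}. even (card (S \<inter> {x. A i x = 1}))"
      define c where "c x = (if x \<in> S then 1 else 0 :: bit)" for x
      have "{x \<in> X. c x = 1} = S" using S by (auto simp: c_def)
      then have "\<forall>x \<in> X. c x = 0"
        using L S unfolding independent_columns_def sum zero by simp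
      then have "x \<notin> S" if "x \<in> X" for x using that unfolding c_def by (metis zero_neq_one)
      then show "S = {}" using S(1) by blast
    qed
  next
    assume R: "\<forall>S \<subseteq> X. ?R S \<longrightarrow> S = {}"
    show "independent_columns m A X"
      unfolding independent_columns_def sum zero
    proof (intro allI impI ballI)
      fix c :: "'a \<Rightarrow> bit" and x assume "\<forall>i \<in> {1..m}. even (card ({x \<in> X. c x = 1} \<inter> {x. A i x = 1}))" "x \<in> X"
      then show "c x = 0" using R[rule_format, of "{x \<in> X. c x = 1}"] by auto
    qed
  qed
qed

lemma vector_matroid_bit:
  fixes A :: "nat \<Rightarrow> 'a \<Rightarrow> bit"
  assumes "finite E"
  shows "vector_matroid m A E =
    cycle_matroid E {S. S \<subseteq> E \<and> (\<forall>i \<in> {1..m}. even (card (S \<inter> {x. A i x = 1})))}"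
proof -
  let ?R = "{S. S \<subseteq> E \<and> (\<forall>i \<in> {1..m}. even (card (S \<inter> {x. A i x = 1})))}"
  have "independent_columns m A X \<longleftrightarrow>
      (\<forall>S \<in> ?R. S \<subseteq> X \<longrightarrow> S = {})"
    if "X \<subseteq> E" for X
    unfolding independent_columns_bit[OF finite_subset[OF that assms]] using that by blast
  then have "{X. X \<subseteq> E \<and> independent_columns m A X} =
      {X. X \<subseteq> E \<and> (\<forall>S \<in> ?R. S \<subseteq> X \<longrightarrow> S = {})}"
    by blast
  then show ?thesis unfolding vector_matroid_def cycle_matroid_def by simp
qed

fun spike_chord :: "spike_elem \<Rightarrow> spike_elem set" where
  "spike_chord (SY i) = {SX i}"
| "spike_chord _ = {}"

text \<open>The columns of the tip and of all \<open>SX i\<close> form a spanning circuit, with the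
  tip as its first and the cotip \<open>SX r\<close> as its second end. Each \<open>SY i\<close>
  with \<open>i < r\<close> is a chord, closing a triangle with the tip and
  \<open>SX i\<close>.\<close>

definition standard_spike :: "nat \<Rightarrow> spike_elem matroid" where
  "standard_spike r = chorded spike_chord STip (SX r) (SX ` {1..<r}) (SY ` {1..<r})"

text \<open>Row operations identify the two systems of parities. After the deletion of
  \<open>SY r\<close>, row \<open>r\<close> of the spike matrix is the row counting chords, and row
  \<open>i\<close> plus row \<open>r\<close> has support \<open>{SX i, SY i, SX r}\<close>, which is
  the row of \<open>SX i\<close>.\<close>

lemma cotipped_spike_chorded:
  assumes r: "1 \<le> r"
  shows "cotipped_spike r = standard_spike r"
proof -
  let ?Cy = "chord_cycles spike_chord STip (SX r) (SX ` {1..<r}) (SY ` {1..<r})"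
  let ?at = "\<lambda>S i. S \<inter> {x. spike_matrix i x = 1}"
  let ?E = "SX ` {1..r} \<union> SY ` {1..r} \<union> {STip}"
  let ?X = "SX ` {1..<r}" and ?Z = "SY ` {1..<r}"
  let ?E' = "{STip, SX r} \<union> ?X \<union> ?Z"
  let ?row = "\<lambda>S. \<forall>i \<in> {1..r}. even (card (?at S i))"
  have ins: "{1..r} = insert r {1..<r}" using r by auto
  have E: "?E - {SY r} = ?E'"
  proof -
    have "SY ` {1..r} - {SY r} = SY ` {1..<r}" by auto
    moreover have "SX ` {1..r} = insert (SX r) (SX ` {1..<r})" unfolding ins by simp
    ultimately show ?thesis by auto
  qed
  have cyc: "?row S \<longleftrightarrow> S \<in> ?Cy" if S: "S \<subseteq> ?E'" for S
  proof -
    have top: "even (card (?at S r)) \<longleftrightarrow>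
        (even (card (S \<inter> ?Z)) \<longleftrightarrow> (STip \<in> S \<longleftrightarrow> SX r \<in> S))"
    proof -
      have "?at S r = S \<inter> insert (SX r) (insert STip ?Z)"
        using S by (auto split: if_splits)
      then have "even (card (?at S r)) \<longleftrightarrow>
          even (card (S \<inter> insert (SX r) (insert STip ?Z)))" by simp
      also have "\<dots> \<longleftrightarrow> ((even (card (S \<inter> ?Z)) \<longleftrightarrow> STip \<notin> S) \<longleftrightarrow> SX r \<notin> S)"
        by (subst even_card_Int_insert, simp, force, subst even_card_Int_insert, simp, force) (rule refl)
      also have "\<dots> \<longleftrightarrow> (even (card (S \<inter> ?Z)) \<longleftrightarrow> (STip \<in> S \<longleftrightarrow> SX r \<in> S))" by argo
      finally show ?thesis .
    qed
    have row: "even (card (?at S i)) \<longleftrightarrow>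
        (((even (card (S \<inter> ?Z)) \<longleftrightarrow> SY i \<notin> S) \<longleftrightarrow> STip \<notin> S) \<longleftrightarrow> SX i \<notin> S)"
      if i: "i \<in> {1..<r}" for i
    proof -
      let ?D = "?Z - {SY i}"
      have "?at S i = S \<inter> insert (SX i) (insert STip ?D)"
        using S i by (auto split: if_splits)
      then have "even (card (?at S i)) \<longleftrightarrow>
          even (card (S \<inter> insert (SX i) (insert STip ?D)))" by simp
      also have "\<dots> \<longleftrightarrow> ((even (card (S \<inter> ?D)) \<longleftrightarrow> STip \<notin> S) \<longleftrightarrow> SX i \<notin> S)"
        by (subst even_card_Int_insert, simp, force, subst even_card_Int_insert, simp, force) (rule refl)
      finally have 1: "even (card (?at S i)) \<longleftrightarrow>
          ((even (card (S \<inter> ?D)) \<longleftrightarrow> STip \<notin> S) \<longleftrightarrow> SX i \<notin> S)" .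
      have "insert (SY i) ?D = ?Z" using i by blast
      then have "even (card (S \<inter> ?Z)) \<longleftrightarrow> (even (card (S \<inter> ?D)) \<longleftrightarrow> SY i \<notin> S)"
        using even_card_Int_insert[of ?D "SY i" S] by simp
      then show ?thesis using 1 by argo
    qed
    have chord: "{z \<in> ?Z. SX i \<in> spike_chord z} = {SY i}" if "i \<in> {1..<r}" for i
      using that by auto
    have sing: "even (card (S \<inter> {SY i})) \<longleftrightarrow> SY i \<notin> S" for i
      using even_card_Int_insert[of "{}" "SY i" S] by simp
    have *: "?row S \<longleftrightarrow> even (card (?at S r)) \<and>
        (\<forall>i \<in> {1..<r}. even (card (?at S i)))"
      unfolding ins by simp
    have **: "S \<in> ?Cy \<longleftrightarrow>
        (even (card (S \<inter> ?Z)) \<longleftrightarrow> (STip \<in> S \<longleftrightarrow> SX r \<in> S)) \<and>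
        (\<forall>i \<in> {1..<r}. SY i \<notin> S \<longleftrightarrow> (SX i \<in> S \<longleftrightarrow> SX r \<in> S))"
    proof -
      have "(\<forall>y \<in> ?X. even (card (S \<inter> {z \<in> ?Z. y \<in> spike_chord z})) \<longleftrightarrow> (y \<in> S \<longleftrightarrow> SX r \<in> S)) \<longleftrightarrow>
          (\<forall>i \<in> {1..<r}. SY i \<notin> S \<longleftrightarrow> (SX i \<in> S \<longleftrightarrow> SX r \<in> S))"
        unfolding ball_simps(9) by (intro ball_cong refl) (simp only: chord sing)
      then show ?thesis using S unfolding chord_cycles_def by simp
    qed
    show ?thesis
    proof (cases "even (card (S \<inter> ?Z)) \<longleftrightarrow> (STip \<in> S \<longleftrightarrow> SX r \<in> S)")
      case True
      then have "even (card (?at S i)) \<longleftrightarrow>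
          (SY i \<notin> S \<longleftrightarrow> (SX i \<in> S \<longleftrightarrow> SX r \<in> S))" if "i \<in> {1..<r}" for i
        using row[OF that] by argo
      then show ?thesis unfolding * ** top by simp
    next
      case False
      show ?thesis unfolding * ** top
        by (rule iffI; elim conjE; rule notE[OF False]; assumption)
    qed
  qed
  have fin: "finite ?E" by simp
  have "indeps (cotipped_spike r) = indeps (chorded spike_chord STip (SX r) ?X ?Z)"
  proof (rule set_eqI)
    fix I
    have "(\<forall>S \<in> {S. S \<subseteq> ?E \<and> ?row S}. S \<subseteq> I \<longrightarrow> S = {}) \<longleftrightarrow>
        (\<forall>S \<in> ?Cy. S \<subseteq> I \<longrightarrow> S = {})" if I: "I \<subseteq> ?E'"
    proof -
      have mem: "S \<in> {S. S \<subseteq> ?E \<and> ?row S} \<longleftrightarrow> S \<in> ?Cy" if "S \<subseteq> I" for S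
      proof -
        have "S \<subseteq> ?E'" "S \<subseteq> ?E" using that I E by blast+
        then show ?thesis using cyc[of S] by simp
      qed
      have "(S \<in> {S. S \<subseteq> ?E \<and> ?row S} \<longrightarrow> S \<subseteq> I \<longrightarrow> S = {}) \<longleftrightarrow>
          (S \<in> ?Cy \<longrightarrow> S \<subseteq> I \<longrightarrow> S = {})" for S
        by (cases "S \<subseteq> I") (simp_all only: mem simp_thms)
      then show ?thesis unfolding Ball_def by (rule all_cong1)
    qed
    moreover have "I \<in> indeps (cotipped_spike r) \<longleftrightarrow> I \<subseteq> ?E' \<and>
        (\<forall>S \<in> {S. S \<subseteq> ?E \<and> ?row S}. S \<subseteq> I \<longrightarrow> S = {})"
      unfolding cotipped_spike_def tipped_spike_def vector_matroid_bit[OF fin] delete_elements_def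
        E[symmetric]
      by (auto simp: indeps_cycle_matroid)
    ultimately show "I \<in> indeps (cotipped_spike r) \<longleftrightarrow>
        I \<in> indeps (chorded spike_chord STip (SX r) ?X ?Z)"
      unfolding chorded_def indeps_cycle_matroid by blast
  qed
  moreover have "ground (cotipped_spike r) = ground (chorded spike_chord STip (SX r) ?X ?Z)"
    unfolding cotipped_spike_def tipped_spike_def delete_elements_def vector_matroid_def
    using E by simp
  ultimately show ?thesis unfolding standard_spike_def by simp
qed

lemma chord_data_standard_spike:
  "1 \<le> r \<Longrightarrow> chord_data STip (SX r) (SX ` {1..<r}) (SY ` {1..<r})"
  by (auto simp: chord_data_def)

lemma card_ground_cotipped_spike:
  assumes "1 \<le> r"
  shows "card (ground (cotipped_spike r)) = 2 * r"
proof -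
  have "card (SX ` {1..<r}) = r - 1" "card (SY ` {1..<r}) = r - 1"
    by (simp_all add: card_image inj_on_def)
  then show ?thesis
    using card_ground_chorded[OF chord_data_standard_spike[OF assms], of spike_chord] assms
    unfolding cotipped_spike_chorded[OF assms] standard_spike_def by simp
qed

text \<open>
  The two alternatives correspond to the tip being the first or the second end of the segment; if
  \<open>card X = 2\<close>, both hold, for different choices of \<open>g\<close>.
\<close>

definition spike_segment :: "('a \<Rightarrow> 'a set) \<Rightarrow> 'a set \<Rightarrow> 'a set \<Rightarrow> bool" where
  "spike_segment A X Z \<longleftrightarrow> 2 \<le> card X \<and> (\<exists>g. bij_betw g X Z \<and>
     ((\<forall>x \<in> X. A (g x) \<inter> X = {x}) \<or> (\<forall>x \<in> X. A (g x) \<inter> X = X - {x})))"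

lemma matroid_iso_standard_spike:
  assumes cd: "chord_data e f X Z" and g: "bij_betw g X Z" and A: "\<forall>x \<in> X. A (g x) \<inter> X = {x}"
  shows "\<exists>\<phi>. matroid_iso \<phi> (chorded A e f X Z) (standard_spike (card X + 1)) \<and>
    \<phi> e = STip \<and> \<phi> f = SX (card X + 1)"
proof -
  let ?r = "card X + 1"
  have fin: "finite X" using cd by (simp add: chord_data_def)
  then obtain h where h: "bij_betw h X {1..<?r}"
    by (metis add_diff_cancel_right' card_atLeastLessThan finite_atLeastLessThan finite_same_card_bij)
  define \<phi> where "\<phi> u = (if u = e then STip else if u = f then SX ?r else if u \<in> X then SX (h u)
    else SY (h (inv_into X g u)))" for u
  have ginv: "inv_into X g (g x) = x" if "x \<in> X" for x
    using g that by (simp add: bij_betw_def)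
  have d: "e \<noteq> f" "e \<notin> X" "e \<notin> Z" "f \<notin> X" "f \<notin> Z" "X \<inter> Z = {}"
    using cd by (auto simp: chord_data_def)
  have gZ: "g x \<in> Z" if "x \<in> X" for x using g that by (auto simp: bij_betw_def)
  have val: "\<phi> e = STip" "\<phi> f = SX ?r" "\<And>x. x \<in> X \<Longrightarrow> \<phi> x = SX (h x)"
    "\<And>x. x \<in> X \<Longrightarrow> \<phi> (g x) = SY (h x)"
    using d gZ ginv unfolding \<phi>_def by auto
  have Z: "Z = g ` X" using g by (simp add: bij_betw_def)
  have hX: "h ` X = {1..<?r}" and hinj: "inj_on h X" using h by (auto simp: bij_betw_def)
  have hr: "h x \<noteq> ?r" if "x \<in> X" for x using hX that by force
  have "inj_on \<phi> ({e, f} \<union> X \<union> Z)"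
    unfolding Z using hinj hr
    by (auto simp: inj_on_def val) (metis val(3) spike_elem.inject(1) hr)+
  moreover have "y \<in> A z \<longleftrightarrow> \<phi> y \<in> spike_chord (\<phi> z)" if "y \<in> X" "z \<in> Z" for y z
  proof -
    obtain x where x: "x \<in> X" "z = g x" using \<open>z \<in> Z\<close> unfolding Z by blast
    then have "y \<in> A z \<longleftrightarrow> y = x" using A that by blast
    also have "\<dots> \<longleftrightarrow> h y = h x" using hinj x that by (auto simp: inj_on_def)
    finally show ?thesis using x that by (simp add: val)
  qed
  ultimately have "matroid_iso \<phi> (chorded A e f X Z)
      (chorded spike_chord (\<phi> e) (\<phi> f) (\<phi> ` X) (\<phi> ` Z))"
    by (rule matroid_iso_chorded)
  moreover have "\<phi> ` X = SX ` {1..<?r}" unfolding hX[symmetric] using val(3) by (simp add: image_image)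
  moreover have "\<phi> ` Z = SY ` {1..<?r}" unfolding hX[symmetric] Z using val(4) by (simp add: image_image)
  ultimately show ?thesis unfolding standard_spike_def using val(1,2) by auto
qed

text \<open>The second alternative of a spike segment becomes the first after the ends are
  interchanged; the tip is then \<open>f\<close>, and the unordered pair is the same.\<close>

lemma spike_segment_tip_cotip:
  assumes cd: "chord_data e f X Z" and sp: "spike_segment A X Z"
  shows "tip_cotip_pair (card X + 1) (chorded A e f X Z) {e, f}"
proof -
  obtain g where g: "bij_betw g X Z"
    and or: "(\<forall>x \<in> X. A (g x) \<inter> X = {x}) \<or> (\<forall>x \<in> X. - A (g x) \<inter> X = {x})"
    using sp unfolding spike_segment_def by fastforce
  have "\<exists>\<phi>. matroid_iso \<phi> (chorded A e f X Z) (standard_spike (card X + 1)) \<and>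
      \<phi> ` {e, f} = {STip, SX (card X + 1)}"
    using or
  proof
    assume "\<forall>x \<in> X. A (g x) \<inter> X = {x}"
    then show ?thesis using matroid_iso_standard_spike[OF cd g, of A] by auto
  next
    assume "\<forall>x \<in> X. - A (g x) \<inter> X = {x}"
    then show ?thesis
      using matroid_iso_standard_spike[OF chord_data_swap[OF cd] g, of "\<lambda>z. - A z"] chorded_swap[OF cd, of A]
      by auto
  qed
  then show ?thesis unfolding tip_cotip_pair_def by (simp add: cotipped_spike_chorded)
qed

lemma isomorphic_cotipped_spike_card:
  assumes "isomorphic_matroid N (cotipped_spike r)" "1 \<le> r"
  shows "card (ground N) = 2 * r"
proof -
  have "card (ground N) = card (ground (cotipped_spike r))"
    using assms(1) by (auto simp: isomorphic_matroid_def matroid_iso_def intro: bij_betw_same_card)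
  then show ?thesis using card_ground_cotipped_spike[OF assms(2)] by simp
qed

section \<open>Binary spikes are 3-connected\<close>

lemma card_le_matroid_rank:
  assumes "finite (ground M)" "indeps M \<subseteq> Pow (ground M)" "I \<in> indeps M" "I \<subseteq> X"
  shows "card I \<le> matroid_rank M X"
proof -
  have "finite {I \<in> indeps M. I \<subseteq> X}"
    by (rule finite_subset[of _ "Pow (ground M)"]) (use assms in auto)
  then show ?thesis using assms unfolding matroid_rank_def by (intro Max_ge) auto
qed

lemma matroid_rank_le:
  assumes "finite (ground M)" "indeps M \<subseteq> Pow (ground M)" "{} \<in> indeps M"
    and "\<And>I. I \<in> indeps M \<Longrightarrow> I \<subseteq> X \<Longrightarrow> card I \<le> k"
  shows "matroid_rank M X \<le> k"
proof -
  have "finite {I \<in> indeps M. I \<subseteq> X}"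
    by (rule finite_subset[of _ "Pow (ground M)"]) (use assms in auto)
  then show ?thesis using assms unfolding matroid_rank_def by (subst Max_le_iff) auto
qed

text \<open>The rank is at most \<open>card X + 1\<close>, so a rank sum of at least
  \<open>card X + 3\<close> refutes separations of order 1 and 2. It has to be shown only when both
  sides have two elements, and by passing to the complement only for sides containing
  \<open>e\<close>. A one-element side can only give order 1, for which a rank sum of
  \<open>card X + 2\<close> suffices.\<close>

lemma n_connected_3_chordedI:
  assumes cd: "chord_data e f X Z"
    and two: "\<And>U. U \<subseteq> ground (chorded A e f X Z) \<Longrightarrow> e \<in> U \<Longrightarrow> 2 \<le> card U \<Longrightarrow>
      2 \<le> card (ground (chorded A e f X Z) - U) \<Longrightarrow>
      \<exists>I J. I \<in> indeps (chorded A e f X Z) \<and> J \<in> indeps (chorded A e f X Z) \<and> I \<subseteq> U \<and>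
        J \<inter> U = {} \<and> card X + 3 \<le> card I + card J"
  shows "n_connected_matroid 3 (chorded A e f X Z)"
proof -
  let ?C = "{e, f} \<union> X"
  let ?M = "chorded A e f X Z"
  let ?E = "ground ?M"
  have M: "finite ?E" "indeps ?M \<subseteq> Pow ?E" "{} \<in> indeps ?M"
    using matroid_chorded[OF cd, of A] by (auto simp: matroid_def)
  have rank: "matroid_rank ?M ?E \<le> card X + 1"
    by (rule matroid_rank_le[OF M]) (rule chorded_indep_card[OF cd])
  have ge: "card I + card J \<le> matroid_rank ?M U + matroid_rank ?M (?E - U)"
    if "I \<in> indeps ?M" "J \<in> indeps ?M" "I \<subseteq> U" "J \<inter> U = {}" for I J U
    by (intro add_mono card_le_matroid_rank[OF M(1,2)]) (use that M(2) in blast)+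
  have sep2: "card X + 3 \<le> matroid_rank ?M U + matroid_rank ?M (?E - U)"
    if U: "U \<subseteq> ?E" "2 \<le> card U" "2 \<le> card (?E - U)" for U
  proof (cases "e \<in> U")
    case True
    then obtain I J where "I \<in> indeps ?M" "J \<in> indeps ?M" "I \<subseteq> U" "J \<inter> U = {}" "card X + 3 \<le> card I + card J"
      using two[OF U(1) _ U(2,3)] by blast
    then show ?thesis using ge[of I J U] by simp
  next
    case False
    have compl: "?E - (?E - U) = U" using U(1) by blast
    then obtain I J where "I \<in> indeps ?M" "J \<in> indeps ?M" "I \<subseteq> ?E - U" "J \<inter> (?E - U) = {}"
        "card X + 3 \<le> card I + card J"
      using two[of "?E - U"] U False by auto
    then show ?thesis using ge[of I J "?E - U"] compl by simp
  qed
  have single: "card X + 2 \<le> matroid_rank ?M {u} + matroid_rank ?M (?E - {u})" if u: "u \<in> ?E" for u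
  proof -
    have C: "circuit ?M ?C" by (rule circuit_whole[OF cd])
    have cC: "card ?C = card X + 2" using cd by (simp add: chord_data_def)
    have "{u} \<in> indeps ?M"
    proof (cases "u \<in> Z")
      case True
      then have "{u} \<subset> {u, e} \<union> (A u \<inter> X)" using cd by (auto simp: chord_data_def)
      then show ?thesis using circuit_chord_e[OF cd True, of A] circuit_proper_subset_indep by metis
    next
      case False
      then have "{u} \<subset> ?C" using u cd by (auto simp: chord_data_def)
      then show ?thesis using C circuit_proper_subset_indep by metis
    qed
    \<comment> \<open>Removing \<open>u\<close> itself from the whole circuit, or \<open>e\<close>
      when \<open>u\<close> is a chord, leaves an independent set of size \<open>card X + 1\<close>
      that avoids \<open>u\<close>.\<close>
    moreover define c where "c = (if u \<in> {e, f} \<union> X then u else e)"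
    have c: "c \<in> ?C" by (simp add: c_def)
    have "?C - {c} \<in> indeps ?M" by (rule circuit_proper_subset_indep[OF C]) (use c in blast)
    moreover have "(?C - {c}) \<inter> {u} = {}" by (auto simp: c_def)
    moreover have "card (?C - {c}) = card X + 1" using c cC by (simp only: card_Diff_singleton)
    ultimately show ?thesis using ge[of "{u}" "?C - {c}" "{u}"] by simp
  qed
  have "\<not> matroid_separation ?M k U" if k: "1 \<le> k" "k < 3" for k U
  proof
    assume s: "matroid_separation ?M k U"
    then have U: "U \<subseteq> ?E" "k \<le> card U" "k \<le> card (?E - U)"
      "matroid_rank ?M U + matroid_rank ?M (?E - U) < card X + 1 + k"
      using rank by (auto simp: matroid_separation_def)
    have finU: "finite U" using U(1) M(1) finite_subset by blast
    consider "2 \<le> card U" "2 \<le> card (?E - U)" | "card U = 1" "k = 1" | "card (?E - U) = 1" "k = 1"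
      using U k by linarith
    then show False
    proof cases
      case 1
      then show ?thesis using sep2[OF U(1)] U(4) k by linarith
    next
      case 2
      then obtain u where "U = {u}" by (meson card_1_singletonE)
      then show ?thesis using single[of u] U 2 by auto
    next
      case 3
      then obtain u where u: "?E - U = {u}" by (meson card_1_singletonE)
      then have "U = ?E - {u}" "u \<in> ?E" using U(1) by blast+
      then show ?thesis using single[of u] U(4) 3 u by simp
    qed
  qed
  then show ?thesis unfolding n_connected_matroid_def by blast
qed

text \<open>A cycle through \<open>f\<close> meets each pair \<open>{x, g x}\<close> in exactly one
  element, so missing one pair excludes it. A cycle avoiding \<open>f\<close> is a union of whole
  pairs, together with \<open>e\<close> exactly when their number is odd. Hence no nonempty cycle of
  this kind fits into a set with at most one whole pair, and with none if the tip is
  present.\<close>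

lemma spike_indep:
  assumes cd: "chord_data e f X Z" and g: "bij_betw g X Z" and A: "\<forall>x \<in> X. A (g x) \<inter> X = {x}"
    and I: "I \<subseteq> {e, f} \<union> X \<union> Z"
    and If: "f \<in> I \<Longrightarrow> \<exists>x \<in> X. x \<notin> I \<and> g x \<notin> I"
    and Ie: "e \<in> I \<Longrightarrow> \<forall>x \<in> X. \<not> (x \<in> I \<and> g x \<in> I)"
    and I1: "\<And>x y. \<lbrakk>x \<in> X; y \<in> X; x \<in> I; g x \<in> I; y \<in> I; g y \<in> I\<rbrakk> \<Longrightarrow> x = y"
  shows "I \<in> indeps (chorded A e f X Z)"
  unfolding chorded_def indeps_cycle_matroid
proof (intro conjI ballI impI I)
  fix S assume S: "S \<in> chord_cycles A e f X Z" "S \<subseteq> I"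
  have Z: "Z = g ` X" using g by (simp add: bij_betw_def)
  have row: "g y \<notin> S \<longleftrightarrow> (y \<in> S \<longleftrightarrow> f \<in> S)" if y: "y \<in> X" for y
  proof -
    have mem: "y \<in> A (g x) \<longleftrightarrow> x = y" if "x \<in> X" for x
    proof -
      have "A (g x) \<inter> X = {x}" using A that by simp
      then show ?thesis using y by auto
    qed
    have chords: "{z \<in> Z. y \<in> A z} = {g y}"
    proof (rule set_eqI)
      fix z
      show "z \<in> {z \<in> Z. y \<in> A z} \<longleftrightarrow> z \<in> {g y}"
        using y mem unfolding Z by (cases "z \<in> g ` X") auto
    qed
    have "even (card (S \<inter> {z \<in> Z. y \<in> A z})) \<longleftrightarrow> (y \<in> S \<longleftrightarrow> f \<in> S)"
      using S(1) y by (simp add: chord_cycles_def)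
    then show ?thesis unfolding chords using even_card_Int_insert[of "{}" "g y" S] by simp
  qed
  have "f \<notin> S"
  proof
    assume "f \<in> S"
    then obtain x where "x \<in> X" "x \<notin> I" "g x \<notin> I" using If S(2) by blast
    then show False using row[of x] S(2) \<open>f \<in> S\<close> by blast
  qed
  then have pair: "y \<in> S \<longleftrightarrow> g y \<in> S" if "y \<in> X" for y using row[OF that] by blast
  have "S \<inter> Z = {}"
  proof (rule ccontr)
    assume "S \<inter> Z \<noteq> {}"
    then obtain y where y: "y \<in> X" "g y \<in> S" "y \<in> S" using pair unfolding Z by blast
    have "S \<inter> Z = {g y}"
    proof
      show "S \<inter> Z \<subseteq> {g y}"
      proof
        fix z assume "z \<in> S \<inter> Z"
        then obtain x where x: "x \<in> X" "z = g x" "g x \<in> S" "x \<in> S" using pair unfolding Z by blast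
        then have "x = y" using I1[of x y] y S(2) by blast
        then show "z \<in> {g y}" using x by simp
      qed
    qed (use y Z in blast)
    then have "\<not> (e \<in> S \<longleftrightarrow> f \<in> S)" using S(1) unfolding chord_cycles_def by auto
    then have "e \<in> I" using \<open>f \<notin> S\<close> S(2) by blast
    then show False using Ie y S(2) by blast
  qed
  then show "S = {}" using chord_cycle_without_chords[OF S(1)] \<open>f \<notin> S\<close> by blast
qed

text \<open>
  In each case the two independent sets are transversals of the pairs \<open>{x, g x}\<close>, enlarged by the
  tip \<open>e\<close>, by the cotip \<open>f\<close> if some pair is missed, or, in the absence of the tip, by the
  second element of one pair.
\<close>

lemma spike_two_sides:
  assumes cd: "chord_data e f X Z" and g: "bij_betw g X Z" and A: "\<forall>x \<in> X. A (g x) \<inter> X = {x}"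
    and X2: "2 \<le> card X" and U: "U \<subseteq> {e, f} \<union> X \<union> Z" "e \<in> U" "2 \<le> card U"
    and V: "V = ({e, f} \<union> X \<union> Z) - U" "2 \<le> card V"
  shows "\<exists>I J. I \<in> indeps (chorded A e f X Z) \<and> J \<in> indeps (chorded A e f X Z) \<and> I \<subseteq> U \<and>
    J \<inter> U = {} \<and> card X + 3 \<le> card I + card J"
proof -
  let ?E = "{e, f} \<union> X \<union> Z"
  let ?M = "chorded A e f X Z"
  note indep = spike_indep[OF cd g A]
  have d: "e \<noteq> f" "e \<notin> X" "e \<notin> Z" "f \<notin> X" "f \<notin> Z" "X \<inter> Z = {}" "finite X" "finite Z"
    using cd by (auto simp: chord_data_def)
  have Z: "Z = g ` X" and ginj: "inj_on g X" using g by (auto simp: bij_betw_def)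
  have gn: "g x \<notin> X" "g x \<noteq> e" "g x \<noteq> f" "g x \<in> Z" if "x \<in> X" for x using that d Z by auto
  have finV: "finite V" using d V by simp
  have finU: "finite U" using d U(1) finite_subset[of U "{e, f} \<union> X \<union> Z"] by simp
  define hU where "hU x = (if x \<in> U then x else g x)" for x
  define hV where "hV x = (if x \<in> V then x else g x)" for x
  \<comment> \<open>\<open>Xa\<close> and \<open>Xc\<close> index the pairs lying wholly in
    \<open>V\<close> and wholly in \<open>U\<close>; \<open>TU\<close> and \<open>TV\<close> pick
    one element of every pair that meets \<open>U\<close> and \<open>V\<close>,
    respectively.\<close>
  define Xa where "Xa = {x \<in> X. x \<in> V \<and> g x \<in> V}"
  define Xc where "Xc = {x \<in> X. x \<in> U \<and> g x \<in> U}"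
  define TU where "TU = hU ` (X - Xa)"
  define TV where "TV = hV ` (X - Xc)"
  have UV: "x \<in> V \<longleftrightarrow> x \<notin> U" if "x \<in> X \<union> Z \<union> {e, f}" for x using that V by blast
  have fin: "finite Xa" "finite Xc" using d by (auto simp: Xa_def Xc_def)
  have hinj: "inj_on hU X" "inj_on hV X"
    using ginj gn by (auto simp: inj_on_def hU_def hV_def)
  have cardT: "card TU = card (X - Xa)" "card TV = card (X - Xc)"
    unfolding TU_def TV_def by (intro card_image inj_on_subset[OF hinj(1)] inj_on_subset[OF hinj(2)]; blast)+
  have TUsub: "TU \<subseteq> U" "TU \<subseteq> X \<union> Z"
    using UV gn by (auto simp: TU_def hU_def Xa_def)
  have TVsub: "TV \<subseteq> V" "TV \<subseteq> X \<union> Z"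
    using UV gn by (auto simp: TV_def hV_def Xc_def)
  have TUx: "\<not> (x \<in> TU \<and> g x \<in> TU)" "x \<in> Xa \<Longrightarrow> x \<notin> TU \<and> g x \<notin> TU" if "x \<in> X" for x
    using that gn ginj by (auto simp: TU_def hU_def Xa_def inj_on_def)
  have TVx: "\<not> (x \<in> TV \<and> g x \<in> TV)" "x \<in> Xc \<Longrightarrow> x \<notin> TV \<and> g x \<notin> TV" if "x \<in> X" for x
    using that gn ginj by (auto simp: TV_def hV_def Xc_def inj_on_def)
  have finT: "finite TU" "finite TV" using d by (auto simp: TU_def TV_def)
  have nT: "e \<notin> TU" "f \<notin> TU" "e \<notin> TV" "f \<notin> TV" using TUsub TVsub d by auto
  have VU: "J \<inter> U = {}" if "J \<subseteq> V" for J using that V by blast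
  have eTU: "insert e TU \<in> indeps ?M"
    by (rule indep) (use TUsub TUx nT gn d in auto)
  have ceTU: "card (insert e TU) = card (X - Xa) + 1" using nT finT cardT by simp
  have eV: "e \<notin> V" using U(2) V by blast
  \<comment> \<open>If no pair lies in \<open>V\<close>, the set \<open>insert e TU\<close> has
    \<open>card X + 1\<close> elements and two more are needed from \<open>V\<close>. The set
    \<open>V\<close> itself is independent unless it contains \<open>f\<close> and meets every pair;
    in that case \<open>TV\<close> has \<open>card X\<close> elements, which is at least
    two.\<close>
  show ?thesis
  proof (cases "Xa = {}")
    case True
    have full: "\<not> (x \<in> V \<and> g x \<in> V)" if "x \<in> X" for x using True that by (auto simp: Xa_def)
    show ?thesis
    proof (cases "f \<in> V \<and> Xc = {}")
      case False
      have "V \<in> indeps ?M"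
        by (rule indep) (use False full V UV eV gn in \<open>auto simp: Xc_def\<close>)
      then show ?thesis
        using eTU ceTU True TUsub U(2) V(2) VU[of V] by (intro exI[of _ "insert e TU"] exI[of _ V]) auto
    next
      case fV: True
      have "TV \<in> indeps ?M"
        by (rule indep) (use TVsub TVx nT in auto)
      then show ?thesis
        using eTU ceTU True fV cardT TUsub TVsub U(2) X2 VU[of TV]
        by (intro exI[of _ "insert e TU"] exI[of _ TV]) auto
    qed
  next
    case False
    then obtain a where a: "a \<in> X" "a \<in> V" "g a \<in> V" by (auto simp: Xa_def)
    have aXa: "a \<in> Xa" "a \<notin> Xc" using a UV by (auto simp: Xa_def Xc_def)
    have aTV: "a \<in> TV" "g a \<notin> TV"
      using a aXa TVx(1)[OF a(1)] by (auto simp: TV_def hV_def image_iff)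
    \<comment> \<open>In the absence of \<open>e\<close> both elements of the pair
      \<open>{a, g a}\<close> may be used. As \<open>card Xc \<le> card (X - Xa)\<close>, the sizes
      of \<open>insert e TU\<close> and \<open>J\<close> add up to at least
      \<open>card X + 2\<close>. The missing one is gained by adding \<open>f\<close> on its own
      side, or, if \<open>f\<close> is in \<open>V\<close> and \<open>Xc\<close> is empty, from
      \<open>X - Xa\<close> being nonempty.\<close>
    define J where "J = insert (g a) TV"
    have cJ: "card J = card (X - Xc) + 1" using aTV finT cardT by (simp add: J_def)
    have JV: "J \<subseteq> V" "J \<subseteq> X \<union> Z" using a TVsub gn by (auto simp: J_def)
    have nJ: "e \<notin> J" "f \<notin> J" using JV d by auto
    have Jpair: "x = a" if "x \<in> X" "x \<in> J" "g x \<in> J" for x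
      using that TVx(1)[OF that(1)] ginj gn a by (auto simp: J_def inj_on_def)
    have Jc: "x \<notin> J \<and> g x \<notin> J" if "x \<in> Xc" "x \<in> X" for x
      using JV UV that by (auto simp: Xc_def)
    have Jind: "J \<in> indeps ?M"
    proof (rule indep)
      show "x = y" if "x \<in> X" "y \<in> X" "x \<in> J" "g x \<in> J" "y \<in> J" "g y \<in> J" for x y
        using Jpair[of x] Jpair[of y] that by simp
    qed (use JV nJ in auto)
    have ca: "card (X - Xa) + card Xa = card X" "card (X - Xc) + card Xc = card X"
      using d(7) fin by (auto simp: Xa_def Xc_def card_Diff_subset card_mono)
    have sub: "Xc \<subseteq> X - Xa" using UV by (auto simp: Xa_def Xc_def)
    then have le: "card Xc \<le> card (X - Xa)" using d(7) by (intro card_mono) auto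
    have ax: "\<exists>x \<in> X. x \<notin> TU \<and> g x \<notin> TU" using a aXa TUx(2) by blast
    show ?thesis
    proof (cases "f \<in> V")
      case fU: False
      have "insert f (insert e TU) \<in> indeps ?M"
      proof (rule indep)
        show "\<exists>x \<in> X. x \<notin> insert f (insert e TU) \<and> g x \<notin> insert f (insert e TU)"
          using a aXa TUx(2)[of a] gn[of a] d by auto
      qed (use TUsub TUx nT gn d in auto)
      moreover have "card (insert f (insert e TU)) = card (X - Xa) + 2"
        using nT finT cardT d by simp
      moreover have "insert f (insert e TU) \<subseteq> U" using TUsub U(2) fU UV by auto
      ultimately show ?thesis using Jind cJ ca le VU[OF JV(1)]
        by (intro exI[of _ "insert f (insert e TU)"] exI[of _ J]) auto
    next
      case fV: True
      show ?thesis
      proof (cases "Xc = {}")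
        case False
        then obtain c where c: "c \<in> Xc" "c \<in> X" by (auto simp: Xc_def)
        have "insert f J \<in> indeps ?M"
        proof (rule indep)
          show "\<exists>x \<in> X. x \<notin> insert f J \<and> g x \<notin> insert f J"
            using c Jc[OF c] gn[of c] d by auto
        next
          fix x y assume "x \<in> X" "y \<in> X" "x \<in> insert f J" "g x \<in> insert f J" "y \<in> insert f J" "g y \<in> insert f J"
          then show "x = y" using Jpair[of x] Jpair[of y] gn d by auto
        qed (use JV nJ gn d in auto)
        moreover have "card (insert f J) = card (X - Xc) + 2"
          using nJ cJ finT by (simp add: J_def)
        moreover have "insert f J \<subseteq> V" using fV JV by simp
        ultimately show ?thesis using eTU ceTU ca le TUsub U(2) VU[of "insert f J"]
          by (intro exI[of _ "insert e TU"] exI[of _ "insert f J"]) auto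
      next
        case c0: True
        have "X - Xa \<noteq> {}"
        proof
          assume "X - Xa = {}"
          then have "x \<in> V \<and> g x \<in> V" if "x \<in> X" for x using that by (auto simp: Xa_def)
          then have "U \<subseteq> {e}" using U(1) fV V unfolding Z by blast
          then show False using U(3) card_mono[of "{e}" U] by simp
        qed
        then have "1 \<le> card (X - Xa)" using d(7) by (simp add: card_gt_0_iff Suc_le_eq)
        then show ?thesis using eTU ceTU Jind cJ c0 TUsub U(2) VU[OF JV(1)]
          by (intro exI[of _ "insert e TU"] exI[of _ J]) auto
      qed
    qed
  qed
qed

lemma n_connected_spike:
  assumes cd: "chord_data e f X Z" and sp: "spike_segment A X Z"
  shows "n_connected_matroid 3 (chorded A e f X Z)"
proof -
  have main: "n_connected_matroid 3 (chorded B e' f' X Z)"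
    if cd': "chord_data e' f' X Z" and g: "bij_betw g X Z" "\<forall>x \<in> X. B (g x) \<inter> X = {x}" for B e' f' g
    by (rule n_connected_3_chordedI[OF cd'])
      (rule spike_two_sides[OF cd' g _ _ _ _ refl], use sp in \<open>simp_all add: spike_segment_def\<close>)
  obtain g where g: "bij_betw g X Z"
    and or: "(\<forall>x \<in> X. A (g x) \<inter> X = {x}) \<or> (\<forall>x \<in> X. - A (g x) \<inter> X = {x})"
    using sp unfolding spike_segment_def by fastforce
  show ?thesis
    using or main[OF cd g, of A] main[OF chord_data_swap[OF cd] g, of "\<lambda>z. - A z"] chorded_swap[OF cd, of A]
    by auto
qed

section \<open>Decomposing the family of chords\<close>

definition compatible :: "'a set \<Rightarrow> 'a set \<Rightarrow> bool" where
  "compatible B C \<longleftrightarrow> B \<noteq> C \<and> (B \<subseteq> C \<or> C \<subseteq> B \<or> card (B - C) = 1 \<and> card (C - B) = 1)"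

definition chord_family :: "('a \<Rightarrow> 'a set) \<Rightarrow> 'a set \<Rightarrow> 'a set \<Rightarrow> bool" where
  "chord_family A X Z \<longleftrightarrow>
     (\<forall>z \<in> Z. \<forall>w \<in> Z. z \<noteq> w \<longrightarrow> compatible (A z \<inter> X) (A w \<inter> X))"

text \<open>The three alternatives yield the three labels: a circuit, the matroid
  \<open>U_{1,3}\<close> made of the two ends and \<open>z\<close>, and a spike.\<close>

definition segment :: "('a \<Rightarrow> 'a set) \<Rightarrow> 'a set \<Rightarrow> 'a set \<Rightarrow> bool" where
  "segment A X Z \<longleftrightarrow> X \<noteq> {} \<and> Z = {} \<or> X = {} \<and> (\<exists>z. Z = {z}) \<or> spike_segment A X Z"

text \<open>A pair consists of a part of \<open>X\<close> and a set of chords. The conditions are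
  those under which a matroid with chords splits as a 2-sum between the two parts.\<close>

definition precedes :: "('a \<Rightarrow> 'a set) \<Rightarrow> 'a set \<times> 'a set \<Rightarrow> 'a set \<times> 'a set \<Rightarrow> bool" where
  "precedes A p q \<longleftrightarrow> fst p \<inter> fst q = {} \<and> snd p \<inter> snd q = {} \<and>
     (\<forall>z \<in> snd p. A z \<inter> fst q = {}) \<and> (\<forall>z \<in> snd q. fst p \<subseteq> A z)"

lemma spike_segmentI:
  assumes h: "bij_betw h Z L" and "2 \<le> card L"
    and "(\<forall>z \<in> Z. A z \<inter> L = {h z}) \<or> (\<forall>z \<in> Z. A z \<inter> L = L - {h z})"
  shows "spike_segment A L Z"
proof -
  let ?g = "inv_into Z h"
  have g: "bij_betw ?g L Z" using h by (rule bij_betw_inv_into)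
  have "h (?g x) = x" "?g x \<in> Z" if "x \<in> L" for x
    using that h g by (auto simp: bij_betw_inv_into_right bij_betw_def)
  then have "(\<forall>x \<in> L. A (?g x) \<inter> L = {x}) \<or> (\<forall>x \<in> L. A (?g x) \<inter> L = L - {x})"
    using assms(3) by metis
  then show ?thesis using g assms(2) unfolding spike_segment_def by blast
qed

text \<open>
  A family of equicardinal sets, any two of which differ by an exchange, either shares all but one
  element of each member or consists of sets missing a single element of the union.
\<close>

lemma level_spike_segment:
  assumes fin: "finite X" and two: "2 \<le> card Z" and fam: "chord_family A X Z"
    and k: "\<forall>z \<in> Z. card (A z \<inter> X) = k" and none: "\<forall>y \<in> X. \<exists>z \<in> Z. y \<notin> A z"
  shows "spike_segment A (\<Union>z \<in> Z. A z \<inter> X) Z"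
proof -
  define B where "B z = A z \<inter> X" for z
  define L where "L = (\<Union>z \<in> Z. B z)"
  have finB: "finite (B z)" for z using fin by (simp add: B_def)
  have finZ: "finite Z" using two card.infinite by fastforce
  have cB: "card (B z) = k" if "z \<in> Z" for z using k that by (simp add: B_def)
  have comp: "compatible (B z) (B w)" if "z \<in> Z" "w \<in> Z" "z \<noteq> w" for z w
    using fam that by (simp add: chord_family_def B_def)
  have ne: "B z \<noteq> B w" if "z \<in> Z" "w \<in> Z" "z \<noteq> w" for z w
    using comp[OF that] by (simp add: compatible_def)
  have ex: "\<exists>c. B z - B w = {c}" if zw: "z \<in> Z" "w \<in> Z" "z \<noteq> w" for z w
  proof -
    have "\<not> B z \<subseteq> B w" "\<not> B w \<subseteq> B z"
      using ne[OF zw] card_subset_eq[OF finB] cB zw by metis+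
    then have "card (B z - B w) = 1" using comp[OF zw] by (simp add: compatible_def)
    then show ?thesis by (metis card_1_singletonE)
  qed
  have BL: "B z \<subseteq> L" if "z \<in> Z" for z using that by (auto simp: L_def)
  have LX: "L \<subseteq> X" by (auto simp: L_def B_def)
  have AL: "A z \<inter> L = B z" if "z \<in> Z" for z using that by (auto simp: L_def B_def)
  obtain z w where zw: "z \<in> Z" "w \<in> Z" "z \<noteq> w"
  proof -
    have "Z \<noteq> {}" using two by auto
    then obtain z where z: "z \<in> Z" by blast
    have "Z \<noteq> {z}" using two by auto
    then show ?thesis using z that by blast
  qed
  obtain a b where ab: "B z - B w = {a}" "B w - B z = {b}" using ex zw by metis
  have "L \<noteq> {}" using ab BL[OF zw(1)] by blast
  have main: "\<exists>h. bij_betw h Z L \<and> ((\<forall>z \<in> Z. B z = {h z}) \<or> (\<forall>z \<in> Z. B z = L - {h z}))"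
  proof (cases "k = 1")
    case True
    then have "\<forall>z \<in> Z. \<exists>x. B z = {x}" using cB by (metis card_1_singletonE)
    then obtain h where h: "\<forall>z \<in> Z. B z = {h z}" by metis
    then have "inj_on h Z" using ne by (metis inj_onI)
    moreover have "h ` Z = L" using h by (auto simp: L_def)
    ultimately show ?thesis using h by (auto simp: bij_betw_def)
  next
    case False
    \<comment> \<open>Since \<open>k\<close> is not 1, the common part \<open>I\<close> of the two
      sets is nonempty, which leads to the second alternative: every member is \<open>L'\<close>
      without one element.\<close>
    define I where "I = B z \<inter> B w"
    define L' where "L' = I \<union> {a, b}"
    have Bz: "B z = insert a I" "a \<notin> I" and Bw: "B w = insert b I" "b \<notin> I" "a \<noteq> b"
      using ab by (auto simp: I_def)
    have finI: "finite I" using finB by (simp add: I_def)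
    have kI: "k = Suc (card I)" using Bz cB[OF zw(1)] finI by simp
    then have "I \<noteq> {}" using False by auto
    then obtain i where i: "i \<in> I" by blast
    \<comment> \<open>Each of \<open>B z\<close> and \<open>B w\<close> has only one element outside
      \<open>B u\<close>, and that is \<open>j\<close>; so \<open>B u\<close> contains the rest of
      \<open>L'\<close> and equals it by cardinality.\<close>
    have miss: "B u = L' - {j}" if u: "u \<in> Z" and j: "j \<in> I" "j \<notin> B u" for u j
    proof -
      have "u \<noteq> z" "u \<noteq> w" using j Bz Bw by auto
      then obtain c d where c: "B z - B u = {c}" and d: "B w - B u = {d}" using ex zw u by metis
      moreover have "j \<in> B z - B u" "j \<in> B w - B u" using j Bz Bw by simp_all
      ultimately have "c = j" "d = j" by simp_all
      then have sub: "L' - {j} \<subseteq> B u" using c d Bz Bw by (auto simp: L'_def)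
      have "card (L' - {j}) = k"
        using kI Bz Bw finI j by (simp add: L'_def card_Diff_singleton)
      then show ?thesis using card_subset_eq[OF finB sub] cB[OF u] by simp
    qed
    have all: "\<exists>x. x \<in> L' \<and> B u = L' - {x}" if u: "u \<in> Z" for u
    proof (cases "I \<subseteq> B u")
      case False
      then obtain j where "j \<in> I" "j \<notin> B u" by blast
      then show ?thesis using miss[OF u] by (auto simp: L'_def)
    next
      case True
      \<comment> \<open>A member containing \<open>I\<close> is compared with a member
        \<open>B v\<close> that misses \<open>i\<close> and so contains both \<open>a\<close> and
        \<open>b\<close>. Only one element of \<open>B v\<close> is outside \<open>B u\<close>, so
        \<open>B u\<close> contains \<open>a\<close> or \<open>b\<close> and is \<open>B z\<close>
        or \<open>B w\<close> by cardinality.\<close>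
      have "i \<in> X" using i by (auto simp: I_def B_def)
      then obtain v where v: "v \<in> Z" "i \<notin> B v" using none by (auto simp: B_def)
      then have Bv: "B v = L' - {i}" using miss i by blast
      have "u \<noteq> v" using True v i by blast
      then obtain c where "B v - B u = {c}" using ex v u by metis
      moreover have "a \<in> B v" "b \<in> B v" using Bv Bz Bw i by (auto simp: L'_def)
      ultimately have "a \<in> B u \<or> b \<in> B u" using Bw(3) by (metis DiffI singletonD)
      then have "B z \<subseteq> B u \<or> B w \<subseteq> B u" using True unfolding Bz(1) Bw(1) by blast
      then have "B z = B u \<or> B w = B u" using card_subset_eq[OF finB] cB u zw by metis
      moreover have "B z = L' - {b}" "B w = L' - {a}" using Bz Bw by (auto simp: L'_def)
      ultimately show ?thesis by (auto simp: L'_def)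
    qed
    then obtain h where h: "\<forall>u \<in> Z. h u \<in> L' \<and> B u = L' - {h u}" by metis
    then have "inj_on h Z" using ne by (metis inj_onI)
    have "L' \<subseteq> L" using BL[OF zw(1)] BL[OF zw(2)] Bz Bw by (auto simp: L'_def)
    then have LL: "L' = L" using h by (auto simp: L_def)
    have "h ` Z = L"
    proof
      show "h ` Z \<subseteq> L" using h LL by auto
      show "L \<subseteq> h ` Z"
      proof
        fix x assume x: "x \<in> L"
        then obtain u where u: "u \<in> Z" "x \<notin> B u" using none LX by (auto simp: B_def)
        then have "x = h u" using h x LL by blast
        then show "x \<in> h ` Z" using u by simp
      qed
    qed
    then show ?thesis using \<open>inj_on h Z\<close> h LL by (auto simp: bij_betw_def)
  qed
  then obtain h where h: "bij_betw h Z L" "(\<forall>z \<in> Z. B z = {h z}) \<or> (\<forall>z \<in> Z. B z = L - {h z})" by blast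
  have "card L = card Z" using bij_betw_same_card[OF h(1)] by simp
  then have "spike_segment A L Z"
    using h two AL by (intro spike_segmentI[OF h(1)]) auto
  then show ?thesis by (simp add: L_def B_def)
qed

text \<open>Segments are split off from the left. Elements of \<open>X\<close> common to all
  \<open>A z\<close> form a circuit segment; failing these, a chord with
  \<open>A z \<inter> X\<close> empty forms a \<open>U_{1,3}\<close> segment; failing that, the sets
  of least size form a spike segment. Taking all common elements at once prevents two circuit
  segments in a row.\<close>

lemma chord_family_decomposition:
  assumes "finite X" "finite Z" "chord_family A X Z"
  shows "\<exists>ps. (\<Union>p \<in> set ps. fst p) = X \<and> (\<Union>p \<in> set ps. snd p) = Z \<and>
    sorted_wrt (precedes A) ps \<and> (\<forall>p \<in> set ps. segment A (fst p) (snd p)) \<and>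
    successively (\<lambda>p q. snd p \<noteq> {} \<or> snd q \<noteq> {}) ps"
  using assms
proof (induction "card X + card Z" arbitrary: X Z rule: less_induct)
  case less
  note fin = less.prems(1,2) and fam = less.prems(3)
  let ?K = "{y \<in> X. \<forall>z \<in> Z. y \<in> A z}"
  have step: ?case
    if X1: "X1 \<subseteq> X" and Z1: "Z1 \<subseteq> Z" and seg: "segment A X1 Z1"
      and low: "\<forall>z \<in> Z1. A z \<inter> X \<subseteq> X1" and high: "\<forall>z \<in> Z - Z1. X1 \<subseteq> A z"
      and K: "Z1 = {} \<Longrightarrow> ?K \<subseteq> X1"
    for X1 Z1
  proof -
    have ne: "X1 \<noteq> {} \<or> Z1 \<noteq> {}" using seg by (auto simp: segment_def spike_segment_def)
    have smaller: "card (X - X1) + card (Z - Z1) < card X + card Z"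
    proof (cases "X1 = {}")
      case True
      then have "Z - Z1 \<subset> Z" using ne Z1 by blast
      then show ?thesis using True psubset_card_mono[OF fin(2)] by simp
    next
      case False
      then have "X - X1 \<subset> X" using X1 by blast
      then have "card (X - X1) < card X" using psubset_card_mono[OF fin(1)] by blast
      moreover have "card (Z - Z1) \<le> card Z" using fin(2) by (intro card_mono) auto
      ultimately show ?thesis by linarith
    qed
    have fam': "chord_family A (X - X1) (Z - Z1)"
      unfolding chord_family_def
    proof (intro ballI impI)
      fix z w assume zw: "z \<in> Z - Z1" "w \<in> Z - Z1" "z \<noteq> w"
      then have sub: "X1 \<subseteq> A z" "X1 \<subseteq> A w" using high by auto
      let ?B = "\<lambda>u. A u \<inter> (X - X1)"
      have eq: "?B z - ?B w = A z \<inter> X - A w \<inter> X" "?B w - ?B z = A w \<inter> X - A z \<inter> X"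
        "?B z = ?B w \<longleftrightarrow> A z \<inter> X = A w \<inter> X" "?B z \<subseteq> ?B w \<longleftrightarrow> A z \<inter> X \<subseteq> A w \<inter> X"
        "?B w \<subseteq> ?B z \<longleftrightarrow> A w \<inter> X \<subseteq> A z \<inter> X"
        using sub by blast+
      show "compatible (?B z) (?B w)"
        using fam zw unfolding chord_family_def compatible_def eq by blast
    qed
    obtain ps where ps: "(\<Union>p \<in> set ps. fst p) = X - X1" "(\<Union>p \<in> set ps. snd p) = Z - Z1"
      "sorted_wrt (precedes A) ps" "\<forall>p \<in> set ps. segment A (fst p) (snd p)"
      "successively (\<lambda>p q. snd p \<noteq> {} \<or> snd q \<noteq> {}) ps"
      using less.hyps[OF smaller _ _ fam'] fin by blast
    have prec: "precedes A (X1, Z1) q" if q: "q \<in> set ps" for q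
    proof -
      have "fst q \<subseteq> X - X1" "snd q \<subseteq> Z - Z1" using ps(1,2) q by blast+
      then show ?thesis using low high unfolding precedes_def by auto
    qed
    \<comment> \<open>If neither of the first two segments has chords, all chords come after the
      second one, so its elements are common to all \<open>A z\<close> and would already belong to
      \<open>X1\<close>.\<close>
    have succ: "Z1 \<noteq> {} \<or> snd (hd ps) \<noteq> {}" if "ps \<noteq> []"
    proof (rule ccontr)
      assume "\<not> (Z1 \<noteq> {} \<or> snd (hd ps) \<noteq> {})"
      then have e: "Z1 = {}" "snd (hd ps) = {}" by auto
      obtain q qs where q: "ps = q # qs" using \<open>ps \<noteq> []\<close> by (cases ps) auto
      have "segment A (fst q) {}" using ps(4) q e by auto
      then have "fst q \<noteq> {}" by (auto simp: segment_def spike_segment_def)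
      then obtain y where y: "y \<in> fst q" by blast
      have "y \<in> A z" if "z \<in> Z" for z
      proof -
        have "z \<in> (\<Union>p \<in> set ps. snd p)" using ps(2) e that by simp
        then obtain p where "p \<in> set qs" "z \<in> snd p" using q e by auto
        then have "fst q \<subseteq> A z" using ps(3) q by (simp add: precedes_def)
        then show ?thesis using y by blast
      qed
      moreover have "y \<in> X - X1" using y q ps(1) by auto
      ultimately show False using K[OF e(1)] by blast
    qed
    show ?case
    proof (intro exI[of _ "(X1, Z1) # ps"] conjI)
      show "(\<Union>p \<in> set ((X1, Z1) # ps). fst p) = X" using ps(1) X1 by auto
      show "(\<Union>p \<in> set ((X1, Z1) # ps). snd p) = Z" using ps(2) Z1 by auto
    qed (use ps prec seg succ in \<open>auto simp: successively_Cons\<close>)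
  qed
  consider "?K \<noteq> {}" | "?K = {}" "\<exists>z \<in> Z. A z \<inter> X = {}" | "?K = {}" "\<forall>z \<in> Z. A z \<inter> X \<noteq> {}"
    by blast
  then show ?case
  proof cases
    case 1
    show ?thesis
      by (rule step[of ?K "{}"]) (use 1 in \<open>auto simp: segment_def\<close>)
  next
    case 2
    then obtain z where "z \<in> Z" "A z \<inter> X = {}" by blast
    then show ?thesis
      by (intro step[of "{}" "{z}"]) (auto simp: segment_def)
  next
    case 3
    show ?thesis
    proof (cases "Z = {}")
      case True
      then have "X = {}" using 3(1) by simp
      then show ?thesis using True by (intro exI[of _ "[]"]) simp
    next
      case False
      define k where "k = Min ((\<lambda>z. card (A z \<inter> X)) ` Z)"
      define Z1 where "Z1 = {z \<in> Z. card (A z \<inter> X) = k}"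
      have kle: "k \<le> card (A z \<inter> X)" if "z \<in> Z" for z
        using that fin(2) by (simp add: k_def)
      have "k \<in> (\<lambda>z. card (A z \<inter> X)) ` Z" unfolding k_def using False fin(2) by (intro Min_in) auto
      then obtain z0 where z0: "z0 \<in> Z1" by (auto simp: Z1_def)
      have Z1Z: "Z1 \<subseteq> Z" by (auto simp: Z1_def)
      \<comment> \<open>An exchange preserves cardinality, so sets of different sizes must be
        nested.\<close>
      have above: "A z \<inter> X \<subseteq> A w" if "z \<in> Z1" "w \<in> Z - Z1" for z w
      proof -
        have zw: "z \<in> Z" "w \<in> Z" "z \<noteq> w" using that Z1Z by auto
        have less: "card (A z \<inter> X) < card (A w \<inter> X)"
          using that kle[of w] by (auto simp: Z1_def)
        have "card (A w \<inter> X - A z \<inter> X) \<noteq> card (A z \<inter> X - A w \<inter> X)"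
          using less fin(1) card_less_sym_Diff[of "A z \<inter> X" "A w \<inter> X"] by simp
        moreover have "\<not> A w \<inter> X \<subseteq> A z \<inter> X"
          using less fin(1) card_mono[of "A z \<inter> X" "A w \<inter> X"] by auto
        moreover have "compatible (A z \<inter> X) (A w \<inter> X)" using fam zw by (simp add: chord_family_def)
        ultimately show ?thesis unfolding compatible_def by auto
      qed
      have none: "\<forall>y \<in> X. \<exists>z \<in> Z1. y \<notin> A z"
      proof
        fix y assume y: "y \<in> X"
        then obtain w where w: "w \<in> Z" "y \<notin> A w" using 3(1) by blast
        show "\<exists>z \<in> Z1. y \<notin> A z"
        proof (cases "w \<in> Z1")
          case False
          then show ?thesis using above[OF z0, of w] w y z0 by blast
        qed (use w in blast)
      qed
      \<comment> \<open>With a single set at the lowest level, \<open>none\<close> would make that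
        set empty, which is excluded in this case.\<close>
      have two: "2 \<le> card Z1"
      proof (rule ccontr)
        assume "\<not> 2 \<le> card Z1"
        moreover have finZ1: "finite Z1" using fin(2) Z1Z finite_subset by blast
        moreover have "card Z1 \<noteq> 0" using z0 finZ1 by auto
        ultimately have "card Z1 = 1" by linarith
        then have "Z1 = {z0}" using z0 by (metis card_1_singletonE singletonD)
        then show False using none 3(2) z0 Z1Z by blast
      qed
      have "spike_segment A (\<Union>z \<in> Z1. A z \<inter> X) Z1"
      proof (rule level_spike_segment[OF fin(1) two _ _ none])
        show "chord_family A X Z1" using fam Z1Z unfolding chord_family_def by blast
        show "\<forall>z \<in> Z1. card (A z \<inter> X) = k" by (simp add: Z1_def)
      qed
      then show ?thesis
        by (intro step[of "\<Union>z \<in> Z1. A z \<inter> X" Z1])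
          (use above Z1Z z0 in \<open>auto simp: segment_def\<close>)
    qed
  qed
qed

section \<open>A circuit with chords from spanning circuits\<close>

lemma cycle_space_rows:
  assumes "finite E"
  shows "cycle_space E {S. S \<subseteq> E \<and> (\<forall>i \<in> I. even (card (S \<inter> D i)))}"
proof -
  let ?R = "{S. S \<subseteq> E \<and> (\<forall>i \<in> I. even (card (S \<inter> D i)))}"
  have "sym_diff S T \<in> ?R"
    if S: "S \<in> ?R"
      and T: "T \<in> ?R" for S T
  proof -
    have fin: "finite S" "finite T" using S T assms finite_subset by auto
    show ?thesis unfolding mem_Collect_eq even_card_sym_diff[OF fin] using S T by auto
  qed
  then show ?thesis unfolding cycle_space_def using assms by auto
qed

lemma binary_matroid_cycle_space:
  assumes "finite (ground M)" "binary_matroid M"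
  shows "\<exists>Cy. cycle_space (ground M) Cy \<and> M = cycle_matroid (ground M) Cy"
proof -
  obtain m and B :: "nat \<Rightarrow> 'a \<Rightarrow> bit" where MB: "M = vector_matroid m B (ground M)"
    using assms(2) by (auto simp: binary_matroid_def)
  show ?thesis
    by (intro exI conjI, rule cycle_space_rows[OF assms(1), of "{1..m}" "\<lambda>i. {x. B i x = 1}"])
      (rule trans[OF MB vector_matroid_bit[OF assms(1)]])
qed

text \<open>Membership is checked by elimination: adding the fundamental cycles \<open>F z\<close>,
  which lie in both spaces, clears the elements of \<open>Z\<close> one at a time.\<close>

lemma cycle_space_subset:
  assumes cs: "cycle_space E Cy" "cycle_space E Cy'" and fin: "finite Z"
    and F: "\<forall>z \<in> Z. F z \<in> Cy \<and> F z \<in> Cy' \<and> F z \<inter> Z = {z}"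
    and base: "\<forall>S \<in> Cy. S \<inter> Z = {} \<longrightarrow> S \<in> Cy'"
  shows "Cy \<subseteq> Cy'"
proof
  fix S assume "S \<in> Cy"
  then show "S \<in> Cy'"
  proof (induction "card (S \<inter> Z)" arbitrary: S)
    case 0
    then show ?case using base fin by simp
  next
    case (Suc k)
    then have "S \<inter> Z \<noteq> {}" by auto
    then obtain z where z: "z \<in> S" "z \<in> Z" by blast
    have S': "sym_diff S (F z) \<in> Cy" using cycle_space_sym_diff[OF cs(1) Suc.prems] F z by blast
    have "F z \<inter> Z = {z}" using F z by simp
    then have "sym_diff S (F z) \<inter> Z = S \<inter> Z - {z}" using z by auto
    then have "k = card (sym_diff S (F z) \<inter> Z)" using Suc.hyps(2) z fin by simp
    then have "sym_diff S (F z) \<in> Cy'" using Suc.hyps(1) S' by blast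
    then have "sym_diff (sym_diff S (F z)) (F z) \<in> Cy'"
      using cycle_space_sym_diff[OF cs(2)] F z by blast
    moreover have "sym_diff (sym_diff S (F z)) (F z) = S" by blast
    ultimately show ?case by simp
  qed
qed

lemma matroid_rank_circuit:
  assumes M: "matroid M" and C: "circuit M C" "C \<noteq> {}"
  shows "matroid_rank M C + 1 = card C"
proof -
  have m: "finite (ground M)" "indeps M \<subseteq> Pow (ground M)" "{} \<in> indeps M"
    using M unfolding matroid_def by blast+
  have fin: "finite C" using C m finite_subset by (auto simp: circuit_def)
  obtain c where c: "c \<in> C" using C by blast
  have "C - {c} \<in> indeps M" by (rule circuit_proper_subset_indep[OF C(1)]) (use c in blast)
  then have "card (C - {c}) \<le> matroid_rank M C"
    by (intro card_le_matroid_rank[OF m(1,2)]) auto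
  moreover have "matroid_rank M C \<le> card C - 1"
  proof (rule matroid_rank_le[OF m])
    fix I assume "I \<in> indeps M" "I \<subseteq> C"
    then have "I \<subset> C" using C(1) unfolding circuit_def by blast
    then have "card I < card C" by (rule psubset_card_mono[OF fin])
    then show "card I \<le> card C - 1" by simp
  qed
  moreover have "card (C - {c}) = card C - 1" using c by simp
  moreover have "0 < card C" using C fin by (simp add: card_gt_0_iff)
  ultimately show ?thesis by linarith
qed

text \<open>Connectedness provides a circuit \<open>C\<close> through \<open>e\<close> and
  \<open>f\<close>. All circuits through both elements are spanning and hence have one element more
  than the rank; this equality of sizes is what the proof exploits. \<open>X\<close> is the rest of
  \<open>C\<close>, and \<open>Z\<close> is everything outside it.\<close>

lemma chorded_of_spanning_circuits:
  assumes M: "matroid M" and simple: "simple_matroid M" and conn: "connected_matroid M"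
    and bin: "binary_matroid M" and ef: "e \<in> ground M" "f \<in> ground M" "e \<noteq> f"
    and span: "\<forall>C. circuit M C \<and> {e, f} \<subseteq> C \<longrightarrow> spanning M C"
  shows "\<exists>A X Z. chord_data e f X Z \<and> M = chorded A e f X Z \<and> chord_family A X Z \<and>
    (\<forall>z \<in> Z. A z \<inter> X \<noteq> {} \<and> \<not> X \<subseteq> A z)"
proof -
  let ?E = "ground M"
  have m: "finite ?E" "indeps M \<subseteq> Pow ?E" "{} \<in> indeps M"
    using M unfolding matroid_def by blast+
  obtain Cy where cs: "cycle_space ?E Cy" and MCy: "M = cycle_matroid ?E Cy"
    using binary_matroid_cycle_space[OF m(1) bin] by blast
  have CyE: "Cy \<subseteq> Pow ?E" using cs by (simp add: cycle_space_def)
  have circ: "circuit M C \<longleftrightarrow> C \<in> Cy \<and> C \<noteq> {} \<and> (\<forall>S \<in> Cy. S \<subseteq> C \<longrightarrow> S = {} \<or> S = C)" for C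
    by (subst MCy) (rule circuit_cycle_matroid[OF CyE])
  have small: "3 \<le> card C" if "circuit M C" for C
  proof -
    have "\<not> card C \<le> 2" using simple that unfolding simple_matroid_def by blast
    then show ?thesis by simp
  qed
  have size: "card C = matroid_rank M ?E + 1" if "circuit M C" "e \<in> C" "f \<in> C" for C
  proof -
    have "spanning M C" "C \<noteq> {}" using span that by blast+
    then show ?thesis using matroid_rank_circuit[OF M that(1)] by (simp add: spanning_def)
  qed
  obtain C where C: "circuit M C" "e \<in> C" "f \<in> C"
    using conn ef unfolding connected_matroid_def by blast
  have CE: "C \<subseteq> ?E" using C by (simp add: circuit_def)
  have finC: "finite C" using CE m finite_subset by blast
  define X where "X = C - {e, f}"
  define Z where "Z = ?E - C"
  have Ceq: "C = {e, f} \<union> X" using C by (auto simp: X_def)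
  have Eeq: "?E = {e, f} \<union> X \<union> Z" using CE Ceq by (auto simp: Z_def)
  have cd: "chord_data e f X Z"
    using m(1) finC ef C CE by (auto simp: chord_data_def X_def Z_def)
  have Csub: "S = {} \<or> S = C" if "S \<in> Cy" "S \<subseteq> C" for S using C(1) that circ by blast
  have ex: "\<exists>a. a \<subseteq> X \<and> {z, e} \<union> a \<in> Cy" if z: "z \<in> Z" for z
  proof -
    have zC: "z \<notin> C" "z \<in> ?E" using z by (auto simp: Z_def)
    \<comment> \<open>This set has as many elements as the rank, so adding \<open>z\<close> creates
      a cycle \<open>D\<close>, and \<open>D\<close> must contain \<open>z\<close>.\<close>
    have B: "C - {f} \<in> indeps M" by (rule circuit_proper_subset_indep[OF C(1)]) (use C in blast)
    have "card (insert z (C - {f})) = matroid_rank M ?E + 1"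
      using zC finC size[OF C] C(3) by (simp add: card_Suc_Diff1)
    then have "insert z (C - {f}) \<notin> indeps M"
      using card_le_matroid_rank[OF m(1,2), of "insert z (C - {f})" ?E] CE zC by auto
    then obtain D where D: "D \<in> Cy" "D \<subseteq> insert z (C - {f})" "D \<noteq> {}"
      using CE zC by (subst (asm) MCy) (auto simp: indeps_cycle_matroid)
    have zD: "z \<in> D"
    proof (rule ccontr)
      assume "z \<notin> D"
      then have "D \<subseteq> C - {f}" using D by blast
      then show False using B D by (subst (asm) MCy) (auto simp: indeps_cycle_matroid)
    qed
    have D3: "3 \<le> card D"
    proof -
      obtain T where T: "circuit M T" "T \<subseteq> D"
        using cycle_contains_circuit_through[OF cs D(1) zD] MCy by auto
      have "finite D" using D finC finite_subset[of D "insert z (C - {f})"] by simp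
      then show ?thesis using small[OF T(1)] card_mono[OF _ T(2)] by simp
    qed
    \<comment> \<open>If \<open>e\<close> were missing, adding \<open>D\<close> to \<open>C\<close>
      would give the circuit \<open>insert z (C - D)\<close> through \<open>e\<close> and
      \<open>f\<close>. Having the size of \<open>C\<close>, it would force \<open>D\<close> to have
      two elements, against simplicity.\<close>
    have "e \<in> D"
    proof (rule ccontr)
      assume eD: "e \<notin> D"
      let ?D = "insert z (C - D)"
      have eq: "sym_diff C D = ?D" using D zD zC by blast
      have "?D \<in> Cy" using cycle_space_sym_diff[OF cs _ D(1), of C] C(1) circ unfolding eq by blast
      have sub: "S = {}" if "S \<in> Cy" "S \<subseteq> C - D" for S
      proof -
        have "D \<inter> C \<noteq> {}"
        proof
          assume "D \<inter> C = {}"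
          then have "D \<subseteq> {z}" using D by blast
          then show False using D3 card_mono[of "{z}" D] by simp
        qed
        then have "S \<noteq> C" using that by blast
        then show ?thesis using Csub that by blast
      qed
      have "circuit M ?D"
        by (subst MCy, rule cycle_circuitI[OF cs \<open>?D \<in> Cy\<close>, where z = z]) (use sub in auto)
      then have "card ?D = card C" using size C eD D zC by auto
      moreover have "card ?D = card (C - D) + 1" using finC zC by simp
      moreover have "card C = card (C - D) + card (D - {z})"
      proof -
        have "C = (C - D) \<union> (D - {z})" using D zC by blast
        moreover have "finite D" using D finC finite_subset[of D "insert z (C - {f})"] by simp
        ultimately show ?thesis using finC by (metis card_Un_disjoint Diff_disjoint Int_commute finite_Diff inf_le1 Diff_Int_distrib2 disjoint_iff DiffE)
      qed
      ultimately have "card (D - {z}) = 1" by simp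
      then show False using D3 zD by (simp add: card_Diff_singleton)
    qed
    then have "{z, e} \<union> (D - {z, e}) = D" using zD by blast
    moreover have "D - {z, e} \<subseteq> X" using D zC by (auto simp: X_def)
    ultimately show ?thesis using D(1) by metis
  qed
  then obtain A where A: "\<forall>z \<in> Z. A z \<subseteq> X \<and> {z, e} \<union> A z \<in> Cy" by metis
  have cs': "cycle_space ?E (chord_cycles A e f X Z)"
    using cycle_space_chord_cycles[OF cd, of A] unfolding Eeq .
  have AX: "A z \<inter> X = A z" if "z \<in> Z" for z using A that by blast
  have F: "{z, e} \<union> A z \<in> Cy" "{z, e} \<union> A z \<in> chord_cycles A e f X Z" "({z, e} \<union> A z) \<inter> Z = {z}"
    if z: "z \<in> Z" for z
  proof -
    show "{z, e} \<union> A z \<in> Cy" using A z by blast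
    show "{z, e} \<union> A z \<in> chord_cycles A e f X Z" using chord_cycle_e[OF cd z, of A] AX[OF z] by simp
    show "({z, e} \<union> A z) \<inter> Z = {z}" using A z cd by (auto simp: chord_data_def)
  qed
  have finZ: "finite Z" using cd by (simp add: chord_data_def)
  \<comment> \<open>Both spaces contain the cycles \<open>{z, e} \<union> A z\<close>, and in both
    the only cycles without chords are the empty set and \<open>C\<close>; elimination of chords
    then gives the two inclusions.\<close>
  have "Cy \<subseteq> chord_cycles A e f X Z"
  proof (rule cycle_space_subset[OF cs cs' finZ, where F = "\<lambda>z. {z, e} \<union> A z"])
    show "\<forall>S \<in> Cy. S \<inter> Z = {} \<longrightarrow> S \<in> chord_cycles A e f X Z"
    proof (intro ballI impI)
      fix S assume S: "S \<in> Cy" "S \<inter> Z = {}"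
      then have "S \<subseteq> C" using CyE by (auto simp: Z_def)
      then have "S = {} \<or> S = C" using Csub S by blast
      then show "S \<in> chord_cycles A e f X Z"
        using whole_circuit_cycle[OF cd, of A] cs' unfolding Ceq[symmetric] cycle_space_def by blast
    qed
  qed (use F in blast)
  moreover have "chord_cycles A e f X Z \<subseteq> Cy"
  proof (rule cycle_space_subset[OF cs' cs finZ, where F = "\<lambda>z. {z, e} \<union> A z"])
    show "\<forall>S \<in> chord_cycles A e f X Z. S \<inter> Z = {} \<longrightarrow> S \<in> Cy"
    proof (intro ballI impI)
      fix S assume S: "S \<in> chord_cycles A e f X Z" "S \<inter> Z = {}"
      then have "S = {} \<or> S = C" unfolding Ceq by (rule chord_cycle_without_chords)
      moreover have "C \<in> Cy" "{} \<in> Cy" using C(1) circ cs by (simp_all add: cycle_space_def)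
      ultimately show "S \<in> Cy" by auto
    qed
  qed (use F in blast)
  ultimately have "Cy = chord_cycles A e f X Z" by blast
  then have Meq: "M = chorded A e f X Z" using MCy Eeq unfolding chorded_def by metis
  have cardC: "card C = card X + 2" using Ceq cd by (simp add: chord_data_def)
  have proper: "A z \<inter> X \<noteq> {} \<and> \<not> X \<subseteq> A z" if z: "z \<in> Z" for z
  proof -
    have "3 \<le> card ({z, e} \<union> (A z \<inter> X))" using small circuit_chord_e[OF cd z, of A] Meq by simp
    then have "A z \<inter> X \<noteq> {}" using card_insert_le_m1[of 2 "{e}" z] by auto
    moreover have f3: "3 \<le> card ({z, f} \<union> (X - A z))" using small circuit_chord_f[OF cd z, of A] Meq by simp
    have "X - A z \<noteq> {}"
    proof
      assume "X - A z = {}"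
      then show False using f3 card_insert_le_m1[of 2 "{f}" z] by (simp only: Un_empty_right) simp
    qed
    ultimately show ?thesis by blast
  qed
  have "chord_family A X Z"
    unfolding chord_family_def
  proof (intro ballI impI)
    fix z w assume zw: "z \<in> Z" "w \<in> Z" "z \<noteq> w"
    let ?S = "sym_diff (A z) (A w) \<inter> X"
    have two: "circuit M ({z, w} \<union> ?S)" using circuit_two_chords[OF cd zw, of A] Meq by simp
    then have S: "?S \<noteq> {}" using small[OF two] zw by auto
    have "card (A z \<inter> X - A w \<inter> X) = 1 \<and> card (A w \<inter> X - A z \<inter> X) = 1"
      if inc: "\<not> A z \<inter> X \<subseteq> A w \<inter> X" "\<not> A w \<inter> X \<subseteq> A z \<inter> X"
    proof -
      \<comment> \<open>\<open>?D\<close> is the sum of the whole circuit and the circuit of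
        \<open>z\<close> and \<open>w\<close>. It turns out to be a circuit through \<open>e\<close>
        and \<open>f\<close>, so it has the size of \<open>C\<close>, which leaves exactly two
        elements for \<open>?S\<close>.\<close>
      let ?D = "{z, w, e, f} \<union> (X - ?S)"
      have zwX: "z \<notin> {e, f} \<union> X" "w \<notin> {e, f} \<union> X" using zw cd by (auto simp: chord_data_def)
      have "sym_diff ({e, f} \<union> X) ({z, w} \<union> ?S) \<in> chord_cycles A e f X Z"
        by (rule cycle_space_sym_diff[OF cs' whole_circuit_cycle[OF cd] chord_cycle_two[OF cd zw]])
      moreover have "sym_diff ({e, f} \<union> X) ({z, w} \<union> ?S) = ?D"
        using zw cd by (auto simp: chord_data_def)
      ultimately have D: "?D \<in> chord_cycles A e f X Z" by simp
      have "circuit (chorded A e f X Z) ?D"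
      proof (rule chorded_circuitI[OF cd D, where z = z])
        fix T assume T: "T \<in> chord_cycles A e f X Z" "T \<subseteq> ?D" "z \<notin> T"
        have "T \<inter> Z \<subseteq> {w}" using T cd by (auto simp: chord_data_def)
        \<comment> \<open>A nonempty subcycle without chords would be the whole circuit and contain
          \<open>?S\<close>. One with the chord \<open>w\<close> alone contains
          \<open>A w \<inter> X\<close> or \<open>X - A w\<close>; as it avoids \<open>?S\<close>,
          the sets of \<open>z\<close> and \<open>w\<close> would be comparable.\<close>
        then consider "T \<inter> Z = {}" | "T \<inter> Z = {w}" by blast
        then show "T = {}"
        proof cases
          case 1
          moreover have "T \<noteq> {e, f} \<union> X" using S T zwX cd by (auto simp: chord_data_def)
          ultimately show ?thesis using chord_cycle_without_chords[OF T(1)] by blast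
        next
          case 2
          then have "T = {w, e} \<union> (A w \<inter> X) \<or> T = {w, f} \<union> (X - A w)"
            by (rule chord_cycle_one[OF cd T(1)])
          then have "A w \<inter> X \<subseteq> ?D \<or> X - A w \<subseteq> ?D" using T(2) by blast
          then have "A w \<inter> X \<inter> ?S = {} \<or> (X - A w) \<inter> ?S = {}" using zwX cd by (auto simp: chord_data_def)
          then show ?thesis using inc by blast
        qed
      qed auto
      then have "card ?D = card C" using size[of ?D] size[OF C] Meq by simp
      moreover have "card ?D = 4 + card (X - ?S)"
        using zwX zw cd by (simp add: chord_data_def)
      moreover have "card X = card (X - ?S) + card ?S"
        using cd card_mono[of X ?S] by (simp add: chord_data_def card_Diff_subset)
      moreover have "card ?S = card (A z \<inter> X - A w \<inter> X) + card (A w \<inter> X - A z \<inter> X)"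
      proof -
        have "?S = (A z \<inter> X - A w \<inter> X) \<union> (A w \<inter> X - A z \<inter> X)" by blast
        then show ?thesis
          using cd by (simp only:, intro card_Un_disjoint) (auto simp: chord_data_def)
      qed
      moreover have "card (A z \<inter> X - A w \<inter> X) \<noteq> 0" "card (A w \<inter> X - A z \<inter> X) \<noteq> 0"
        using inc cd by (auto simp: chord_data_def)
      ultimately show ?thesis using cardC by linarith
    qed
    moreover have "A z \<inter> X \<noteq> A w \<inter> X" using S by blast
    ultimately show "compatible (A z \<inter> X) (A w \<inter> X)" unfolding compatible_def by blast
  qed
  then show ?thesis using cd Meq proper by blast
qed

section \<open>Paths of segments\<close>

lemma tcycle_two_edges:
  assumes cyc: "tcycle T Ns xs" and i: "i < length xs" and N: "N \<in> tends T (xs ! i)"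
  shows "\<exists>j < length xs. j \<noteq> i \<and> N \<in> tends T (xs ! j)"
proof -
  let ?L = "length xs"
  have L: "length Ns = ?L" "2 \<le> ?L"
    and te: "\<And>i. i < ?L \<Longrightarrow> tends T (xs ! i) = {Ns ! i, Ns ! (Suc i mod ?L)}"
    using cyc by (auto simp: tcycle_def)
  have "N = Ns ! i \<or> N = Ns ! (Suc i mod ?L)" using N te[OF i] by simp
  then show ?thesis
  proof
    assume N: "N = Ns ! i"
    show ?thesis
    proof (cases i)
      case 0
      have "Suc (?L - 1) = ?L" using L by linarith
      then have "Suc (?L - 1) mod ?L = 0" by (simp only: mod_self)
      then have "N \<in> tends T (xs ! (?L - 1))" using te[of "?L - 1"] N 0 L by simp
      then show ?thesis using 0 L by (intro exI[of _ "?L - 1"]) auto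
    next
      case (Suc k)
      then have "N \<in> tends T (xs ! k)" using te[of k] N i by simp
      then show ?thesis using Suc i by (intro exI[of _ k]) auto
    qed
  next
    assume N: "N = Ns ! (Suc i mod ?L)"
    let ?j = "Suc i mod ?L"
    have j: "?j < ?L" using L by (intro mod_less_divisor) linarith
    have "?j \<noteq> i"
    proof (cases "Suc i = ?L")
      case True
      then show ?thesis using L by auto
    next
      case False
      then show ?thesis using i by simp
    qed
    moreover have "N \<in> tends T (xs ! ?j)" using te[OF j] N by simp
    ultimately show ?thesis using j by blast
  qed
qed

text \<open>Acyclicity comes from the edge of largest index \<open>k\<close> in a supposed cycle:
  its end \<open>P (Suc k)\<close> would need a second cycle edge, but the only other edge there has
  index \<open>Suc k\<close>.\<close>

lemma is_tree_path:
  assumes "is_path T n P"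
  shows "is_tree T"
proof -
  obtain b where inj: "inj_on P {0..n}" and V: "tverts T = P ` {0..n}" and E: "tedges T = b ` {0..<n}"
    and te: "\<And>i. i < n \<Longrightarrow> tends T (b i) = {P i, P (Suc i)}"
    using assms by (auto simp: is_path_def)
  have neq: "P i = P j \<longleftrightarrow> i = j" if "i \<le> n" "j \<le> n" for i j
    using inj that by (auto simp: inj_on_def)
  have adj: "(P i, P (Suc i)) \<in> tadjacent T" "(P (Suc i), P i) \<in> tadjacent T" if "i < n" for i
    using te[OF that] that E by (auto simp: tadjacent_def insert_commute)
  have from0: "(P 0, P i) \<in> (tadjacent T)\<^sup>*" "(P i, P 0) \<in> (tadjacent T)\<^sup>*" if "i \<le> n" for i
    using that
  proof (induction i)
    case (Suc i)
    { case 1 then show ?case using Suc adj(1)[of i] by (auto intro: rtrancl_into_rtrancl) }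
    { case 2 then show ?case using Suc adj(2)[of i] by (auto intro: converse_rtrancl_into_rtrancl) }
  qed auto
  have nocycle: "\<not> tcycle T Ns xs" for Ns xs
  proof
    assume cyc: "tcycle T Ns xs"
    define K where "K = {k. k < n \<and> b k \<in> set xs}"
    have xs: "distinct xs" "2 \<le> length xs" "set xs \<subseteq> b ` {0..<n}" using cyc E by (auto simp: tcycle_def)
    have "xs ! 0 \<in> set xs" using xs(2) by (intro nth_mem) linarith
    moreover obtain l where "l < n" "xs ! 0 = b l" using calculation xs(3) by fastforce
    ultimately have "K \<noteq> {}" by (auto simp: K_def)
    moreover have finK: "finite K" by (simp add: K_def)
    ultimately have k: "Max K \<in> K" by (rule Max_in[rotated])
    define k where "k = Max K"
    have kn: "k < n" "b k \<in> set xs" using k by (auto simp: K_def k_def)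
    then obtain i where i: "i < length xs" "xs ! i = b k" by (auto simp: in_set_conv_nth)
    then have "P (Suc k) \<in> tends T (xs ! i)" using te kn by simp
    then obtain j where j: "j < length xs" "j \<noteq> i" "P (Suc k) \<in> tends T (xs ! j)"
      using tcycle_two_edges[OF cyc i(1)] by blast
    have "xs ! j \<in> set xs" using j by simp
    then obtain l where l: "l < n" "xs ! j = b l" using xs(3) by fastforce
    then have "l \<in> K" using \<open>xs ! j \<in> set xs\<close> by (simp add: K_def)
    then have "l \<le> k" using finK by (simp add: k_def)
    moreover have "l = Suc k \<or> l = k" using j(3) l te[OF l(1)] neq kn by auto
    ultimately have "xs ! j = xs ! i" using l i by simp
    then show False using xs(1) i j nth_eq_iff_index_eq by metis
  qed
  show ?thesis
    unfolding is_tree_def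
  proof (intro conjI ballI)
    show "finite (tverts T)" "tverts T \<noteq> {}" "finite (tedges T)" using V E by auto
    show "tends T x \<subseteq> tverts T" "card (tends T x) = 2" if x: "x \<in> tedges T" for x
    proof -
      obtain i where i: "i < n" "x = b i" using x E by auto
      have "P i \<noteq> P (Suc i)" using neq i by simp
      then show "card (tends T x) = 2" using te i by simp
      show "tends T x \<subseteq> tverts T" using te i V by auto
    qed
    show "(N1, N2) \<in> (tadjacent T)\<^sup>*" if N: "N1 \<in> tverts T" "N2 \<in> tverts T" for N1 N2
    proof -
      obtain i j where "i \<le> n" "j \<le> n" "N1 = P i" "N2 = P j" using N V by auto
      then show ?thesis using from0(2)[of i] from0(1)[of j] by (auto intro: rtrancl_trans)
    qed
  qed (use nocycle in auto)
qed

section \<open>The canonical decomposition built from a chain of segments\<close>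

locale segment_path =
  fixes A :: "'a \<Rightarrow> 'a set" and n :: nat and X Z :: "nat \<Rightarrow> 'a set" and q :: "nat \<Rightarrow> 'a"
  assumes finite_seg: "i \<le> n \<Longrightarrow> finite (X i) \<and> finite (Z i)"
    and seg: "i \<le> n \<Longrightarrow> segment A (X i) (Z i)"
    and prec: "i < j \<Longrightarrow> j \<le> n \<Longrightarrow> precedes A (X i, Z i) (X j, Z j)"
    and inj_q: "inj_on q {..Suc n}"
    and fresh: "i \<le> Suc n \<Longrightarrow> j \<le> n \<Longrightarrow> q i \<notin> X j \<union> Z j"
    and XZ: "i \<le> n \<Longrightarrow> j \<le> n \<Longrightarrow> X i \<inter> Z j = {}"
    and alternating: "i < n \<Longrightarrow> (Z i \<noteq> {} \<or> Z (Suc i) \<noteq> {}) \<and> (X i \<noteq> {} \<or> X (Suc i) \<noteq> {})"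
begin

text \<open>\<open>q 0\<close> and \<open>q (Suc n)\<close> stand for the two given elements, and
  each \<open>q i\<close> in between is the basepoint shared by \<open>P (i - 1)\<close> and
  \<open>P i\<close>: the second end of one segment is the first end of the next.\<close>

definition P :: "nat \<Rightarrow> 'a matroid" where
  "P i = chorded A (q i) (q (Suc i)) (X i) (Z i)"

text \<open>This is the 2-sum of \<open>P 0\<close> to \<open>P k\<close>, written as one matroid
  with chords; \<open>Q n\<close> is the matroid being decomposed.\<close>

definition Q :: "nat \<Rightarrow> 'a matroid" where
  "Q k = chorded A (q 0) (q (Suc k)) (\<Union>i\<le>k. X i) (\<Union>i\<le>k. Z i)"

definition T :: "'a matroid_graph" where
  "T = \<lparr>tverts = P ` {0..n}, tedges = q ` {1..n},
        tends = (\<lambda>x. let i = the_inv_into {..Suc n} q x in {P (i - 1), P i})\<rparr>"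

lemma q_eq: "i \<le> Suc n \<Longrightarrow> j \<le> Suc n \<Longrightarrow> q i = q j \<longleftrightarrow> i = j"
  using inj_q by (auto simp: inj_on_def)

lemma disjoint_seg:
  assumes "i \<le> n" "j \<le> n" "i \<noteq> j"
  shows "X i \<inter> X j = {}" "Z i \<inter> Z j = {}"
proof -
  consider "i < j" | "j < i" using assms by linarith
  then have "X i \<inter> X j = {} \<and> Z i \<inter> Z j = {}"
    using assms prec[of i j] prec[of j i] by cases (auto simp: precedes_def)
  then show "X i \<inter> X j = {}" "Z i \<inter> Z j = {}" by auto
qed

lemma chord_data_P: "i \<le> n \<Longrightarrow> chord_data (q i) (q (Suc i)) (X i) (Z i)"
  using finite_seg[of i] fresh[of i i] fresh[of "Suc i" i] XZ[of i i] q_eq[of i "Suc i"]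
  by (simp add: chord_data_def)

lemma chord_data_Q:
  assumes "k \<le> n"
  shows "chord_data (q 0) (q (Suc k)) (\<Union>i\<le>k. X i) (\<Union>i\<le>k. Z i)"
proof -
  have "q j \<notin> X i" "q j \<notin> Z i" if "i \<le> k" "j \<le> Suc n" for i j
    using fresh[of j i] that assms by auto
  moreover have "X i \<inter> Z j = {}" if "i \<le> k" "j \<le> k" for i j using XZ[of i j] that assms by simp
  ultimately show ?thesis
    using finite_seg assms q_eq[of 0 "Suc k"] unfolding chord_data_def
    by (auto simp: disjoint_iff)
qed

lemma ground_P: "ground (P i) = {q i, q (Suc i)} \<union> X i \<union> Z i"
  by (simp add: P_def)

lemma q_in_ground_P:
  assumes "j \<le> Suc n" "i \<le> n"
  shows "q j \<in> ground (P i) \<longleftrightarrow> j = i \<or> j = Suc i"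
  using fresh[OF assms] q_eq[of j i] q_eq[of j "Suc i"] assms by (simp add: ground_P)

lemma ground_P_Int:
  assumes "i < j" "j \<le> n"
  shows "ground (P i) \<inter> ground (P j) = (if j = Suc i then {q j} else {})"
proof -
  have "X i \<inter> X j = {}" "Z i \<inter> Z j = {}" using disjoint_seg[of i j] assms by auto
  moreover have "X i \<inter> Z j = {}" "X j \<inter> Z i = {}" using XZ[of i j] XZ[of j i] assms by auto
  moreover have "q k \<notin> X l \<union> Z l" if "k \<in> {i, Suc i, j, Suc j}" "l \<in> {i, j}" for k l
    using fresh[of k l] that assms by auto
  moreover have "q i \<noteq> q j" "q i \<noteq> q (Suc j)" "q (Suc i) \<noteq> q (Suc j)" "q (Suc i) = q j \<longleftrightarrow> j = Suc i"
    using q_eq[of i j] q_eq[of i "Suc j"] q_eq[of "Suc i" "Suc j"] q_eq[of "Suc i" j] assms by auto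
  ultimately show ?thesis by (auto simp: ground_P)
qed

lemma P_eq: "i \<le> n \<Longrightarrow> j \<le> n \<Longrightarrow> P i = P j \<longleftrightarrow> i = j"
proof -
  have "P i \<noteq> P j" if "i < j" "j \<le> n" for i j
    using q_in_ground_P[of i i] q_in_ground_P[of i j] that by auto
  then show "i \<le> n \<Longrightarrow> j \<le> n \<Longrightarrow> P i = P j \<longleftrightarrow> i = j" by (metis nat_neq_iff)
qed

lemma tends_T:
  assumes "i < n"
  shows "tends T (q (Suc i)) = {P i, P (Suc i)}"
proof -
  have "the_inv_into {..Suc n} q (q (Suc i)) = Suc i"
    using assms inj_q by (intro the_inv_into_f_f) auto
  then show ?thesis by (simp add: T_def)
qed

lemma tedges_T: "tedges T = (\<lambda>i. q (Suc i)) ` {0..<n}"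
proof -
  have "{1..n} = Suc ` {0..<n}" by (simp add: image_Suc_atLeastLessThan atLeastLessThanSuc_atLeastAtMost)
  then show ?thesis unfolding T_def by (simp only: matroid_graph.simps image_image)
qed

lemma is_path_T: "is_path T n P"
proof -
  note tedges_T
  moreover have "inj_on P {0..n}" using P_eq by (auto simp: inj_on_def)
  moreover have "tverts T = P ` {0..n}" by (simp add: T_def)
  ultimately show ?thesis unfolding is_path_def using tends_T by blast
qed

lemma tadjacent_T:
  assumes "i < j" "j \<le> n"
  shows "(P i, P j) \<in> tadjacent T \<longleftrightarrow> j = Suc i"
proof
  assume "(P i, P j) \<in> tadjacent T"
  then obtain x where x: "x \<in> tedges T" "tends T x = {P i, P j}"
    by (auto simp: tadjacent_def)
  then obtain k where k: "k < n" "x = q (Suc k)" by (auto simp: tedges_T)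
  then have "{P k, P (Suc k)} = {P i, P j}" using tends_T x by simp
  then have "(k = i \<and> Suc k = j) \<or> (k = j \<and> Suc k = i)"
    using P_eq k assms by (auto simp: doubleton_eq_iff)
  then show "j = Suc i" using assms by auto
next
  assume "j = Suc i"
  then have "tends T (q j) = {P i, P j}" "q j \<in> tedges T"
    using assms tends_T[of i] by (auto simp: T_def)
  then show "(P i, P j) \<in> tadjacent T" unfolding tadjacent_def by blast
qed

lemma tadjacent_sym: "(N1, N2) \<in> tadjacent G \<Longrightarrow> (N2, N1) \<in> tadjacent G"
  by (auto simp: tadjacent_def insert_commute)

lemma two_sum_Q:
  assumes "k < n"
  shows "two_sum (q (Suc k)) (Q k) (P (Suc k)) = Q (Suc k)"
proof -
  have un: "(\<Union>i\<le>Suc k. X i) = (\<Union>i\<le>k. X i) \<union> X (Suc k)" "(\<Union>i\<le>Suc k. Z i) = (\<Union>i\<le>k. Z i) \<union> Z (Suc k)"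
    by (auto simp: atMost_Suc)
  have pr: "X i \<inter> X (Suc k) = {} \<and> Z i \<inter> Z (Suc k) = {} \<and> (\<forall>z \<in> Z i. A z \<inter> X (Suc k) = {}) \<and>
      (\<forall>z \<in> Z (Suc k). X i \<subseteq> A z)" if "i \<le> k" for i
    using prec[of i "Suc k"] that assms by (simp add: precedes_def)
  show ?thesis
    unfolding Q_def P_def un
  proof (rule two_sum_chorded)
    show "chord_data (q 0) (q (Suc (Suc k))) ((\<Union>i\<le>k. X i) \<union> X (Suc k)) ((\<Union>i\<le>k. Z i) \<union> Z (Suc k))"
      using chord_data_Q[of "Suc k"] assms unfolding un by simp
    show "(\<Union>i\<le>k. X i) \<inter> X (Suc k) = {}" "(\<Union>i\<le>k. Z i) \<inter> Z (Suc k) = {}"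
      "\<forall>z \<in> (\<Union>i\<le>k. Z i). A z \<inter> X (Suc k) = {}" "\<forall>z \<in> Z (Suc k). (\<Union>i\<le>k. X i) \<subseteq> A z"
      using pr by blast+
    show "q (Suc k) \<notin> {q 0, q (Suc (Suc k))} \<union> (\<Union>i\<le>k. X i) \<union> X (Suc k) \<union> (\<Union>i\<le>k. Z i) \<union> Z (Suc k)"
      using q_eq[of "Suc k" 0] q_eq[of "Suc k" "Suc (Suc k)"] fresh[of "Suc k"] assms by auto
  qed
qed

text \<open>Vertices of the graph are the labels themselves, so a composite vertex must be told
  apart from the remaining ones; the element \<open>q 0\<close> does this.\<close>

lemma Q_neq_P:
  assumes "k < j" "j \<le> n"
  shows "Q k \<noteq> P j"
proof
  assume eq: "Q k = P j"
  have "q 0 \<in> ground (Q k)" by (simp add: Q_def)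
  then show False using q_in_ground_P[of 0 j] assms unfolding eq by simp
qed

text \<open>The state after contracting the first \<open>k\<close> edges from the left: only the
  leftmost remaining edge has the composite vertex as an end.\<close>

definition partial_contraction :: "nat \<Rightarrow> 'a matroid_graph \<Rightarrow> bool" where
  "partial_contraction k G \<longleftrightarrow>
     tverts G = insert (Q k) (P ` {Suc k..n}) \<and> tedges G = q ` {Suc k..n} \<and>
     (\<forall>i \<in> {Suc k..n}. tends G (q i) = {if i = Suc k then Q k else P (i - 1), P i})"

lemma partial_contraction_T: "partial_contraction 0 T"
proof -
  have "Q 0 = P 0" by (simp add: Q_def P_def)
  moreover have "{0..n} = insert 0 {1..n}" by auto
  moreover have "tends T (q i) = {if i = 1 then P 0 else P (i - 1), P i}" if "i \<in> {1..n}" for i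
    using tends_T[of "i - 1"] that by auto
  ultimately show ?thesis by (simp add: partial_contraction_def T_def)
qed

lemma partial_contraction_step:
  assumes k: "k < n" and G: "partial_contraction k G"
  shows "\<exists>G'. contract_step G G' \<and> partial_contraction (Suc k) G'"
proof -
  let ?G = "contract_edge G (q (Suc k)) (Q k) (P (Suc k))"
  have ends: "tends G (q (Suc k)) = {Q k, P (Suc k)}" "q (Suc k) \<in> tedges G"
    using G k by (auto simp: partial_contraction_def)
  have set: "{Suc k..n} = insert (Suc k) {Suc (Suc k)..n}" using k by auto
  have notin: "Q k \<notin> P ` {Suc (Suc k)..n}" "P (Suc k) \<notin> P ` {Suc (Suc k)..n}"
    using Q_neq_P P_eq k by fastforce+
  have "tverts ?G = insert (Q (Suc k)) (P ` {Suc (Suc k)..n})"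
  proof -
    have "tverts G - {Q k, P (Suc k)} = P ` {Suc (Suc k)..n}"
      using G notin unfolding partial_contraction_def set by auto
    then show ?thesis by (simp add: contract_edge_def two_sum_Q[OF k])
  qed
  moreover have "tedges ?G = q ` {Suc (Suc k)..n}"
  proof -
    have "q (Suc k) \<notin> q ` {Suc (Suc k)..n}" using q_eq k by fastforce
    then show ?thesis using G unfolding partial_contraction_def set by (auto simp: contract_edge_def)
  qed
  moreover have "tends ?G (q i) = {if i = Suc (Suc k) then Q (Suc k) else P (i - 1), P i}"
    if i: "i \<in> {Suc (Suc k)..n}" for i
  proof -
    have "tends G (q i) = {P (i - 1), P i}" using G i by (auto simp: partial_contraction_def)
    moreover have "P i \<in> P ` {Suc (Suc k)..n}" using i by simp
    then have "P i \<notin> {Q k, P (Suc k)}" using notin by auto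
    moreover have "P (i - 1) \<notin> {Q k, P (Suc k)} \<longleftrightarrow> i \<noteq> Suc (Suc k)"
    proof (cases "i = Suc (Suc k)")
      case False
      then have "i - 1 \<in> {Suc (Suc k)..n}" using i by auto
      then have "P (i - 1) \<in> P ` {Suc (Suc k)..n}" by blast
      then show ?thesis using False notin by auto
    qed simp
    ultimately show ?thesis by (auto simp: contract_edge_def two_sum_Q[OF k])
  qed
  ultimately have "partial_contraction (Suc k) ?G" by (simp add: partial_contraction_def)
  moreover have "contract_step G ?G" unfolding contract_step_def using ends by blast
  ultimately show ?thesis by blast
qed

lemma contract_T: "\<exists>G. contract_step\<^sup>*\<^sup>* T G \<and> tverts G = {Q n} \<and> tedges G = {}"
proof -
  have "\<exists>G. contract_step\<^sup>*\<^sup>* T G \<and> partial_contraction k G" if "k \<le> n" for k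
    using that
  proof (induction k)
    case 0
    then show ?case using partial_contraction_T by blast
  next
    case (Suc k)
    then obtain G where "contract_step\<^sup>*\<^sup>* T G" "partial_contraction k G" by auto
    then show ?case
      using partial_contraction_step[of k G] Suc.prems by (meson Suc_le_lessD rtranclp.rtrancl_into_rtrancl)
  qed
  from this[of n] show ?thesis by (auto simp: partial_contraction_def)
qed

lemma card_segment:
  assumes "i \<le> n"
  shows "1 \<le> card (X i) + card (Z i)"
proof -
  have "X i \<noteq> {} \<or> Z i \<noteq> {}" using seg[OF assms] by (auto simp: segment_def spike_segment_def)
  then show ?thesis using finite_seg[OF assms] by (auto simp: Suc_le_eq card_gt_0_iff)
qed

lemma card_ground_Q: "3 \<le> card (ground (Q n))"
proof -
  have "card (X 0) \<le> card (\<Union>i\<le>n. X i)" "card (Z 0) \<le> card (\<Union>i\<le>n. Z i)"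
    using finite_seg by (auto intro!: card_mono)
  then have "1 \<le> card (\<Union>i\<le>n. X i) + card (\<Union>i\<le>n. Z i)" using card_segment[of 0] by simp
  then show ?thesis using card_ground_chorded[OF chord_data_Q[of n], of A] unfolding Q_def by linarith
qed

lemma tree_decomposition_T: "tree_decomposition T (Q n)"
  unfolding tree_decomposition_def
proof (intro conjI ballI allI impI)
  show "is_tree T" by (rule is_tree_path[OF is_path_T])
  show "matroid N" "connected_matroid N" if "N \<in> tverts T" for N
    using that matroid_chorded[OF chord_data_P] connected_chorded[OF chord_data_P]
    by (auto simp: T_def P_def)
  show "ground (Q n) = (\<Union>N \<in> tverts T. ground N) - tedges T"
  proof -
    have "(\<Union>N \<in> tverts T. ground N) = (\<Union>i\<le>n. {q i, q (Suc i)}) \<union> (\<Union>i\<le>n. X i) \<union> (\<Union>i\<le>n. Z i)"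
      by (auto simp: T_def ground_P atLeast0AtMost)
    moreover have "(\<Union>i\<le>n. {q i, q (Suc i)}) = q ` {..Suc n}"
    proof
      show "q ` {..Suc n} \<subseteq> (\<Union>i\<le>n. {q i, q (Suc i)})"
      proof
        fix x assume "x \<in> q ` {..Suc n}"
        then obtain j where "j \<le> Suc n" "x = q j" by auto
        then show "x \<in> (\<Union>i\<le>n. {q i, q (Suc i)})" by (cases "j \<le> n") (auto simp: le_Suc_eq)
      qed
    qed auto
    moreover have "q ` {..Suc n} - q ` {1..n} = {q 0, q (Suc n)}"
    proof -
      have "q ` {..Suc n} - q ` {1..n} = q ` ({..Suc n} - {1..n})"
        by (rule inj_on_image_set_diff[symmetric, OF inj_q]) auto
      also have "{..Suc n} - {1..n} = {0, Suc n}" by auto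
      finally show ?thesis by simp
    qed
    moreover have "((\<Union>i\<le>n. X i) \<union> (\<Union>i\<le>n. Z i)) \<inter> q ` {1..n} = {}"
    proof -
      have "q j \<notin> X i \<union> Z i" if "i \<le> n" "j \<in> {1..n}" for i j using fresh[of j i] that by simp
      then show ?thesis by blast
    qed
    then have "(\<Union>i\<le>n. X i) - q ` {1..n} = (\<Union>i\<le>n. X i)" "(\<Union>i\<le>n. Z i) - q ` {1..n} = (\<Union>i\<le>n. Z i)"
      by (auto simp: disjoint_iff)
    moreover have "tedges T = q ` {1..n}" by (simp add: T_def)
    ultimately show ?thesis unfolding Q_def ground_chorded by (simp only: Un_Diff)
  qed
  show "ground N1 \<inter> ground N2 = {x}" if x: "x \<in> tedges T" "tends T x = {N1, N2}" for x N1 N2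
  proof -
    obtain k where k: "k < n" "x = q (Suc k)" using x by (auto simp: tedges_T)
    then have "{N1, N2} = {P k, P (Suc k)}" using tends_T x by simp
    then show ?thesis using ground_P_Int[of k "Suc k"] k by (auto simp: doubleton_eq_iff)
  qed
  show "ground N1 \<inter> ground N2 = {}"
    if N: "N1 \<in> tverts T" "N2 \<in> tverts T" "N1 \<noteq> N2 \<and> (N1, N2) \<notin> tadjacent T" for N1 N2
  proof -
    obtain i j where ij: "i \<le> n" "j \<le> n" "N1 = P i" "N2 = P j" using N by (auto simp: T_def)
    then consider "i < j" | "j < i" using N by fastforce
    then show ?thesis
    proof cases
      case 1
      then show ?thesis using ground_P_Int[of i j] tadjacent_T[of i j] N ij by auto
    next
      case 2
      then have "(P j, P i) \<notin> tadjacent T" using N ij tadjacent_sym by blast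
      then show ?thesis using ground_P_Int[of j i] tadjacent_T[of j i] 2 ij by auto
    qed
  qed
  have "3 \<le> card (ground (P i))" if "i \<le> n" for i
    using card_ground_chorded[OF chord_data_P[OF that], of A] card_segment[OF that]
    unfolding P_def by linarith
  then show "if card (ground (Q n)) < 3 then tverts T = {Q n} else \<forall>N \<in> tverts T. 3 \<le> card (ground N)"
    using card_ground_Q by (auto simp: T_def)
  show "\<exists>G. contract_step\<^sup>*\<^sup>* T G \<and> tverts G = {Q n} \<and> tedges G = {}" by (rule contract_T)
qed

lemma P_cases:
  assumes i: "i \<le> n"
  obtains (circuit) "X i \<noteq> {}" "Z i = {}" "labeled_circuit (card (X i) + 2) (P i)"
  | (triangle) z where "X i = {}" "Z i = {z}" "labeled_cocircuit 3 (P i)"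
  | (spike) "spike_segment A (X i) (Z i)" "tip_cotip_pair (card (X i) + 1) (P i) {q i, q (Suc i)}"
      "n_connected_matroid 3 (P i)" "4 \<le> card (ground (P i))" "3 \<le> card (X i) + 1"
proof -
  note cd = chord_data_P[OF i]
  consider "X i \<noteq> {}" "Z i = {}" | z where "X i = {}" "Z i = {z}" | "spike_segment A (X i) (Z i)"
    using seg[OF i] unfolding segment_def by blast
  then show thesis
  proof cases
    case 1
    then show ?thesis using circuit chorded_labeled_circuit[of "q i" "q (Suc i)" "X i" A] cd
      by (simp add: P_def)
  next
    case 2
    then show ?thesis using triangle chorded_triangle_cocircuit[of "q i" "q (Suc i)" z A] cd
      by (simp add: P_def)
  next
    case 3
    then have X2: "2 \<le> card (X i)" by (simp add: spike_segment_def)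
    have "4 \<le> card (ground (P i))"
      using card_ground_chorded[OF cd, of A] X2 unfolding P_def by linarith
    then show ?thesis
      using spike 3 X2 spike_segment_tip_cotip[OF cd 3] n_connected_spike[OF cd 3] by (simp add: P_def)
  qed
qed

lemma labeled_circuitD: "i \<le> n \<Longrightarrow> labeled_circuit k (P i) \<Longrightarrow> Z i = {}"
  using chorded_labeled_circuitD[OF chord_data_P] by (simp add: P_def)

lemma labeled_cocircuitD: "i \<le> n \<Longrightarrow> labeled_cocircuit k (P i) \<Longrightarrow> X i = {}"
  using chorded_labeled_cocircuitD[OF chord_data_P] by (simp add: P_def)

lemma canonical_T: "canonical_tree_decomposition T (Q n)"
proof -
  have label: "(\<exists>k. labeled_circuit k (P i)) \<or> (\<exists>k. labeled_cocircuit k (P i)) \<or>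
      n_connected_matroid 3 (P i) \<and> 4 \<le> card (ground (P i))" if "i \<le> n" for i
    using that by (cases rule: P_cases) blast+
  have adj: "\<not> ((\<exists>k. labeled_circuit k N1) \<and> (\<exists>k. labeled_circuit k N2)) \<and>
      \<not> ((\<exists>k. labeled_cocircuit k N1) \<and> (\<exists>k. labeled_cocircuit k N2))"
    if N: "(N1, N2) \<in> tadjacent T" for N1 N2
  proof -
    obtain x where x: "x \<in> tedges T" "tends T x = {N1, N2}"
      using N by (auto simp: tadjacent_def)
    then obtain k where k: "k < n" "x = q (Suc k)" by (auto simp: tedges_T)
    then have "{N1, N2} = {P k, P (Suc k)}" using tends_T x by simp
    then have "N1 = P k \<and> N2 = P (Suc k) \<or> N1 = P (Suc k) \<and> N2 = P k" by (auto simp: doubleton_eq_iff)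
    then show ?thesis
      using alternating[OF k(1)] k(1) labeled_circuitD[of k] labeled_circuitD[of "Suc k"]
        labeled_cocircuitD[of k] labeled_cocircuitD[of "Suc k"] by auto
  qed
  have "\<forall>N \<in> tverts T. (\<exists>k. labeled_circuit k N) \<or> (\<exists>k. labeled_cocircuit k N) \<or>
      n_connected_matroid 3 N \<and> 4 \<le> card (ground N)"
    using label by (auto simp: T_def)
  then show ?thesis
    unfolding canonical_tree_decomposition_def using tree_decomposition_T adj by blast
qed

text \<open>The parameter \<open>r\<close> is arbitrary and must be recovered: a spike has
  \<open>2 * r\<close> elements, which fixes \<open>r\<close> for a spike segment and excludes
  \<open>U_{1,3}\<close>. A circuit segment is excluded because a spike has a circuit other than its
  ground set.\<close>

lemma isomorphic_spike_imp:
  assumes i: "i \<le> n" and r: "3 \<le> r" and iso: "isomorphic_matroid (P i) (cotipped_spike r)"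
  shows "tip_cotip_pair r (P i) {q i, q (Suc i)}"
  using i
proof (cases rule: P_cases)
  case circuit
  obtain \<phi> where \<phi>: "matroid_iso \<phi> (P i) (cotipped_spike r)" using iso by (auto simp: isomorphic_matroid_def)
  have bij: "bij_betw \<phi> (ground (P i)) (ground (cotipped_spike r))" using \<phi> by (simp add: matroid_iso_def)
  have r1: "1 \<le> r" using r by simp
  \<comment> \<open>This is the triangle of \<open>SY 1\<close>, the tip and \<open>SX 1\<close>, a
    circuit that misses the cotip \<open>SX r\<close>.\<close>
  let ?D = "{SY 1, STip} \<union> (spike_chord (SY 1) \<inter> SX ` {1..<r})"
  have "SY 1 \<in> SY ` {1..<r}" using r by simp
  then have "circuit (cotipped_spike r) ?D"
    unfolding cotipped_spike_chorded[OF r1] standard_spike_def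
    by (rule circuit_chord_e[OF chord_data_standard_spike[OF r1]])
  then have D: "?D \<subseteq> ground (cotipped_spike r)" "?D \<notin> indeps (cotipped_spike r)" by (auto simp: circuit_def)
  have "SX r \<in> ground (cotipped_spike r)"
    by (simp add: cotipped_spike_chorded[OF r1] standard_spike_def)
  moreover have "SX r \<notin> ?D" using r by simp
  ultimately have proper: "?D \<noteq> ground (cotipped_spike r)" by metis
  obtain S where S: "S \<subseteq> ground (P i)" "?D = \<phi> ` S"
    using D(1) bij unfolding bij_betw_def by (metis subset_image_iff)
  then have "S \<noteq> ground (P i)" using proper bij by (auto simp: bij_betw_def)
  moreover have "circuit (P i) (ground (P i))"
    using circuit_whole[OF chord_data_P[OF i], of A] circuit by (simp add: P_def)
  ultimately have "S \<in> indeps (P i)" using S(1) circuit_proper_subset_indep by blast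
  then show ?thesis using \<phi> S D(2) by (auto simp: matroid_iso_def)
next
  case (triangle z)
  have "card (ground (P i)) = 3" using card_ground_chorded[OF chord_data_P[OF i], of A] triangle(1,2)
    unfolding P_def by (simp del: ground_chorded)
  then show ?thesis using isomorphic_cotipped_spike_card[OF iso] r by simp
next
  case spike
  have "isomorphic_matroid (P i) (cotipped_spike (card (X i) + 1))"
    using spike by (auto simp: tip_cotip_pair_def isomorphic_matroid_def)
  then have "card (ground (P i)) = 2 * (card (X i) + 1)"
    by (rule isomorphic_cotipped_spike_card) simp
  moreover have "card (ground (P i)) = 2 * r"
    by (rule isomorphic_cotipped_spike_card[OF iso]) (use r in simp)
  ultimately have "2 * r = 2 * (card (X i) + 1)" by (rule trans[OF sym, rotated])
  then have "r = card (X i) + 1" by simp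
  then show ?thesis using spike by simp
qed

lemma basepoints_P:
  assumes "i \<le> n"
  shows "basepoints T (P i) = {q j | j. j \<in> {i, Suc i} \<and> 1 \<le> j \<and> j \<le> n}"
  using q_in_ground_P[OF _ assms] by (auto simp: basepoints_def T_def)

end

text \<open>The sequence \<open>s\<close> supplies names for the basepoints. A
  \<open>U_{1,3}\<close> segment at an end of the chain would give a chord whose set is empty or all
  of \<open>X\<close>, and two consecutive ones would give chords with equal sets;
  \<open>proper\<close> and \<open>fam\<close> exclude these.\<close>

lemma segment_path_exists:
  fixes s :: "nat \<Rightarrow> 'a"
  assumes cd: "chord_data e f X Z" and fam: "chord_family A X Z"
    and proper: "\<forall>z \<in> Z. A z \<inter> X \<noteq> {} \<and> \<not> X \<subseteq> A z" and ne: "X \<noteq> {}"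
    and s: "inj s" "range s \<inter> ({e, f} \<union> X \<union> Z) = {}"
  shows "\<exists>n Xs Zs q. segment_path A n Xs Zs q \<and> q 0 = e \<and> q (Suc n) = f \<and>
    (\<Union>i\<le>n. Xs i) = X \<and> (\<Union>i\<le>n. Zs i) = Z \<and> Xs 0 \<noteq> {} \<and> Xs n \<noteq> {}"
proof -
  have fin: "finite X" "finite Z" using cd by (auto simp: chord_data_def)
  obtain ps where ps: "(\<Union>p \<in> set ps. fst p) = X" "(\<Union>p \<in> set ps. snd p) = Z"
    "sorted_wrt (precedes A) ps" "\<forall>p \<in> set ps. segment A (fst p) (snd p)"
    "successively (\<lambda>p q. snd p \<noteq> {} \<or> snd q \<noteq> {}) ps"
    using chord_family_decomposition[OF fin fam] by blast
  define n where "n = length ps - 1"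
  define Xs where "Xs i = fst (ps ! i)" for i
  define Zs where "Zs i = snd (ps ! i)" for i
  define q where "q i = (if i = 0 then e else if i = Suc n then f else s i)" for i
  have "ps \<noteq> []" using ps(1) ne by auto
  then have len: "length ps = Suc n" by (simp add: n_def)
  have set: "set ps = (!) ps ` {..n}" by (simp add: set_conv_nth len less_Suc_eq_le atMost_def image_def) blast
  have UX: "(\<Union>i\<le>n. Xs i) = X" and UZ: "(\<Union>i\<le>n. Zs i) = Z"
    using ps(1,2) by (simp_all add: set Xs_def Zs_def)
  have sub: "Xs i \<subseteq> X" "Zs i \<subseteq> Z" if "i \<le> n" for i using that UX UZ by auto
  have seg: "segment A (Xs i) (Zs i)" if "i \<le> n" for i
    using ps(4) that len by (simp add: Xs_def Zs_def)
  have prec: "precedes A (Xs i, Zs i) (Xs j, Zs j)" if "i < j" "j \<le> n" for i j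
    using sorted_wrt_nth_less[OF ps(3), of i j] that len by (simp add: Xs_def Zs_def)
  have tri: "\<exists>z \<in> Z. z \<in> Zs i" if "i \<le> n" "Xs i = {}" for i
    using seg[OF that(1)] that sub(2)[OF that(1)] by (auto simp: segment_def spike_segment_def)
  have below: "Xs j \<subseteq> A z" if "j < i" "i \<le> n" "z \<in> Zs i" for i j z
    using prec[OF that(1,2)] that by (simp add: precedes_def)
  have above: "A z \<inter> Xs j = {}" if "i < j" "j \<le> n" "z \<in> Zs i" for i j z
    using prec[OF that(1,2)] that by (simp add: precedes_def)
  have "Xs 0 \<noteq> {}"
  proof
    assume e: "Xs 0 = {}"
    then obtain z where z: "z \<in> Z" "z \<in> Zs 0" using tri[of 0] by auto
    have "A z \<inter> Xs j = {}" if "j \<le> n" for j using above[of 0 j z] e z that by (cases j) auto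
    then have "A z \<inter> X = {}" unfolding UX[symmetric] by blast
    then show False using proper z by blast
  qed
  moreover have "Xs n \<noteq> {}"
  proof
    assume e: "Xs n = {}"
    then obtain z where z: "z \<in> Z" "z \<in> Zs n" using tri[of n] by auto
    have "Xs j \<subseteq> A z" if "j \<le> n" for j using below[of j n z] e z that by (cases "j = n") auto
    then have "X \<subseteq> A z" unfolding UX[symmetric] by blast
    then show False using proper z by blast
  qed
  moreover have "segment_path A n Xs Zs q"
  proof
    show "finite (Xs i) \<and> finite (Zs i)" if "i \<le> n" for i
      using sub[OF that] fin finite_subset by blast
    show "inj_on q {..Suc n}"
    proof (rule inj_onI)
      fix i j assume "i \<in> {..Suc n}" "j \<in> {..Suc n}" "q i = q j"
      moreover have "s i \<noteq> e" "s i \<noteq> f" "e \<noteq> f" for i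
        using s(2) cd by (auto simp: chord_data_def)
      ultimately show "i = j" using s(1) by (auto simp: q_def inj_eq split: if_splits)
    qed
    show "q i \<notin> Xs j \<union> Zs j" if "i \<le> Suc n" "j \<le> n" for i j
    proof -
      have "s i \<notin> X \<union> Z" using s(2) by blast
      then have "q i \<notin> X \<union> Z" using cd by (simp add: q_def chord_data_def)
      then show ?thesis using sub[OF that(2)] by blast
    qed
    show "Xs i \<inter> Zs j = {}" if "i \<le> n" "j \<le> n" for i j
      using sub[OF that(1)] sub[OF that(2)] cd by (auto simp: chord_data_def)
    show "(Zs i \<noteq> {} \<or> Zs (Suc i) \<noteq> {}) \<and> (Xs i \<noteq> {} \<or> Xs (Suc i) \<noteq> {})" if i: "i < n" for i
    proof
      show "Zs i \<noteq> {} \<or> Zs (Suc i) \<noteq> {}"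
        using ps(5) i len by (simp add: successively_conv_nth Zs_def)
      show "Xs i \<noteq> {} \<or> Xs (Suc i) \<noteq> {}"
      proof (rule ccontr)
        assume "\<not> (Xs i \<noteq> {} \<or> Xs (Suc i) \<noteq> {})"
        then have e: "Xs i = {}" "Xs (Suc i) = {}" by auto
        obtain z w where zw: "z \<in> Z" "z \<in> Zs i" "w \<in> Z" "w \<in> Zs (Suc i)"
          using tri[of i] tri[of "Suc i"] e i by auto
        have "z \<noteq> w" using prec[of i "Suc i"] i zw by (auto simp: precedes_def)
        \<comment> \<open>The sets of \<open>z\<close> and \<open>w\<close> agree on earlier
          segments, which both contain, and on later ones, which both avoid; their own two segments
          have no elements of \<open>X\<close>.\<close>
        have "A z \<inter> Xs j = A w \<inter> Xs j" if "j \<le> n" for j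
        proof -
          consider "j < i" | "j = i \<or> j = Suc i" | "Suc i < j" by linarith
          then show ?thesis
          proof cases
            case 1
            then show ?thesis using below[of j i z] below[of j "Suc i" w] i zw by auto
          next
            case 2
            then show ?thesis using e by auto
          next
            case 3
            then show ?thesis using above[of i j z] above[of "Suc i" j w] zw that by auto
          qed
        qed
        then have "A z \<inter> X = A w \<inter> X" unfolding UX[symmetric] by blast
        then show False using fam zw \<open>z \<noteq> w\<close> unfolding chord_family_def compatible_def by blast
      qed
    qed
  qed (use seg prec in auto)
  moreover have "q 0 = e" "q (Suc n) = f" by (simp_all add: q_def)
  ultimately show ?thesis using UX UZ by blast
qed

section \<open>Transfer to a type with spare names for basepoints\<close>

fun lift_chord :: "('a \<Rightarrow> 'a set) \<Rightarrow> 'a + nat \<Rightarrow> ('a + nat) set" where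
  "lift_chord A (Inl z) = Inl ` A z"
| "lift_chord A (Inr i) = {}"

lemma relabel_Inl_chorded:
  "relabel Inl (chorded A e f X Z) = chorded (lift_chord A) (Inl e) (Inl f) (Inl ` X) (Inl ` Z)"
proof (rule relabel_iso)
  show "matroid_iso Inl (chorded A e f X Z) (chorded (lift_chord A) (Inl e) (Inl f) (Inl ` X) (Inl ` Z))"
    by (rule matroid_iso_chorded) auto
qed (auto simp: chorded_def indeps_cycle_matroid)

lemma chord_family_lift:
  assumes "chord_family A X Z"
  shows "chord_family (lift_chord A) (Inl ` X) (Inl ` Z)"
  unfolding chord_family_def
proof (intro ballI impI)
  fix z' w' :: "'a + nat" assume "z' \<in> Inl ` Z" "w' \<in> Inl ` Z" "z' \<noteq> w'"
  then obtain z w where zw: "z \<in> Z" "w \<in> Z" "z \<noteq> w" "z' = Inl z" "w' = Inl w" by auto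
  have "compatible (A z \<inter> X) (A w \<inter> X)" using assms zw unfolding chord_family_def by blast
  moreover have "lift_chord A (Inl u) \<inter> Inl ` X = Inl ` (A u \<inter> X)" for u by auto
  moreover have "compatible (Inl ` B :: ('a + nat) set) (Inl ` C) \<longleftrightarrow> compatible B C" for B C
    unfolding compatible_def
    by (simp add: inj_image_eq_iff inj_image_subset_iff card_image flip: image_set_diff)
  ultimately show "compatible (lift_chord A z' \<inter> Inl ` X) (lift_chord A w' \<inter> Inl ` X)"
    unfolding zw(4,5) by simp
qed

section \<open>Spanning circuits through two elements of a 2-sum\<close>

text \<open>This is the exchange form of the statement that circuits through \<open>s\<close> and
  \<open>t\<close> are spanning: each \<open>C - {c}\<close> is a maximal independent set. It
  mentions dependence only, which can be read off the circuits of a 2-sum without computing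
  ranks.\<close>

definition spanning_between :: "'a matroid \<Rightarrow> 'a \<Rightarrow> 'a \<Rightarrow> bool" where
  "spanning_between N s t \<longleftrightarrow> (\<forall>C c x. circuit N C \<and> s \<in> C \<and> t \<in> C \<and> c \<in> C \<and>
     x \<in> ground N - C \<longrightarrow> insert x (C - {c}) \<notin> indeps N)"

lemma spanning_between_sym: "spanning_between N s t \<Longrightarrow> spanning_between N t s"
  by (simp add: spanning_between_def)

lemma dependent_contains_circuit:
  assumes "finite (ground N)" "I \<subseteq> ground N" "I \<notin> indeps N"
  shows "\<exists>C \<subseteq> I. circuit N C"
proof -
  define F where "F = {C. C \<subseteq> I \<and> C \<notin> indeps N}"
  have "finite I" using assms finite_subset by blast
  then have "finite F" by (simp add: F_def)
  moreover have "I \<in> F" using assms by (simp add: F_def)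
  ultimately obtain C where C: "C \<in> F" "\<forall>D \<in> F. D \<subseteq> C \<longrightarrow> C = D"
    using finite_has_minimal2[of F I] by auto
  have "D \<in> indeps N" if "D \<subset> C" for D
  proof (rule ccontr)
    assume "D \<notin> indeps N"
    then have "D \<in> F" using that C(1) by (auto simp: F_def)
    then show False using C(2) that by blast
  qed
  then show ?thesis using C(1) assms(2) unfolding F_def circuit_def by blast
qed

lemma two_sum_circuits_commute: "two_sum_circuits p N1 N2 = two_sum_circuits p N2 N1"
  unfolding two_sum_circuits_def by (auto simp: Un_commute)

text \<open>If \<open>x\<close> lies in \<open>N1\<close> together with \<open>c\<close>, exchange
  there gives a circuit, which is joined to \<open>C2\<close> when it passes through
  \<open>p\<close>. If \<open>x\<close> lies in \<open>N2\<close>, exchange is applied to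
  \<open>C2\<close> with \<open>p\<close> as the removed element, giving a circuit that avoids
  \<open>p\<close>.\<close>

lemma two_sum_exchange:
  assumes fin: "finite (ground N1)" "finite (ground N2)" and int: "ground N1 \<inter> ground N2 = {p}"
    and sp: "spanning_between N1 s p" "spanning_between N2 p t"
    and C1: "circuit N1 C1" "p \<in> C1" "s \<in> C1" and C2: "circuit N2 C2" "p \<in> C2" "t \<in> C2"
    and c: "c \<in> C1" "c \<noteq> p" and x: "x \<in> ground N1 \<union> ground N2" "x \<notin> C1 \<union> C2"
  shows "\<exists>D \<in> two_sum_circuits p N1 N2. D \<subseteq> insert x ((C1 \<union> C2) - {p} - {c})"
proof -
  have sub: "C1 \<subseteq> ground N1" "C2 \<subseteq> ground N2" using C1 C2 by (auto simp: circuit_def)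
  have cC2: "c \<notin> C2" using c sub int by blast
  have xp: "x \<noteq> p" using x C1 by blast
  show ?thesis
  proof (cases "x \<in> ground N1")
    case True
    have "insert x (C1 - {c}) \<notin> indeps N1"
      using sp(1) C1 c x True unfolding spanning_between_def by blast
    then obtain D where D: "D \<subseteq> insert x (C1 - {c})" "circuit N1 D"
      using dependent_contains_circuit[OF fin(1)] True sub by (metis Diff_subset insert_subset subset_trans)
    show ?thesis
    proof (cases "p \<in> D")
      case True
      then have "(D \<union> C2) - {p} \<in> two_sum_circuits p N1 N2"
        using D C2 unfolding two_sum_circuits_def by blast
      moreover have "(D \<union> C2) - {p} \<subseteq> insert x ((C1 \<union> C2) - {p} - {c})"
        using D(1) cC2 by blast
      ultimately show ?thesis by blast
    next
      case False
      then have "D \<in> two_sum_circuits p N1 N2" using D(2) unfolding two_sum_circuits_def by blast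
      moreover have "D \<subseteq> insert x ((C1 \<union> C2) - {p} - {c})" using D(1) False by blast
      ultimately show ?thesis by blast
    qed
  next
    case False
    then have xN: "x \<in> ground N2" using x by blast
    then have "insert x (C2 - {p}) \<notin> indeps N2"
      using sp(2) C2 x unfolding spanning_between_def by blast
    then obtain D where D: "D \<subseteq> insert x (C2 - {p})" "circuit N2 D"
      using dependent_contains_circuit[OF fin(2)] xN sub by (metis Diff_subset insert_subset subset_trans)
    then have "p \<notin> D" using xp by blast
    then have "D \<in> two_sum_circuits p N1 N2" using D(2) unfolding two_sum_circuits_def by blast
    moreover have "D \<subseteq> insert x ((C1 \<union> C2) - {p} - {c})" using D(1) cC2 by blast
    ultimately show ?thesis by blast
  qed
qed

text \<open>By minimality a circuit of the 2-sum belongs to \<open>two_sum_circuits\<close>, and it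
  must be of the glued kind, since \<open>s\<close> and \<open>t\<close> lie on different sides.
  Exchange then works in whichever part contains \<open>c\<close>.\<close>

lemma spanning_between_two_sum:
  assumes fin: "finite (ground N1)" "finite (ground N2)" and int: "ground N1 \<inter> ground N2 = {p}"
    and sp: "spanning_between N1 s p" "spanning_between N2 p t"
    and s: "s \<in> ground N1" "s \<noteq> p" and t: "t \<in> ground N2" "t \<noteq> p"
  shows "spanning_between (two_sum p N1 N2) s t"
  unfolding spanning_between_def
proof (intro allI impI)
  let ?N = "two_sum p N1 N2"
  fix C c x assume *: "circuit ?N C \<and> s \<in> C \<and> t \<in> C \<and> c \<in> C \<and> x \<in> ground ?N - C"
  have C: "circuit ?N C" and x: "x \<in> (ground N1 \<union> ground N2) - {p}" "x \<notin> C"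
    using * by (auto simp: two_sum_def)
  have CE: "C \<subseteq> ground N1 \<union> ground N2 - {p}" using C by (simp add: circuit_def two_sum_def)
  have dep: "I \<notin> indeps ?N" if "D \<in> two_sum_circuits p N1 N2" "D \<subseteq> I" for D I
    using that by (auto simp: two_sum_def)
  have "C \<notin> indeps ?N" using C by (simp add: circuit_def)
  then obtain D where D: "D \<in> two_sum_circuits p N1 N2" "D \<subseteq> C" using CE by (auto simp: two_sum_def)
  have "D = C"
  proof (rule ccontr)
    assume "D \<noteq> C"
    then have "D \<in> indeps ?N" using C D(2) unfolding circuit_def by blast
    then show False using dep[OF D(1)] by blast
  qed
  then consider "circuit N1 C" | "circuit N2 C"
    | C1 C2 where "circuit N1 C1" "p \<in> C1" "circuit N2 C2" "p \<in> C2" "C = (C1 \<union> C2) - {p}"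
    using D(1) unfolding two_sum_circuits_def by blast
  then have "\<exists>D \<in> two_sum_circuits p N1 N2. D \<subseteq> insert x (C - {c})"
  proof cases
    case 1
    then have "t \<in> ground N1" using * by (auto simp: circuit_def)
    then show ?thesis using int t by blast
  next
    case 2
    then have "s \<in> ground N2" using * by (auto simp: circuit_def)
    then show ?thesis using int s by blast
  next
    case 3
    have sub: "C1 \<subseteq> ground N1" "C2 \<subseteq> ground N2" using 3 by (auto simp: circuit_def)
    have sC: "s \<in> C1" using * 3(5) sub s int by blast
    have tC: "t \<in> C2" using * 3(5) sub t int by blast
    have xC: "x \<notin> C1 \<union> C2" using x 3(5) by blast
    have cp: "c \<noteq> p" using * 3(5) by blast
    have "c \<in> C1 \<or> c \<in> C2" using * 3(5) by blast
    then show ?thesis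
    proof
      assume "c \<in> C1"
      then show ?thesis
        using two_sum_exchange[OF fin int sp 3(1,2) sC 3(3,4) tC _ cp _ xC] x 3(5) by blast
    next
      assume "c \<in> C2"
      moreover have "ground N2 \<inter> ground N1 = {p}" using int by blast
      moreover have "x \<notin> C2 \<union> C1" using xC by blast
      ultimately have "\<exists>D \<in> two_sum_circuits p N2 N1. D \<subseteq> insert x ((C2 \<union> C1) - {p} - {c})"
        using two_sum_exchange[OF fin(2,1) _ spanning_between_sym[OF sp(2)] spanning_between_sym[OF sp(1)]
            3(3,4) tC 3(1,2) sC _ cp] x by blast
      then show ?thesis using 3(5) by (simp add: two_sum_circuits_commute Un_commute)
    qed
  qed
  then show "insert x (C - {c}) \<notin> indeps ?N" using dep by blast
qed

section \<open>The exchange property for circuits, cocircuits and spikes\<close>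

lemma spanning_betweenI:
  assumes fin: "finite (ground N)"
    and C: "\<And>C. circuit N C \<Longrightarrow> s \<in> C \<Longrightarrow> t \<in> C \<Longrightarrow> card C = k + 1"
    and I: "\<And>I. I \<in> indeps N \<Longrightarrow> card I \<le> k"
  shows "spanning_between N s t"
  unfolding spanning_between_def
proof (intro allI impI)
  fix C c x assume *: "circuit N C \<and> s \<in> C \<and> t \<in> C \<and> c \<in> C \<and> x \<in> ground N - C"
  then have "finite C" using fin finite_subset by (auto simp: circuit_def)
  then have "card (insert x (C - {c})) = Suc (card (C - {c}))" "Suc (card (C - {c})) = card C"
    using * card_Suc_Diff1[of C c] by (auto simp del: card_Diff_insert card_Diff_singleton)
  moreover have "card C = k + 1" using * C by blast
  ultimately show "insert x (C - {c}) \<notin> indeps N" using I[of "insert x (C - {c})"] by auto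
qed

lemma spanning_between_uniform:
  assumes N: "matroid N" and iso: "isomorphic_matroid N (uniform_matroid k n)"
  shows "spanning_between N s t"
proof -
  have fin: "finite (ground N)" and sub: "indeps N \<subseteq> Pow (ground N)" and em: "{} \<in> indeps N"
    using N unfolding matroid_def by blast+
  have ind: "I \<in> indeps N \<longleftrightarrow> card I \<le> k" if "I \<subseteq> ground N" for I
    using iso that unfolding isomorphic_uniform_iff[OF fin] by blast
  show ?thesis
  proof (rule spanning_betweenI[OF fin, where k = k])
    show "card I \<le> k" if "I \<in> indeps N" for I using ind[of I] sub that by blast
    fix C assume C: "circuit N C" "s \<in> C"
    then have CE: "C \<subseteq> ground N" "C \<notin> indeps N" by (auto simp: circuit_def)
    have "C - {s} \<in> indeps N" by (rule circuit_proper_subset_indep[OF C(1)]) (use C(2) in blast)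
    then have "card (C - {s}) \<le> k" using ind[of "C - {s}"] CE by blast
    moreover have "\<not> card C \<le> k" using ind CE by blast
    moreover have "card (C - {s}) = card C - 1" using C(2) by simp
    ultimately show "card C = k + 1" by linarith
  qed
qed

lemma circuit_iso:
  assumes \<phi>: "matroid_iso \<phi> M N" and C: "circuit M C"
  shows "circuit N (\<phi> ` C)"
proof -
  have bij: "bij_betw \<phi> (ground M) (ground N)" using \<phi> by (simp add: matroid_iso_def)
  have ind: "X \<in> indeps M \<longleftrightarrow> \<phi> ` X \<in> indeps N" if "X \<subseteq> ground M" for X
    using \<phi> that by (simp add: matroid_iso_def)
  have CE: "C \<subseteq> ground M" "C \<notin> indeps M" using C by (auto simp: circuit_def)
  have "D \<in> indeps N" if D: "D \<subset> \<phi> ` C" for D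
  proof -
    obtain S where S: "S \<subseteq> C" "D = \<phi> ` S" using D by (meson psubset_imp_subset subset_imageE)
    then have "S \<subset> C" using D by blast
    then show ?thesis using S ind[of S] CE circuit_proper_subset_indep[OF C] by blast
  qed
  moreover have "\<phi> ` C \<subseteq> ground N" using CE bij by (auto simp: bij_betw_def)
  ultimately show ?thesis using ind[of C] CE by (auto simp: circuit_def)
qed

text \<open>With the cotip in \<open>C\<close>, the row of \<open>SX i\<close> says that exactly one
  of \<open>SX i\<close> and \<open>SY i\<close> is in \<open>C\<close>; together with the tip and
  the cotip this makes \<open>(r - 1) + 2\<close> elements.\<close>

lemma standard_spike_circuit_card:
  assumes C: "circuit (standard_spike r) C" "STip \<in> C" "SX r \<in> C" and r: "1 \<le> r"
  shows "card C = r + 1"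
proof -
  let ?Z = "\<lambda>i. {z \<in> SY ` {1..<r}. SX i \<in> spike_chord z}"
  have cyc: "C \<in> chord_cycles spike_chord STip (SX r) (SX ` {1..<r}) (SY ` {1..<r})"
    using C(1) unfolding standard_spike_def circuit_chorded by blast
  have row: "SY i \<in> C \<longleftrightarrow> SX i \<notin> C" if i: "i \<in> {1..<r}" for i
  proof -
    have "?Z i = {SY i}" using i by auto
    moreover have "even (card (C \<inter> ?Z i)) \<longleftrightarrow> SX i \<in> C"
      using cyc i C(3) by (simp add: chord_cycles_def)
    ultimately have "even (card (C \<inter> {SY i})) \<longleftrightarrow> SX i \<in> C" by simp
    moreover have "even (card (C \<inter> {SY i})) \<longleftrightarrow> SY i \<notin> C"
      using even_card_Int_insert[of "{}" "SY i" C] by simp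
    ultimately show ?thesis by blast
  qed
  define h where "h i = (if SX i \<in> C then SX i else SY i)" for i
  have "C = {STip, SX r} \<union> h ` {1..<r}"
  proof
    show "C \<subseteq> {STip, SX r} \<union> h ` {1..<r}"
    proof
      fix u assume u: "u \<in> C"
      then consider "u \<in> {STip, SX r}" | i where "i \<in> {1..<r}" "u = SX i \<or> u = SY i"
        using chord_cycle_subset[OF cyc] by blast
      then show "u \<in> {STip, SX r} \<union> h ` {1..<r}"
      proof cases
        case 2
        then have "u = h i" using u row[OF 2(1)] by (auto simp: h_def)
        then show ?thesis using 2 by blast
      qed auto
    qed
    show "{STip, SX r} \<union> h ` {1..<r} \<subseteq> C" using C row by (auto simp: h_def)
  qed
  moreover have "card (h ` {1..<r}) = r - 1"
    by (subst card_image) (auto simp: inj_on_def h_def split: if_splits)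
  moreover have "{STip, SX r} \<inter> h ` {1..<r} = {}" by (auto simp: h_def split: if_splits)
  ultimately have "card C = 2 + (r - 1)" by (simp add: card_Un_disjoint)
  then show ?thesis using r by simp
qed

lemma spanning_between_spike:
  assumes r: "1 \<le> r" and pair: "tip_cotip_pair r N {s, t}" and N: "matroid N"
  shows "spanning_between N s t"
proof -
  obtain \<phi> where \<phi>: "matroid_iso \<phi> N (standard_spike r)" "{\<phi> s, \<phi> t} = {STip, SX r}"
    using pair unfolding tip_cotip_pair_def cotipped_spike_chorded[OF r] by auto
  have bij: "bij_betw \<phi> (ground N) (ground (standard_spike r))" using \<phi>(1) by (simp add: matroid_iso_def)
  have card: "card (\<phi> ` S) = card S" if "S \<subseteq> ground N" for S
    using bij that by (auto simp: bij_betw_def intro: card_image inj_on_subset)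
  have sub: "indeps N \<subseteq> Pow (ground N)" and fin: "finite (ground N)" using N unfolding matroid_def by blast+
  show ?thesis
  proof (rule spanning_betweenI[OF fin, where k = r])
    fix C assume C: "circuit N C" "s \<in> C" "t \<in> C"
    then have "STip \<in> \<phi> ` C" "SX r \<in> \<phi> ` C" using \<phi>(2) by (metis image_eqI insertI1 insert_commute insertE singletonD)+
    then have "card (\<phi> ` C) = r + 1"
      using standard_spike_circuit_card[OF circuit_iso[OF \<phi>(1) C(1)] _ _ r] by blast
    then show "card C = r + 1" using card[of C] C(1) by (simp add: circuit_def)
  next
    fix I assume I: "I \<in> indeps N"
    then have "\<phi> ` I \<in> indeps (standard_spike r)" using \<phi>(1) sub by (auto simp: matroid_iso_def)
    then have "card (\<phi> ` I) \<le> card (SX ` {1..<r}) + 1"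
      unfolding standard_spike_def by (rule chorded_indep_card[OF chord_data_standard_spike[OF r]])
    moreover have "card (SX ` {1..<r}) = r - 1" by (simp add: card_image inj_on_def)
    ultimately show "card I \<le> r" using card[of I] I sub r by auto
  qed
qed

section \<open>Contracting a path\<close>

text \<open>
  Each vertex \<open>N\<close> of a path from \<open>e\<close> to \<open>f\<close> has an entry \<open>\<sigma> N\<close> and an exit \<open>\<tau> N\<close>; the height \<open>h\<close>
  increases along the path, so that the invariant needs no indexing of the vertices.
\<close>

definition oriented_vertex ::
    "'a \<Rightarrow> 'a \<Rightarrow> 'a matroid_graph \<Rightarrow> ('a matroid \<Rightarrow> 'a) \<Rightarrow> ('a matroid \<Rightarrow> 'a) \<Rightarrow> 'a matroid \<Rightarrow> bool" where
  "oriented_vertex e f T \<sigma> \<tau> N \<longleftrightarrow>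
     finite (ground N) \<and> \<sigma> N \<in> ground N \<and> \<tau> N \<in> ground N \<and> \<sigma> N \<noteq> \<tau> N \<and>
     spanning_between N (\<sigma> N) (\<tau> N) \<and> \<sigma> N \<in> insert e (tedges T) \<and> \<tau> N \<in> insert f (tedges T)"

definition crossing ::
    "('a matroid \<Rightarrow> 'a) \<Rightarrow> ('a matroid \<Rightarrow> 'a) \<Rightarrow> ('a matroid \<Rightarrow> nat) \<Rightarrow> 'a \<Rightarrow> 'a matroid \<Rightarrow> 'a matroid \<Rightarrow> bool" where
  "crossing \<sigma> \<tau> h z N N' \<longleftrightarrow> h N < h N' \<and> \<tau> N = z \<and> \<sigma> N' = z"

text \<open>The second clause confines an element shared by two vertices to the exit of the lower
  and the entry of the higher one. This keeps a composite vertex distinct from the others and lets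
  any edge be contracted.\<close>

definition oriented_path ::
    "'a \<Rightarrow> 'a \<Rightarrow> 'a matroid_graph \<Rightarrow> ('a matroid \<Rightarrow> 'a) \<Rightarrow> ('a matroid \<Rightarrow> 'a) \<Rightarrow> ('a matroid \<Rightarrow> nat) \<Rightarrow> bool" where
  "oriented_path e f T \<sigma> \<tau> h \<longleftrightarrow>
     (\<forall>N \<in> tverts T. oriented_vertex e f T \<sigma> \<tau> N) \<and>
     (\<forall>N \<in> tverts T. \<forall>N' \<in> tverts T. \<forall>z \<in> ground N \<inter> ground N'. N \<noteq> N' \<longrightarrow>
        crossing \<sigma> \<tau> h z N N' \<or> crossing \<sigma> \<tau> h z N' N) \<and>
     (\<forall>x \<in> tedges T. \<exists>N \<in> tverts T. \<exists>N' \<in> tverts T. tends T x = {N, N'} \<and> crossing \<sigma> \<tau> h x N N')"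

lemma two_sum_commute: "two_sum p N1 N2 = two_sum p N2 N1"
  by (simp add: two_sum_def two_sum_circuits_commute Un_commute)

lemma contract_edge_commute: "contract_edge T x N1 N2 = contract_edge T x N2 N1"
  by (simp add: contract_edge_def two_sum_commute[of x N1 N2] insert_commute[of N1 N2])

text \<open>The composite vertex takes the entry and the height of the lower end \<open>N1\<close>
  and the exit of the higher end \<open>N2\<close>, while \<open>x\<close>, the exit of
  \<open>N1\<close> and the entry of \<open>N2\<close>, disappears. All other vertices keep their
  data.\<close>

lemma oriented_path_step:
  assumes path: "oriented_path e f T \<sigma> \<tau> h" and step: "contract_step T T'"
  shows "\<exists>\<sigma> \<tau> h. oriented_path e f T' \<sigma> \<tau> h"
proof -
  have vert: "finite (ground N)" "\<sigma> N \<in> ground N" "\<tau> N \<in> ground N" "\<sigma> N \<noteq> \<tau> N"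
    "spanning_between N (\<sigma> N) (\<tau> N)" "\<sigma> N \<in> insert e (tedges T)" "\<tau> N \<in> insert f (tedges T)"
    if "N \<in> tverts T" for N
    using path that unfolding oriented_path_def oriented_vertex_def by blast+
  have meet: "h N < h N' \<and> \<tau> N = z \<and> \<sigma> N' = z \<or> h N' < h N \<and> \<tau> N' = z \<and> \<sigma> N = z"
    if "N \<in> tverts T" "N' \<in> tverts T" "N \<noteq> N'" "z \<in> ground N" "z \<in> ground N'" for N N' z
    using path that unfolding oriented_path_def crossing_def by blast
  have edge: "\<exists>N \<in> tverts T. \<exists>N' \<in> tverts T. tends T x = {N, N'} \<and> crossing \<sigma> \<tau> h x N N'"
    if "x \<in> tedges T" for x
    using path that unfolding oriented_path_def by blast
  obtain x M1 M2 where x: "x \<in> tedges T" and ends: "tends T x = {M1, M2}"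
    and T0: "T' = contract_edge T x M1 M2"
    using step unfolding contract_step_def by blast
  obtain N1 N2 where N: "N1 \<in> tverts T" "N2 \<in> tverts T" "tends T x = {N1, N2}"
    "\<tau> N1 = x" "\<sigma> N2 = x" "h N1 < h N2"
    using edge[OF x] unfolding crossing_def by blast
  have T': "T' = contract_edge T x N1 N2"
    using ends N(3) T0 contract_edge_commute[of T x M1 M2] by (auto simp: doubleton_eq_iff)
  have ne: "N1 \<noteq> N2" using N(6) by auto
  let ?N = "two_sum x N1 N2"
  have gN: "ground ?N = (ground N1 \<union> ground N2) - {x}" by (simp add: two_sum_def)
  have xN: "x \<in> ground N1" "x \<in> ground N2" using vert N by metis+
  have int: "ground N1 \<inter> ground N2 = {x}"
  proof -
    have "z = x" if "z \<in> ground N1" "z \<in> ground N2" for z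
      using meet[OF N(1,2) ne that] N(4,6) by auto
    then show ?thesis using xN by blast
  qed
  have s1: "\<sigma> N1 \<in> ground N1" "\<sigma> N1 \<noteq> x" and t2: "\<tau> N2 \<in> ground N2" "\<tau> N2 \<noteq> x"
    using vert[OF N(1)] vert[OF N(2)] N(4,5) by auto
  have s1t2: "\<sigma> N1 \<noteq> \<tau> N2"
  proof -
    have "\<sigma> N1 \<notin> ground N2" using s1 int by blast
    then show ?thesis using t2 by metis
  qed
  \<comment> \<open>An outside vertex meets the composite only at the entry, from below, or at the
    exit, from above: every other possibility makes the shared element \<open>x\<close>.\<close>
  have other: "h K < h N1 \<and> \<tau> K = z \<and> \<sigma> N1 = z \<or> h N1 < h K \<and> \<tau> N2 = z \<and> \<sigma> K = z"
    if K: "K \<in> tverts T" "K \<noteq> N1" "K \<noteq> N2" and z: "z \<in> ground K" "z \<in> ground ?N" for K z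
  proof -
    have "z \<noteq> x" using z gN by blast
    moreover have "z \<in> ground N1 \<or> z \<in> ground N2" using z gN by blast
    ultimately show ?thesis
      using meet[OF K(1) N(1) K(2) z(1)] meet[OF K(1) N(2) K(3) z(1)] N(4,5,6) by auto
  qed
  have notx: "\<sigma> K \<noteq> x" "\<tau> K \<noteq> x" if K: "K \<in> tverts T" "K \<noteq> N1" "K \<noteq> N2" for K
  proof -
    have "x \<notin> ground K"
      using meet[OF K(1) N(1) K(2) _ xN(1)] meet[OF K(1) N(2) K(3) _ xN(2)] s1(2) t2(2) N(4,5) vert(4)[OF K(1)] by auto
    then show "\<sigma> K \<noteq> x" "\<tau> K \<noteq> x" using vert[OF K(1)] by auto
  qed
  \<comment> \<open>A vertex equal to the composite would contain its entry and its exit, and so lie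
    both below and above \<open>N1\<close>.\<close>
  have new: "K \<noteq> ?N" if K: "K \<in> tverts T" for K
  proof
    assume eq: "K = ?N"
    have KN: "K \<noteq> N1" "K \<noteq> N2" 
    proof -
      have "x \<notin> ground K" unfolding eq gN by simp
      then show "K \<noteq> N1" "K \<noteq> N2" using xN by metis+
    qed
    have z: "\<sigma> N1 \<in> ground ?N" "\<tau> N2 \<in> ground ?N" using s1 t2 unfolding gN by simp_all
    moreover note s1t2
    moreover have "\<sigma> N1 \<in> ground K" "\<tau> N2 \<in> ground K" using z eq by simp_all
    ultimately show False
      using other[OF K KN, of "\<sigma> N1"] other[OF K KN, of "\<tau> N2"] by (metis less_asym)
  qed
  define \<sigma>' where "\<sigma>' = \<sigma>(?N := \<sigma> N1)"
  define \<tau>' where "\<tau>' = \<tau>(?N := \<tau> N2)"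
  define h' where "h' = h(?N := h N1)"
  have old: "\<sigma>' K = \<sigma> K" "\<tau>' K = \<tau> K" "h' K = h K" if "K \<in> tverts T" for K
    using new[OF that] by (simp_all add: \<sigma>'_def \<tau>'_def h'_def)
  have val: "\<sigma>' ?N = \<sigma> N1" "\<tau>' ?N = \<tau> N2" "h' ?N = h N1" by (simp_all add: \<sigma>'_def \<tau>'_def h'_def)
  have V': "tverts T' = insert ?N (tverts T - {N1, N2})" and E': "tedges T' = tedges T - {x}"
    and te': "tends T' y = (\<lambda>K. if K \<in> {N1, N2} then ?N else K) ` tends T y" for y
    by (simp_all add: T' contract_edge_def)
  have "oriented_path e f T' \<sigma>' \<tau>' h'"
    unfolding oriented_path_def
  proof (intro conjI)
    show "\<forall>K \<in> tverts T'. oriented_vertex e f T' \<sigma>' \<tau>' K"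
    proof
      fix K assume "K \<in> tverts T'"
      then consider "K = ?N" | "K \<in> tverts T" "K \<noteq> N1" "K \<noteq> N2" using V' by blast
      then show "oriented_vertex e f T' \<sigma>' \<tau>' K"
      proof cases
        case 1
        have "spanning_between ?N (\<sigma> N1) (\<tau> N2)"
          using spanning_between_two_sum[OF _ _ int _ _ s1 t2] vert[OF N(1)] vert[OF N(2)] N(4,5) by simp
        moreover note s1t2
        ultimately show ?thesis
          using 1 val gN s1 t2 vert[OF N(1)] vert[OF N(2)] E' by (simp add: oriented_vertex_def)
      next
        case 2
        then show ?thesis
          using vert[OF 2(1)] old[OF 2(1)] notx[OF 2] E' by (simp add: oriented_vertex_def)
      qed
    qed
    show "\<forall>K \<in> tverts T'. \<forall>K' \<in> tverts T'. \<forall>z \<in> ground K \<inter> ground K'. K \<noteq> K' \<longrightarrow>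
        crossing \<sigma>' \<tau>' h' z K K' \<or> crossing \<sigma>' \<tau>' h' z K' K"
    proof (intro ballI impI)
      fix K K' z assume K: "K \<in> tverts T'" "K' \<in> tverts T'" "K \<noteq> K'" and z: "z \<in> ground K \<inter> ground K'"
      have "K = ?N \<or> K \<in> tverts T \<and> K \<noteq> N1 \<and> K \<noteq> N2"
        "K' = ?N \<or> K' \<in> tverts T \<and> K' \<noteq> N1 \<and> K' \<noteq> N2"
        using K(1,2) V' by simp_all
      then consider "K = ?N" "K' \<in> tverts T" "K' \<noteq> N1" "K' \<noteq> N2"
        | "K' = ?N" "K \<in> tverts T" "K \<noteq> N1" "K \<noteq> N2"
        | "K \<in> tverts T" "K' \<in> tverts T"
        using K(3) by metis
      then show "crossing \<sigma>' \<tau>' h' z K K' \<or> crossing \<sigma>' \<tau>' h' z K' K"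
      proof cases
        case 1
        then show ?thesis using other[of K' z] z old[OF 1(2)] val by (auto simp: crossing_def)
      next
        case 2
        then show ?thesis using other[of K z] z old[OF 2(2)] val by (auto simp: crossing_def)
      next
        case 3
        then show ?thesis using meet[of K K' z] K(3) z old by (auto simp: crossing_def)
      qed
    qed
    show "\<forall>y \<in> tedges T'. \<exists>K \<in> tverts T'. \<exists>K' \<in> tverts T'.
        tends T' y = {K, K'} \<and> crossing \<sigma>' \<tau>' h' y K K'"
    proof
      fix y assume "y \<in> tedges T'"
      then have y: "y \<in> tedges T" "y \<noteq> x" using E' by auto
      obtain K K' where K: "K \<in> tverts T" "K' \<in> tverts T" "tends T y = {K, K'}"
        "\<tau> K = y" "\<sigma> K' = y" "h K < h K'"
        using edge[OF y(1)] unfolding crossing_def by blast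
      have K1: "K \<noteq> N1" "K' \<noteq> N2" using K N y by auto
      \<comment> \<open>An edge other than \<open>x\<close> can leave from \<open>N2\<close> or
        arrive at \<open>N1\<close>, but not the other way round; such an end is now the
        composite.\<close>
      define L where "L = (if K = N2 then ?N else K)"
      define L' where "L' = (if K' = N1 then ?N else K')"
      have "tends T' y = {L, L'}" using K1 K(3) by (simp add: te' L_def L'_def)
      moreover have "L \<in> tverts T'" "L' \<in> tverts T'" using K1 K(1,2) V' by (auto simp: L_def L'_def)
      moreover have "crossing \<sigma>' \<tau>' h' y L L'"
        using K old val N(6) by (auto simp: crossing_def L_def L'_def)
      ultimately show "\<exists>K \<in> tverts T'. \<exists>K' \<in> tverts T'.
          tends T' y = {K, K'} \<and> crossing \<sigma>' \<tau>' h' y K K'" by blast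
    qed
  qed
  then show ?thesis by blast
qed

lemma oriented_path_contract:
  assumes "contract_step\<^sup>*\<^sup>* T T'" and "oriented_path e f T \<sigma> \<tau> h"
    and "tverts T' = {M}" "tedges T' = {}"
  shows "spanning_between M e f"
proof -
  have "\<exists>\<sigma> \<tau> h. oriented_path e f T' \<sigma> \<tau> h"
    using assms(1,2)
  proof (induction rule: rtranclp_induct)
    case base
    then show ?case by blast
  next
    case (step T' T'')
    then obtain \<sigma>' \<tau>' h' where "oriented_path e f T' \<sigma>' \<tau>' h'" by blast
    then show ?case by (rule oriented_path_step) (rule step.hyps(2))
  qed
  then obtain \<sigma> \<tau> h where "oriented_path e f T' \<sigma> \<tau> h" by blast
  then have "spanning_between M (\<sigma> M) (\<tau> M)" "\<sigma> M = e" "\<tau> M = f"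
    using assms(3,4) by (auto simp: oriented_path_def oriented_vertex_def)
  then show ?thesis by simp
qed

text \<open>The prescribed pair in a spike is the entry and exit of its vertex, so every label has
  the exchange property between these two elements. With positions as heights this makes an oriented
  path, and the contractions of the tree decomposition lead to \<open>M\<close>.\<close>

lemma path_spanning_between:
  assumes td: "tree_decomposition T M" and path: "is_path T n P"
    and lab: "\<And>i. i \<le> n \<Longrightarrow> (\<exists>k. labeled_circuit k (P i)) \<or> (\<exists>k. labeled_cocircuit k (P i)) \<or>
      (\<exists>r\<ge>1. tip_cotip_pair r (P i) (if n = 0 then {e, f}
        else basepoints T (P i) \<union> (if i = 0 \<or> i = n then {e, f} \<inter> ground (P i) else {})))"
    and e: "e \<in> ground M" "e \<in> ground (P 0)" and f: "f \<in> ground M" "f \<in> ground (P n)" and "e \<noteq> f"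
  shows "spanning_between M e f"
proof -
  obtain b where injP: "inj_on P {0..n}" and V: "tverts T = P ` {0..n}" and E: "tedges T = b ` {0..<n}"
    and te: "\<And>i. i < n \<Longrightarrow> tends T (b i) = {P i, P (Suc i)}"
    using path by (auto simp: is_path_def)
  have P_eq: "P i = P j \<longleftrightarrow> i = j" if "i \<le> n" "j \<le> n" for i j
    using injP that by (auto simp: inj_on_def)
  have td_verts: "\<forall>N \<in> tverts T. matroid N \<and> connected_matroid N"
    and td_ground: "ground M = (\<Union>N \<in> tverts T. ground N) - tedges T"
    and td_edge: "\<forall>x \<in> tedges T. \<forall>N1 N2. tends T x = {N1, N2} \<longrightarrow> ground N1 \<inter> ground N2 = {x}"
    and td_far: "\<forall>N1 \<in> tverts T. \<forall>N2 \<in> tverts T.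
      N1 \<noteq> N2 \<and> (N1, N2) \<notin> tadjacent T \<longrightarrow> ground N1 \<inter> ground N2 = {}"
    and td_contract: "\<exists>T'. contract_step\<^sup>*\<^sup>* T T' \<and> tverts T' = {M} \<and> tedges T' = {}"
    using td unfolding tree_decomposition_def by - (elim conjE, assumption)+
  have mat: "matroid (P i)" if "i \<le> n" for i
    using td_verts V that by auto
  have fin: "finite (ground (P i))" if "i \<le> n" for i using mat[OF that] by (simp add: matroid_def)
  have edge: "ground (P i) \<inter> ground (P (Suc i)) = {b i}" if "i < n" for i
    using td_edge te[OF that] E that by auto
  have ef: "e \<notin> tedges T" "f \<notin> tedges T"
    using td_ground e f by auto
  have far: "ground (P i) \<inter> ground (P j) = {}" if ij: "Suc i < j" "j \<le> n" for i j
  proof -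
    have "(P i, P j) \<notin> tadjacent T"
    proof
      assume "(P i, P j) \<in> tadjacent T"
      then obtain k where "k < n" "tends T (b k) = {P i, P j}" using E by (auto simp: tadjacent_def)
      then show False using te[of k] P_eq ij by (auto simp: doubleton_eq_iff)
    qed
    moreover have "P i \<in> tverts T" "P j \<in> tverts T" "P i \<noteq> P j" using V ij P_eq[of i j] by auto
    ultimately show ?thesis using td_far by blast
  qed
  \<comment> \<open>\<open>s i\<close> is the entry of \<open>P i\<close> and
    \<open>s (Suc i)\<close> its exit: \<open>e\<close> and \<open>f\<close> at the extremes, edges
    in between, shifted by one to make room for \<open>e\<close> at index 0.\<close>
  define s where "s i = (if i = 0 then e else if i = Suc n then f else b (i - 1))" for i
  have s_in: "s i \<in> ground (P i)" "s (Suc i) \<in> ground (P i)" if "i \<le> n" for i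
  proof -
    show "s i \<in> ground (P i)"
    proof (cases i)
      case 0
      then show ?thesis using e(2) by (simp add: s_def)
    next
      case (Suc j)
      then show ?thesis using edge[of j] that by (auto simp: s_def)
    qed
    show "s (Suc i) \<in> ground (P i)"
      using edge[of i] that f(2) by (cases "i = n") (auto simp: s_def)
  qed
  have bP: "b j \<in> ground (P i) \<longleftrightarrow> i = j \<or> i = Suc j" if ij: "j < n" "i \<le> n" for i j
  proof
    assume bi: "b j \<in> ground (P i)"
    have bj: "b j \<in> ground (P j)" "b j \<in> ground (P (Suc j))" using edge[OF ij(1)] by auto
    show "i = j \<or> i = Suc j"
    proof (rule ccontr)
      assume "\<not> (i = j \<or> i = Suc j)"
      then have "Suc i < Suc j \<or> Suc j < i" by linarith
      then show False using far[of i "Suc j"] far[of j i] bi bj ij by auto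
    qed
  next
    assume "i = j \<or> i = Suc j"
    then show "b j \<in> ground (P i)" using edge[OF ij(1)] by auto
  qed
  have s_ne: "s i \<noteq> s (Suc i)" if i: "i \<le> n" for i
  proof (cases "i = 0 \<or> i = n")
    case True
    then show ?thesis using ef E \<open>e \<noteq> f\<close> i by (auto simp: s_def)
  next
    case False
    then obtain j where j: "i = Suc j" "Suc j < n" using i by (cases i) auto
    have "b j \<noteq> b (Suc j)" using bP[of j j] bP[of "Suc j" j] j by auto
    then show ?thesis using j by (simp add: s_def)
  qed
  \<comment> \<open>The two end vertices can share only an edge, so each of them contains just one
    of \<open>e\<close> and \<open>f\<close>.\<close>
  have apart: "e \<notin> ground (P n)" "f \<notin> ground (P 0)" if "n \<noteq> 0"
  proof -
    have "ground (P 0) \<inter> ground (P n) \<subseteq> tedges T"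
    proof (cases "n = 1")
      case True
      then show ?thesis using edge[of 0] E by auto
    next
      case False
      then show ?thesis using far[of 0 n] that by auto
    qed
    then show "e \<notin> ground (P n)" "f \<notin> ground (P 0)" using ef e(2) f(2) by auto
  qed
  have pair: "(if n = 0 then {e, f} else basepoints T (P i) \<union>
      (if i = 0 \<or> i = n then {e, f} \<inter> ground (P i) else {})) = {s i, s (Suc i)}" if i: "i \<le> n" for i
  proof (cases "n = 0")
    case True
    then show ?thesis using i by (simp add: s_def)
  next
    case False
    have base: "basepoints T (P i) = b ` {j. j < n \<and> (i = j \<or> i = Suc j)}"
      using bP[OF _ i] E by (auto simp: basepoints_def)
    consider "i = 0" | "i \<noteq> 0" "i = n" | "i \<noteq> 0" "i \<noteq> n" by blast
    then show ?thesis
    proof cases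
      case 1
      then have "{j. j < n \<and> (i = j \<or> i = Suc j)} = {0}" using False by auto
      then show ?thesis using base 1 False apart e by (auto simp: s_def)
    next
      case 2
      then have "{j. j < n \<and> (i = j \<or> i = Suc j)} = {n - 1}" using False by auto
      then show ?thesis using base 2 False apart f by (auto simp: s_def)
    next
      case 3
      then have "{j. j < n \<and> (i = j \<or> i = Suc j)} = {i - 1, i}" using i by auto
      then show ?thesis using base 3 False i by (auto simp: s_def)
    qed
  qed
  have span: "spanning_between (P i) (s i) (s (Suc i))" if i: "i \<le> n" for i
    using lab[OF i] unfolding pair[OF i] labeled_circuit_def labeled_cocircuit_def
    using spanning_between_uniform[OF mat[OF i]] spanning_between_spike[OF _ _ mat[OF i]] by blast
  define idx where "idx = the_inv_into {0..n} P"
  have idx: "idx (P i) = i" if "i \<le> n" for i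
    using that injP by (simp add: idx_def the_inv_into_f_f)
  have s_edge: "s i \<in> insert e (tedges T)" if "i \<le> n" for i
    using that E by (auto simp: s_def)
  have s_edge': "s (Suc i) \<in> insert f (tedges T)" if "i \<le> n" for i
    using that E by (auto simp: s_def)
  let ?in = "\<lambda>N. s (idx N)" and ?out = "\<lambda>N. s (Suc (idx N))"
  have "oriented_path e f T ?in ?out idx"
    unfolding oriented_path_def
  proof (intro conjI)
    show "\<forall>N \<in> tverts T. oriented_vertex e f T ?in ?out N"
      unfolding V oriented_vertex_def using idx fin s_in s_ne span s_edge s_edge' by simp
    have up: "crossing ?in ?out idx z (P i) (P j)"
      if ij: "i < j" "j \<le> n" and z: "z \<in> ground (P i) \<inter> ground (P j)" for i j z
    proof -
      have j: "j = Suc i" using far[of i j] ij z by (metis Suc_lessI empty_iff)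
      then have "z = b i" using edge[of i] ij z by auto
      then show ?thesis using j ij by (simp add: crossing_def idx s_def)
    qed
    show "\<forall>N \<in> tverts T. \<forall>N' \<in> tverts T. \<forall>z \<in> ground N \<inter> ground N'. N \<noteq> N' \<longrightarrow>
        crossing ?in ?out idx z N N' \<or> crossing ?in ?out idx z N' N"
    proof (intro ballI impI)
      fix N N' z assume "N \<in> tverts T" "N' \<in> tverts T" "N \<noteq> N'" "z \<in> ground N \<inter> ground N'"
      moreover from this obtain i j where "i \<le> n" "j \<le> n" "N = P i" "N' = P j" using V by auto
      ultimately show "crossing ?in ?out idx z N N' \<or> crossing ?in ?out idx z N' N"
        using up[of i j z] up[of j i z] by (metis Int_commute nat_neq_iff)
    qed
    show "\<forall>x \<in> tedges T. \<exists>N \<in> tverts T. \<exists>N' \<in> tverts T.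
        tends T x = {N, N'} \<and> crossing ?in ?out idx x N N'"
    proof
      fix x assume "x \<in> tedges T"
      then obtain i where i: "i < n" "x = b i" using E by auto
      have "P i \<in> tverts T" "P (Suc i) \<in> tverts T" using V i(1) by auto
      moreover have "tends T x = {P i, P (Suc i)}" using te i by simp
      moreover have "crossing ?in ?out idx x (P i) (P (Suc i))"
        using i by (simp add: crossing_def idx s_def)
      ultimately show "\<exists>N \<in> tverts T. \<exists>N' \<in> tverts T.
        tends T x = {N, N'} \<and> crossing ?in ?out idx x N N'"
        by - (rule bexI[where x = "P i"], rule bexI[where x = "P (Suc i)"], intro conjI, assumption+)
    qed
  qed
  moreover obtain T' where T': "contract_step\<^sup>*\<^sup>* T T'" "tverts T' = {M}" "tedges T' = {}"
    using td_contract by blast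
  ultimately show ?thesis by (intro oriented_path_contract[OF T'(1) _ T'(2,3)])
qed

text \<open>A larger independent set would augment \<open>C - {e}\<close>. The new element is either
  \<open>e\<close>, which restores \<open>C\<close>, or outside \<open>C\<close>, which the exchange
  property excludes; so \<open>C - {e}\<close> has the size of the rank.\<close>

lemma spanning_between_imp_spanning:
  assumes M: "matroid M" and sb: "spanning_between (relabel Inl M :: ('a + nat) matroid) (Inl e) (Inl f)"
    and C: "circuit M C" "e \<in> C" "f \<in> C"
  shows "spanning M C"
proof -
  let ?M = "relabel Inl M :: ('a + nat) matroid"
  have m: "finite (ground M)" "indeps M \<subseteq> Pow (ground M)" "{} \<in> indeps M"
    and aug: "\<And>I J. I \<in> indeps M \<Longrightarrow> J \<in> indeps M \<Longrightarrow> card I < card J \<Longrightarrow> \<exists>x \<in> J - I. insert x I \<in> indeps M"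
    using M unfolding matroid_def by blast+
  have ind: "Inl ` I \<in> indeps ?M \<longleftrightarrow> I \<in> indeps M" for I
    by (auto simp: relabel_def inj_image_eq_iff)
  have iso: "matroid_iso Inl M ?M"
    unfolding matroid_iso_def using ind by (auto simp: relabel_def bij_betw_def)
  have C': "circuit ?M (Inl ` C)" by (rule circuit_iso[OF iso C(1)])
  have dep: "insert x (C - {e}) \<notin> indeps M" if "x \<in> ground M - C" for x
  proof -
    have "insert (Inl x) (Inl ` C - {Inl e}) \<notin> indeps ?M"
      using sb C' C that unfolding spanning_between_def by (auto simp: relabel_def)
    moreover have "insert (Inl x) (Inl ` C - {Inl e}) = Inl ` (insert x (C - {e}))" by auto
    ultimately show ?thesis using ind by metis
  qed
  have finC: "finite C" using C(1) m finite_subset by (auto simp: circuit_def)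
  have I: "C - {e} \<in> indeps M" by (rule circuit_proper_subset_indep[OF C(1)]) (use C in blast)
  have "matroid_rank M (ground M) \<le> card (C - {e})"
  proof (rule matroid_rank_le[OF m])
    fix J assume J: "J \<in> indeps M"
    show "card J \<le> card (C - {e})"
    proof (rule ccontr)
      assume "\<not> card J \<le> card (C - {e})"
      then obtain x where x: "x \<in> J - (C - {e})" "insert x (C - {e}) \<in> indeps M"
        using aug[OF I J] by auto
      show False
      proof (cases "x \<in> C")
        case True
        then have "insert x (C - {e}) = C" using x by auto
        then show False using x C(1) by (auto simp: circuit_def)
      next
        case False
        then show False using dep[of x] x J m(2) by blast
      qed
    qed
  qed
  moreover have "matroid_rank M C + 1 = card C" by (rule matroid_rank_circuit[OF M C(1)]) (use C in blast)
  moreover have "card (C - {e}) = card C - 1" using C(2) by simp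
  moreover have "card (C - {e}) \<le> matroid_rank M (ground M)"
    by (rule card_le_matroid_rank[OF m(1,2) I]) (use I m(2) in blast)
  ultimately show ?thesis unfolding spanning_def by linarith
qed

theorem theorem4p1:
  fixes M :: "'a matroid" and e f :: 'a
  assumes "matroid M" and "simple_matroid M" and "connected_matroid M" and "binary_matroid M"
    and "e \<in> ground M" and "f \<in> ground M" and "e \<noteq> f"
  shows "(\<forall>C. circuit M C \<and> {e, f} \<subseteq> C \<longrightarrow> spanning M C) \<longleftrightarrow>
    (\<exists>(T :: ('a + nat) matroid_graph) n P.
       canonical_tree_decomposition T (relabel Inl M) \<and> is_path T n P \<and>
       (\<forall>i\<le>n. (\<exists>k\<ge>3. labeled_circuit k (P i)) \<or>
               isomorphic_matroid (P i) (uniform_matroid 1 3) \<or>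
               (\<exists>r\<ge>3. isomorphic_matroid (P i) (cotipped_spike r))) \<and>
       \<not> isomorphic_matroid (P 0) (uniform_matroid 1 3) \<and>
       \<not> isomorphic_matroid (P n) (uniform_matroid 1 3) \<and>
       (n = 0 \<longrightarrow>
          (\<forall>r\<ge>3. isomorphic_matroid (P 0) (cotipped_spike r) \<longrightarrow>
                  tip_cotip_pair r (P 0) {Inl e, Inl f})) \<and>
       (n \<ge> 1 \<longrightarrow>
          ((Inl e \<in> ground (P 0) \<and> Inl f \<in> ground (P n)) \<or>
           (Inl f \<in> ground (P 0) \<and> Inl e \<in> ground (P n))) \<and>
          (\<forall>i\<le>n. \<forall>r\<ge>3. isomorphic_matroid (P i) (cotipped_spike r) \<longrightarrow>
             (0 < i \<and> i < n \<longrightarrow> tip_cotip_pair r (P i) (basepoints T (P i))) \<and>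
             (i = 0 \<or> i = n \<longrightarrow>
                tip_cotip_pair r (P i) (basepoints T (P i) \<union> ({Inl e, Inl f} \<inter> ground (P i)))))))"
  (is "?span \<longleftrightarrow> (\<exists>T n P. ?decomp T n P)")
proof
  assume span: ?span
  obtain A X Z where cd: "chord_data e f X Z" and MA: "M = chorded A e f X Z"
    and fam: "chord_family A X Z" and proper: "\<forall>z \<in> Z. A z \<inter> X \<noteq> {} \<and> \<not> X \<subseteq> A z"
    using chorded_of_spanning_circuits[OF assms span] by blast
  let ?A = "lift_chord A" and ?X = "Inl ` X :: ('a + nat) set" and ?Z = "Inl ` Z :: ('a + nat) set"
  \<comment> \<open>An empty \<open>X\<close> would make \<open>e\<close> and \<open>f\<close>
    parallel.\<close>
  have "X \<noteq> {}"
  proof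
    assume "X = {}"
    then have "circuit M {e, f}" using circuit_whole[OF cd, of A] MA by simp
    moreover have "card {e, f} \<le> 2" by (simp add: card_insert_if)
    ultimately show False using assms(2) unfolding simple_matroid_def by blast
  qed
  then have X: "?X \<noteq> {}" by simp
  have cd': "chord_data (Inl e) (Inl f) ?X ?Z" using cd by (auto simp: chord_data_def)
  have proper': "\<forall>z \<in> ?Z. ?A z \<inter> ?X \<noteq> {} \<and> \<not> ?X \<subseteq> ?A z"
    using proper by auto
  \<comment> \<open>The basepoints are named by \<open>Inr\<close> elements, which cannot collide
    with the copy of \<open>M\<close>.\<close>
  have fresh: "range (Inr :: nat \<Rightarrow> 'a + nat) \<inter> ({Inl e, Inl f} \<union> ?X \<union> ?Z) = {}" by auto
  obtain n Xs Zs q where sp: "segment_path ?A n Xs Zs q" and q: "q 0 = Inl e" "q (Suc n) = Inl f"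
    and XZ: "(\<Union>i\<le>n. Xs i) = ?X" "(\<Union>i\<le>n. Zs i) = ?Z" and ends: "Xs 0 \<noteq> {}" "Xs n \<noteq> {}"
    using segment_path_exists[OF cd' chord_family_lift[OF fam] proper' X inj_Inr fresh]
    by (elim exE conjE) (rule that; assumption)
  interpret S: segment_path ?A n Xs Zs q by (rule sp)
  have Q: "relabel Inl M = S.Q n" unfolding MA relabel_Inl_chorded S.Q_def q XZ ..
  have iso13: "labeled_cocircuit 3 N \<longleftrightarrow> isomorphic_matroid N (uniform_matroid 1 3)"
    for N :: "('a + nat) matroid" by (simp add: labeled_cocircuit_def)
  have ef: "Inl e \<notin> ground (S.P i)" if "0 < i" "i \<le> n" for i
    using S.q_in_ground_P[of 0 i] that q by simp
  have ef': "Inl f \<notin> ground (S.P i)" if "i < n" for i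
    using S.q_in_ground_P[of "Suc n" i] that q by simp
  have pos: "Inl e \<in> ground (S.P 0)" "Inl f \<in> ground (S.P n)"
    using S.q_in_ground_P[of 0 0] S.q_in_ground_P[of "Suc n" n] q by simp_all
  have inner: "basepoints S.T (S.P i) = {q i, q (Suc i)}" if "0 < i" "i < n" for i
    using S.basepoints_P[of i] that by auto
  have outer: "basepoints S.T (S.P i) \<union> ({Inl e, Inl f} \<inter> ground (S.P i)) = {q i, q (Suc i)}"
    if n: "1 \<le> n" and i: "i = 0 \<or> i = n" for i
    using i
  proof
    assume "i = 0"
    moreover have "basepoints S.T (S.P 0) = {q (Suc 0)}"
      using n by (auto simp: S.basepoints_P)
    ultimately show ?thesis using n pos ef' q by auto
  next
    assume "i = n"
    moreover have "basepoints S.T (S.P n) = {q n}"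
      using n by (auto simp: S.basepoints_P)
    ultimately show ?thesis using n pos ef q by auto
  qed
  have "?decomp S.T n S.P"
  proof (intro conjI)
    show "canonical_tree_decomposition S.T (relabel Inl M)" unfolding Q by (rule S.canonical_T)
    show "is_path S.T n S.P" by (rule S.is_path_T)
    show "\<forall>i\<le>n. (\<exists>k\<ge>3. labeled_circuit k (S.P i)) \<or>
        isomorphic_matroid (S.P i) (uniform_matroid 1 3) \<or>
        (\<exists>r\<ge>3. isomorphic_matroid (S.P i) (cotipped_spike r))"
    proof (intro allI impI)
      fix i assume i: "i \<le> n"
      then show "(\<exists>k\<ge>3. labeled_circuit k (S.P i)) \<or>
          isomorphic_matroid (S.P i) (uniform_matroid 1 3) \<or>
          (\<exists>r\<ge>3. isomorphic_matroid (S.P i) (cotipped_spike r))"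
      proof (cases rule: S.P_cases)
        case circuit
        moreover have "finite (Xs i)" using S.finite_seg[OF i] by simp
        ultimately have "3 \<le> card (Xs i) + 2" by (simp add: Suc_le_eq card_gt_0_iff)
        then show ?thesis using circuit by blast
      next
        case (triangle z)
        then show ?thesis using iso13 by blast
      next
        case spike
        then show ?thesis by (auto simp: tip_cotip_pair_def isomorphic_matroid_def)
      qed
    qed
    show "\<not> isomorphic_matroid (S.P 0) (uniform_matroid 1 3)"
      using S.labeled_cocircuitD[of 0 3] ends iso13 by blast
    show "\<not> isomorphic_matroid (S.P n) (uniform_matroid 1 3)"
      using S.labeled_cocircuitD[of n 3] ends iso13 by blast
    show "n = 0 \<longrightarrow> (\<forall>r\<ge>3. isomorphic_matroid (S.P 0) (cotipped_spike r) \<longrightarrow>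
        tip_cotip_pair r (S.P 0) {Inl e, Inl f})"
      using S.isomorphic_spike_imp[of 0] q by auto
    show "n \<ge> 1 \<longrightarrow>
        ((Inl e \<in> ground (S.P 0) \<and> Inl f \<in> ground (S.P n)) \<or>
         (Inl f \<in> ground (S.P 0) \<and> Inl e \<in> ground (S.P n))) \<and>
        (\<forall>i\<le>n. \<forall>r\<ge>3. isomorphic_matroid (S.P i) (cotipped_spike r) \<longrightarrow>
           (0 < i \<and> i < n \<longrightarrow> tip_cotip_pair r (S.P i) (basepoints S.T (S.P i))) \<and>
           (i = 0 \<or> i = n \<longrightarrow>
              tip_cotip_pair r (S.P i) (basepoints S.T (S.P i) \<union> ({Inl e, Inl f} \<inter> ground (S.P i)))))"
    proof (intro impI conjI allI)
      fix i r assume n: "1 \<le> n" and i: "i \<le> n" and r: "3 \<le> r"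
        and iso: "isomorphic_matroid (S.P i) (cotipped_spike r)"
      note pair = S.isomorphic_spike_imp[OF i r iso]
      show "tip_cotip_pair r (S.P i) (basepoints S.T (S.P i))" if "0 < i \<and> i < n"
        using pair inner[of i] that by simp
      show "tip_cotip_pair r (S.P i) (basepoints S.T (S.P i) \<union> ({Inl e, Inl f} \<inter> ground (S.P i)))"
        if "i = 0 \<or> i = n"
        using pair unfolding outer[OF n that] .
    qed (use pos in simp)
  qed
  then show "\<exists>T n P. ?decomp T n P" by (intro exI)
next
  assume "\<exists>T n P. ?decomp T n P"
  then obtain T :: "('a + nat) matroid_graph" and n P where d: "?decomp T n P" by (elim exE)
  let ?M = "relabel Inl M :: ('a + nat) matroid"
  have path: "is_path T n P" and td: "tree_decomposition T ?M"
    using d by (simp_all add: canonical_tree_decomposition_def)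
  have V: "tverts T = P ` {0..n}" using path by (simp add: is_path_def)
  have ground: "ground ?M = (\<Union>N \<in> tverts T. ground N) - tedges T"
    using td unfolding tree_decomposition_def by (elim conjE)
  have ef: "Inl e \<in> ground ?M" "Inl f \<in> ground ?M" using assms by (auto simp: relabel_def)
  have label: "(\<exists>k. labeled_circuit k (P i)) \<or> (\<exists>k. labeled_cocircuit k (P i)) \<or>
      (\<exists>r\<ge>1. tip_cotip_pair r (P i) (if n = 0 then {Inl e, Inl f}
        else basepoints T (P i) \<union> (if i = 0 \<or> i = n then {Inl e, Inl f} \<inter> ground (P i) else {})))"
    if i: "i \<le> n" for i
  proof -
    consider k where "labeled_circuit k (P i)" | "isomorphic_matroid (P i) (uniform_matroid 1 3)"
      | r where "3 \<le> r" "isomorphic_matroid (P i) (cotipped_spike r)"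
      using d i by blast
    then show ?thesis
    proof cases
      case 2
      then have "labeled_cocircuit 3 (P i)" by (simp add: labeled_cocircuit_def)
      then show ?thesis by blast
    next
      case 3
      have "tip_cotip_pair r (P i) (if n = 0 then {Inl e, Inl f}
        else basepoints T (P i) \<union> (if i = 0 \<or> i = n then {Inl e, Inl f} \<inter> ground (P i) else {}))"
        using d 3 i by (cases "n = 0"; cases "i = 0 \<or> i = n") auto
      moreover have "1 \<le> r" using 3 by simp
      ultimately show ?thesis by blast
    qed blast
  qed
  \<comment> \<open>A single vertex contains both elements. On a longer path either order may occur,
    and the reversed one is settled by the symmetry of the exchange property.\<close>
  have "Inl e \<in> ground (P 0) \<and> Inl f \<in> ground (P n) \<or> Inl f \<in> ground (P 0) \<and> Inl e \<in> ground (P n)"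
  proof (cases "n = 0")
    case True
    then show ?thesis using ef ground V by auto
  next
    case False
    then show ?thesis using d by simp
  qed
  then have "spanning_between ?M (Inl e) (Inl f)"
  proof
    assume "Inl e \<in> ground (P 0) \<and> Inl f \<in> ground (P n)"
    then show ?thesis
      using path_spanning_between[OF td path label] ef assms(7) by blast
  next
    assume "Inl f \<in> ground (P 0) \<and> Inl e \<in> ground (P n)"
    then have "spanning_between ?M (Inl f) (Inl e)"
      using path_spanning_between[OF td path label[unfolded insert_commute[of "Inl e" "Inl f"]]] ef assms(7)
      by blast
    then show ?thesis by (rule spanning_between_sym)
  qed
  then show ?span using spanning_between_imp_spanning[OF assms(1)] by blast
qed

end
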